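(* Let $\delta\in(0,1)$. Suppose that (i) $\rho_{\min}(R)>0$; and (ii) for some real number $t_{\delta,R}\ge 128\,\frac{\ln(6K/\delta)}{\rho_{\min}(R)}$, one has for all $i\in\{1,\dots,K\}$ $$\sigma^T\Sigma^{2i-1}\sigma\ \ge\ t_{\delta,R}\,\frac{\tau^2}{n}\,K\,\rho(\Sigma)^i\,\mathrm{Tr}(\Sigma^i).$$ Then, with probability larger than $1-\delta$ (with respect to $\varepsilon$), $$\frac1n\|X\hat\beta_K-X\beta\|^2\le \frac2n\inf_{v\in[G]}\|X(\beta-v)\|^2+D_{\delta,R}\frac{\tau^2}{n}\max\left(\mathrm{Cond}(D)\|\Lambda\|^2\sum_{i=1}^K\mathrm{Tr}(\Sigma^{2i}),\ \sqrt{\mathrm{Cond}(D)\|\Lambda\|^2\sum_{i=1}^K\mathrm{Tr}(\Sigma^i)^2}\right),$$ for some constant $D_{\delta,R}$ depending only on $\delta$ and $R$.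
   Context: Model: $X\in\mathbb{R}^{n\times p}$ is a deterministic matrix, $\beta\in\mathbb{R}^p$, $\tau>0$, $\varepsilon\sim\mathcal N_n(0,\tau^2I_n)$ and $Y=X\beta+\varepsilon$. Put $\Sigma=\frac1nX^TX$, $\hat\sigma=\frac1nX^TY$ and $\sigma=\mathbb{E}(\hat\sigma)=\Sigma\beta$. Fix $K\in\{1,\dots,p\}$. Krylov matrices: $G=(\sigma,\Sigma\sigma,\dots,\Sigma^{K-1}\sigma)\in\mathbb{R}^{p\times K}$, $\hat G=(\hat\sigma,\Sigma\hat\sigma,\dots,\Sigma^{K-1}\hat\sigma)$, $\Theta=G^T\Sigma G=(\sigma^T\Sigma^{i+j-1}\sigma)_{i,j=1}^K$, $\hat\Theta=\hat G^T\Sigma\hat G$. $D=\mathrm{diag}(\Theta)$ is the diagonal matrix with the same diagonal as $\Theta$, and $R=D^{-1/2}\Theta D^{-1/2}\in\mathbb{R}^{K\times K}$ (the condition $\rho_{\min}(R)>0$ includes that the diagonal entries of $D$ are positive, so that $R$ is well defined; then $\Theta$ is invertible). $\Lambda=\Theta^{-1}G^T\sigma\in\mathbb{R}^K$. PLS estimator with $K$ components: $\hat\beta_K\in\arg\min_{b\in[\hat G]}\|Y-Xb\|^2$, which equals $\hat G\hat\Theta^{-1}\hat G^T\hat\sigma$ when $\hat\Theta$ has full rank. Notation: $[A]$ is the column span of a matrix $A$; $\rho(A)$ and $\rho_{\min}(A)$ are the largest and smallest eigenvalues of a symmetric positive (semi-)definite matrix $A$; $\mathrm{Cond}(A)=\rho(A)/\rho_{\min}(A)$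 is the condition number; $\|\cdot\|$ is the Euclidean norm. *)

theory Defs
  imports
    "HOL-Probability.Probability"
    "Jordan_Normal_Form.Spectral_Radius"
    "Jordan_Normal_Form.Gauss_Jordan_Elimination"
begin

text \<open>Dimensions are values (carrier-based matrices of Jordan_Normal_Form) rather than types, so
  that a constant can be chosen before \<open>n\<close>, \<open>p\<close> and \<open>K\<close> are quantified. Throughout, \<open>X\<close> is the
  \<open>n \<times> p\<close> design matrix, with \<open>n = dim_row X\<close> and \<open>p = dim_col X\<close>.\<close>

definition enorm :: "real Matrix.vec \<Rightarrow> real" where
  "enorm v = sqrt (scalar_prod v v)"

definition mat_trace :: "real Matrix.mat \<Rightarrow> real" where
  "mat_trace A = (\<Sum>i<dim_row A. A $$ (i, i))"

text \<open>The next three are only meaningful for non-empty symmetric matrices, whose spectrum over the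
  reals is finite and non-empty.\<close>

definition max_eigenvalue :: "real Matrix.mat \<Rightarrow> real" where
  "max_eigenvalue A = Max (spectrum A)"

definition min_eigenvalue :: "real Matrix.mat \<Rightarrow> real" where
  "min_eigenvalue A = Min (spectrum A)"

definition cond_number :: "real Matrix.mat \<Rightarrow> real" where
  "cond_number A = max_eigenvalue A / min_eigenvalue A"

abbreviation column_span :: "real Matrix.mat \<Rightarrow> real Matrix.vec set" where
  "column_span A \<equiv> vec_space.col_space (dim_row A) A"

definition Sigma_mat :: "real Matrix.mat \<Rightarrow> real Matrix.mat" where
  "Sigma_mat X = (1 / real (dim_row X)) \<cdot>\<^sub>m (transpose_mat X * X)"

definition sigma_hat :: "real Matrix.mat \<Rightarrow> real Matrix.vec \<Rightarrow> real Matrix.vec" where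
  "sigma_hat X Y = (1 / real (dim_row X)) \<cdot>\<^sub>v (transpose_mat X *\<^sub>v Y)"

text \<open>The expectation of \<open>sigma_hat X Y\<close> for \<open>Y = X \<beta> + \<epsilon>\<close> with centred noise \<open>\<epsilon>\<close>.\<close>

definition sigma_vec :: "real Matrix.mat \<Rightarrow> real Matrix.vec \<Rightarrow> real Matrix.vec" where
  "sigma_vec X \<beta> = Sigma_mat X *\<^sub>v \<beta>"

text \<open>The matrix with columns \<open>v, A v, \<dots>, A\<^sup>K\<^sup>-\<^sup>1 v\<close>.\<close>

definition krylov_mat :: "real Matrix.mat \<Rightarrow> real Matrix.vec \<Rightarrow> nat \<Rightarrow> real Matrix.mat" where
  "krylov_mat A v K = mat_of_cols (dim_vec v) (map (\<lambda>i. (A ^\<^sub>m i) *\<^sub>v v) [0..<K])"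

definition G_mat :: "real Matrix.mat \<Rightarrow> real Matrix.vec \<Rightarrow> nat \<Rightarrow> real Matrix.mat" where
  "G_mat X \<beta> K = krylov_mat (Sigma_mat X) (sigma_vec X \<beta>) K"

definition G_hat :: "real Matrix.mat \<Rightarrow> real Matrix.vec \<Rightarrow> nat \<Rightarrow> real Matrix.mat" where
  "G_hat X Y K = krylov_mat (Sigma_mat X) (sigma_hat X Y) K"

definition Theta_mat :: "real Matrix.mat \<Rightarrow> real Matrix.vec \<Rightarrow> nat \<Rightarrow> real Matrix.mat" where
  "Theta_mat X \<beta> K = transpose_mat (G_mat X \<beta> K) * Sigma_mat X * G_mat X \<beta> K"

definition D_mat :: "real Matrix.mat \<Rightarrow> real Matrix.vec \<Rightarrow> nat \<Rightarrow> real Matrix.mat" where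
  "D_mat X \<beta> K = mat_diag K (\<lambda>i. Theta_mat X \<beta> K $$ (i, i))"

text \<open>\<open>D\<^sup>-\<^sup>1\<^sup>/\<^sup>2\<close>; only meaningful if the diagonal of \<open>D\<close> is positive.\<close>

definition D_inv_sqrt :: "real Matrix.mat \<Rightarrow> real Matrix.vec \<Rightarrow> nat \<Rightarrow> real Matrix.mat" where
  "D_inv_sqrt X \<beta> K = mat_diag K (\<lambda>i. 1 / sqrt (D_mat X \<beta> K $$ (i, i)))"

definition R_mat :: "real Matrix.mat \<Rightarrow> real Matrix.vec \<Rightarrow> nat \<Rightarrow> real Matrix.mat" where
  "R_mat X \<beta> K = D_inv_sqrt X \<beta> K * Theta_mat X \<beta> K * D_inv_sqrt X \<beta> K"

text \<open>\<open>\<Theta>\<^sup>-\<^sup>1 G\<^sup>T \<sigma>\<close>; \<open>mat_inverse\<close> returns an option and is \<open>Some\<close> iff \<open>\<Theta>\<close> is invertible.\<close>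

definition Lambda_vec :: "real Matrix.mat \<Rightarrow> real Matrix.vec \<Rightarrow> nat \<Rightarrow> real Matrix.vec" where
  "Lambda_vec X \<beta> K =
     the (mat_inverse (Theta_mat X \<beta> K)) *\<^sub>v (transpose_mat (G_mat X \<beta> K) *\<^sub>v sigma_vec X \<beta>)"

text \<open>The minimiser need not be unique when \<open>\<Theta>\<close>-hat is singular, hence a predicate; the fitted
  value \<open>X b\<close> is unique in any case.\<close>

definition is_pls :: "real Matrix.mat \<Rightarrow> nat \<Rightarrow> real Matrix.vec \<Rightarrow> real Matrix.vec \<Rightarrow> bool" where
  "is_pls X K Y b \<longleftrightarrow>
     is_arg_min (\<lambda>b. (enorm (Y - X *\<^sub>v b))\<^sup>2) (\<lambda>b. b \<in> column_span (G_hat X Y K)) b"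

text \<open>The law \<open>N\<^sub>n(0, \<tau>\<^sup>2 I\<^sub>n)\<close>, on coordinate functions \<open>{..<n} \<rightarrow> \<real>\<close>; a sample \<open>\<omega>\<close> is
  turned into a vector by \<open>Matrix.vec n \<omega>\<close>. The second parameter of \<open>normal_density\<close> is the
  standard deviation.\<close>

definition gaussian_noise :: "nat \<Rightarrow> real \<Rightarrow> (nat \<Rightarrow> real) measure" where
  "gaussian_noise n \<tau> = PiM {..<n} (\<lambda>_. density lborel (\<lambda>x. ennreal (normal_density 0 \<tau> x)))"

end

theory Submission
  imports Defs
begin

unbundle no inner_syntax
unbundle no vec_syntax

text \<open>Write \<open>\<epsilon>\<close> for the noise, \<open>m = X \<beta>\<close>, \<open>A = X G\<close> and \<open>A + H = X G\<close>-hat; the matrix \<open>H\<close> is the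
  Krylov design of the noise. The fitted value is the orthogonal projection of \<open>m + \<epsilon>\<close> onto the
  range of \<open>A + H\<close>, so the loss is the squared distance of \<open>m\<close> from this range plus the squared norm
  of the projected noise. The competitor \<open>(A + H) \<Lambda>\<close> bounds the distance by twice the oracle term
  plus twice \<open>\<parallel>H \<Lambda>\<parallel>\<^sup>2\<close>. Hypothesis (ii) makes \<open>H\<close> small relative to \<open>A\<close> in the metric of \<open>D\<close>, so
  the Gram matrix of \<open>A + H\<close> dominates a multiple of \<open>D\<close>; the projected noise is then controlled
  by a coefficient vector of norm at most a constant times \<open>Cond(D)\<^sup>1\<^sup>/\<^sup>2 \<parallel>\<Lambda>\<parallel>\<close>, because the normal
  equations \<open>\<Theta> \<Lambda> = G\<^sup>T \<sigma>\<close> bound the noise level by \<open>\<Sum> D\<^sub>i \<Lambda>\<^sub>i\<^sup>2\<close>. Every random quantity is a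
  weighted sum of squared Gaussian linear forms, for which a single exponential tail bound suffices.\<close>

section \<open>Gaussian quadratic forms\<close>

text \<open>Three obstacles shape the argument. The contribution of \<open>A\<^sup>T e\<close> to
  the projected noise yields a term without any factor \<open>\<Lambda>\<close>, whereas both
  members of the maximum carry \<open>Cond(D) \<parallel>\<Lambda>\<parallel>\<^sup>2\<close>; it is
  absorbed by means of the lower bound 1 \<le> \<open>K \<parallel>\<Lambda>\<parallel>\<^sup>2
  \<Sum> Tr(\<Sigma>\<^sup>2\<^sup>i)\<close>, a second consequence of the normal equations. The
  contribution of \<open>H\<^sup>T e\<close> is quadratic in the noise, and the target allows it
  only as a square root of \<open>\<Sum> Tr(\<Sigma>\<^sup>i)\<^sup>2\<close>. One Cauchy-Schwarz
  step in the metric of \<open>D\<close> does not give this, so that step serves only to bound the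
  coefficient vector, and the bound is then fed into a second, Euclidean Cauchy-Schwarz step. In
  both places hypothesis (ii) is used through the ratio
  \<open>Tr(\<Sigma>) / \<rho>(\<Sigma>)\<close>, the effective rank of \<open>\<Sigma>\<close>,
  which links the traces to the diagonal of \<open>D\<close>. Finally the estimator is an arbitrary
  selection of minimisers, so the loss event is not measurable by construction; its measurability is
  proved from the uniqueness of the fitted value.\<close>

lemma prob_space_gaussian_noise: "0 < \<tau> \<Longrightarrow> prob_space (gaussian_noise n \<tau>)"
  unfolding gaussian_noise_def by (intro prob_space_PiM prob_space_normal_density)

lemma sets_gaussian_noise: "sets (gaussian_noise n \<tau>) = sets (PiM {..<n} (\<lambda>_. borel))"
  unfolding gaussian_noise_def by (intro sets_PiM_cong) auto

lemma measurable_gaussian_noise_coord[measurable]: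
  "k < n \<Longrightarrow> (\<lambda>\<omega>. \<omega> k) \<in> borel_measurable (gaussian_noise n \<tau>)"
  by (simp add: measurable_cong_sets[OF sets_gaussian_noise refl])

text \<open>The target \<open>N\<close> is left open because \<open>distributed\<close> asks for
  \<open>lborel\<close>, while independence is phrased with \<open>borel\<close>.\<close>

lemma distr_gaussian_noise_coord:
  assumes \<tau>: "0 < \<tau>" and k: "k < n" and N: "sets N = sets borel"
  shows "distr (gaussian_noise n \<tau>) N (\<lambda>\<omega>. \<omega> k)
    = density lborel (\<lambda>x. ennreal (normal_density 0 \<tau> x))"
proof -
  let ?N = "density lborel (\<lambda>x. ennreal (normal_density 0 \<tau> x))"
  have "distr (gaussian_noise n \<tau>) N (\<lambda>\<omega>. \<omega> k) = distr (gaussian_noise n \<tau>) ?N (\<lambda>\<omega>. \<omega> k)"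
    by (intro distr_cong) (simp_all add: N)
  also have "\<dots> = ?N"
    unfolding gaussian_noise_def
    by (rule distr_PiM_component) (use k \<tau> in \<open>auto intro: prob_space_normal_density\<close>)
  finally show ?thesis .
qed

lemma gaussian_noise_coord_distributed:
  assumes \<tau>: "0 < \<tau>" and k: "k < n"
  shows "distributed (gaussian_noise n \<tau>) lborel (\<lambda>\<omega>. \<omega> k) (normal_density 0 \<tau>)"
  unfolding distributed_def using k by (auto simp: distr_gaussian_noise_coord[OF \<tau> k])

text \<open>Independence amounts to the joint law being the product of the marginals; here the joint
  law is that of the identity map on a product measure.\<close>

lemma gaussian_noise_indep:
  assumes \<tau>: "0 < \<tau>" and n: "0 < n"
  shows "prob_space.indep_vars (gaussian_noise n \<tau>) (\<lambda>_. borel) (\<lambda>k \<omega>. \<omega> k) {..<n}"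
proof -
  interpret prob_space "gaussian_noise n \<tau>" by (rule prob_space_gaussian_noise[OF \<tau>])
  let ?N = "density lborel (\<lambda>x. ennreal (normal_density 0 \<tau> x))"
  have "distr (gaussian_noise n \<tau>) (PiM {..<n} (\<lambda>_. borel)) (\<lambda>\<omega>. \<lambda>i\<in>{..<n}. \<omega> i)
      = distr (gaussian_noise n \<tau>) (gaussian_noise n \<tau>) (\<lambda>\<omega>. \<omega>)"
  proof (rule distr_cong)
    fix \<omega> assume "\<omega> \<in> space (gaussian_noise n \<tau>)"
    then show "(\<lambda>i\<in>{..<n}. \<omega> i) = \<omega>"
      by (auto simp: gaussian_noise_def space_PiM)
  qed (simp_all add: sets_gaussian_noise)
  also have "\<dots> = PiM {..<n} (\<lambda>_. ?N)"
    by (simp add: distr_id gaussian_noise_def)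
  also have "\<dots> = PiM {..<n} (\<lambda>i. distr (gaussian_noise n \<tau>) borel (\<lambda>\<omega>. \<omega> i))"
    by (intro PiM_cong) (auto simp: distr_gaussian_noise_coord[OF \<tau>])
  finally show ?thesis
    by (subst indep_vars_iff_distr_eq_PiM') (use n in auto)
qed

lemma gaussian_linear_form_distributed:
  assumes \<tau>: "0 < \<tau>" and b: "\<exists>k<n. b k \<noteq> (0::real)"
  shows "distributed (gaussian_noise n \<tau>) lborel (\<lambda>\<omega>. \<Sum>k<n. b k * \<omega> k)
    (normal_density 0 (\<tau> * sqrt (\<Sum>k<n. (b k)\<^sup>2)))"
proof -
  interpret prob_space "gaussian_noise n \<tau>" by (rule prob_space_gaussian_noise[OF \<tau>])
  \<comment> \<open>Zero coefficients are dropped since \<open>sum_indep_normal\<close> requires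
    positive standard deviations and a non-empty index set.\<close>
  define S where "S = {k. k < n \<and> b k \<noteq> 0}"
  have S: "finite S" "S \<noteq> {}" "S \<subseteq> {..<n}" using b by (auto simp: S_def)
  have n: "0 < n" using b by auto
  have "distributed (gaussian_noise n \<tau>) lborel (\<lambda>\<omega>. \<Sum>k\<in>S. b k * \<omega> k)
      (normal_density (\<Sum>k\<in>S. 0) (sqrt (\<Sum>k\<in>S. (\<bar>b k\<bar> * \<tau>)\<^sup>2)))"
  proof (rule sum_indep_normal[OF S(1,2)])
    show "indep_vars (\<lambda>_. borel) (\<lambda>k \<omega>. b k * \<omega> k) S"
      by (rule indep_vars_compose2[OF indep_vars_subset[OF gaussian_noise_indep[OF \<tau> n] S(3)],
          where Y = "\<lambda>k x. b k * x"]) auto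
    fix k assume k: "k \<in> S"
    show "0 < \<bar>b k\<bar> * \<tau>" using k \<tau> by (auto simp: S_def)
    show "distributed (gaussian_noise n \<tau>) lborel (\<lambda>\<omega>. b k * \<omega> k) (normal_density 0 (\<bar>b k\<bar> * \<tau>))"
      using normal_density_affine[OF gaussian_noise_coord_distributed[OF \<tau>, of k n] \<tau>, of "b k" 0] k
      by (auto simp: S_def)
  qed
  moreover have "(\<lambda>\<omega>. \<Sum>k\<in>S. b k * \<omega> k) = (\<lambda>\<omega>. \<Sum>k<n. b k * \<omega> k)"
    by (intro ext sum.mono_neutral_left) (auto simp: S_def)
  moreover have "(\<Sum>k\<in>S. (\<bar>b k\<bar> * \<tau>)\<^sup>2) = \<tau>\<^sup>2 * (\<Sum>k<n. (b k)\<^sup>2)"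
    unfolding sum_distrib_left
    by (intro sum.mono_neutral_cong_left) (auto simp: S_def power_mult_distrib)
  ultimately show ?thesis using \<tau> by (simp add: real_sqrt_mult)
qed

text \<open>The coefficient of x^2 in the exponent changes from -1/(2 s^2) to -1/(4 s^2), that is,
  the variance doubles; the normalising constants then differ by \<open>sqrt 2\<close>.\<close>

lemma normal_density_mult_exp_square:
  assumes "0 < s"
  shows "normal_density 0 s x * exp (x\<^sup>2 / (4 * s\<^sup>2)) = sqrt 2 * normal_density 0 (sqrt 2 * s) x"
proof -
  have "exp (- (x\<^sup>2 / (2 * s\<^sup>2))) * exp (x\<^sup>2 / (4 * s\<^sup>2)) = exp (- (x\<^sup>2 / (4 * s\<^sup>2)))"
    by (subst exp_add[symmetric], rule arg_cong[where f = exp]) (use assms in \<open>simp add: field_simps\<close>)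
  moreover have "sqrt (4 * (pi * s\<^sup>2)) = sqrt 2 * sqrt (2 * pi * s\<^sup>2)"
    by (subst real_sqrt_mult[symmetric]) simp
  ultimately show ?thesis
    using assms by (simp add: normal_density_def power_mult_distrib)
qed

text \<open>Tilting by a quarter of the normalised square leaves a multiple of a probability
  density, with total mass \<open>sqrt 2\<close>. This is the origin of the factor
  \<open>sqrt 2\<close> and of the rate \<open>x / 4\<close> in every tail bound below.\<close>

lemma gaussian_linear_form_exp_square:
  assumes \<tau>: "0 < \<tau>"
  shows "(\<integral>\<^sup>+\<omega>. ennreal (exp ((\<Sum>k<n. b k * \<omega> k)\<^sup>2 / (4 * (\<tau>\<^sup>2 * (\<Sum>k<n. (b k)\<^sup>2)))))
      \<partial>gaussian_noise n \<tau>) \<le> ennreal (sqrt 2)"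
proof (cases "\<exists>k<n. b k \<noteq> 0")
  case False
  interpret prob_space "gaussian_noise n \<tau>" by (rule prob_space_gaussian_noise[OF \<tau>])
  have "(\<Sum>k<n. (b k)\<^sup>2) = 0" using False by auto
  \<comment> \<open>Division by zero gives 0, so the integrand is constantly 1.\<close>
  then show ?thesis by (simp add: emeasure_space_1)
next
  case True
  define v where "v = (\<Sum>k<n. (b k)\<^sup>2)"
  have v: "0 < v" unfolding v_def using True by (auto intro!: sum_pos2)
  define s where "s = \<tau> * sqrt v"
  have s: "0 < s" "s\<^sup>2 = \<tau>\<^sup>2 * v" using v \<tau> by (auto simp: s_def power_mult_distrib)
  have "(\<integral>\<^sup>+\<omega>. ennreal (exp ((\<Sum>k<n. b k * \<omega> k)\<^sup>2 / (4 * s\<^sup>2))) \<partial>gaussian_noise n \<tau>)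
      = (\<integral>\<^sup>+x. ennreal (normal_density 0 s x) * ennreal (exp (x\<^sup>2 / (4 * s\<^sup>2))) \<partial>lborel)"
    using gaussian_linear_form_distributed[OF \<tau> True]
    by (intro distributed_nn_integral[symmetric]) (auto simp: s_def v_def)
  also have "\<dots> = (\<integral>\<^sup>+x. ennreal (sqrt 2) * ennreal (normal_density 0 (sqrt 2 * s) x) \<partial>lborel)"
    by (intro nn_integral_cong, subst (1 2) ennreal_mult[symmetric])
      (auto simp: normal_density_mult_exp_square[OF s(1)])
  also have "\<dots> = ennreal (sqrt 2) * (\<integral>\<^sup>+x. ennreal (normal_density 0 (sqrt 2 * s) x) \<partial>lborel)"
    by (rule nn_integral_cmult) simp
  also have "(\<integral>\<^sup>+x. ennreal (normal_density 0 (sqrt 2 * s) x) \<partial>lborel) = 1"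
    using prob_space.emeasure_space_1[OF prob_space_normal_density[of "sqrt 2 * s" 0]] s
    by (simp add: emeasure_density)
  finally show ?thesis by (simp add: s v_def)
qed

text \<open>Jensen's inequality needs total weight 1. The missing mass is placed on an extra index
  \<open>None\<close> with exponent 0.\<close>

lemma exp_weighted_sum_le:
  fixes w y :: "'j \<Rightarrow> real"
  assumes "finite J" and w: "\<And>j. j \<in> J \<Longrightarrow> 0 \<le> w j" and le: "(\<Sum>j\<in>J. w j) \<le> 1"
  shows "exp (\<Sum>j\<in>J. w j * y j) \<le> (1 - (\<Sum>j\<in>J. w j)) + (\<Sum>j\<in>J. w j * exp (y j))"
proof -
  define I where "I = insert None (Some ` J)"
  define W where "W = (\<lambda>i. case i of None \<Rightarrow> 1 - (\<Sum>j\<in>J. w j) | Some j \<Rightarrow> w j)"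
  define Y where "Y = (\<lambda>i. case i of None \<Rightarrow> 0 | Some j \<Rightarrow> y j)"
  have fin: "finite I" using assms by (auto simp: I_def)
  have *: "(\<Sum>i\<in>I. f i) = f None + (\<Sum>j\<in>J. f (Some j))" for f :: "'j option \<Rightarrow> real"
    unfolding I_def using assms(1) by (subst sum.insert) (auto simp: sum.reindex)
  have "exp (\<Sum>i\<in>I. W i *\<^sub>R Y i) \<le> (\<Sum>i\<in>I. W i * exp (Y i))"
  proof (rule convex_on_sum[OF fin _ exp_convex])
    show "(\<Sum>i\<in>I. W i) = 1" unfolding * by (simp add: W_def)
    show "\<And>i. i \<in> I \<Longrightarrow> 0 \<le> W i" using w le by (auto simp: I_def W_def)
  qed (auto simp: I_def)
  then show ?thesis unfolding * by (simp add: W_def Y_def)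
qed

text \<open>By convexity of \<open>exp\<close> the exponential moment of a weighted sum of squared linear forms is
  dominated by that of a single one, so that no joint distribution is needed.\<close>

lemma gaussian_quadratic_form_tail:
  fixes b :: "'j \<Rightarrow> nat \<Rightarrow> real"
  assumes \<tau>: "0 < \<tau>" and J: "finite J" and c: "\<And>j. j \<in> J \<Longrightarrow> 0 \<le> c j" and V: "0 < V"
    and le: "\<tau>\<^sup>2 * (\<Sum>j\<in>J. c j * (\<Sum>k<n. (b j k)\<^sup>2)) \<le> V"
  shows "measure (gaussian_noise n \<tau>) {\<omega> \<in> space (gaussian_noise n \<tau>).
      x * V < (\<Sum>j\<in>J. c j * (\<Sum>k<n. b j k * \<omega> k)\<^sup>2)} \<le> sqrt 2 * exp (- x / 4)"
proof -
  let ?M = "gaussian_noise n \<tau>"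
  interpret prob_space ?M by (rule prob_space_gaussian_noise[OF \<tau>])
  define l where "l = (\<lambda>j \<omega>. \<Sum>k<n. b j k * \<omega> k)"
  define v where "v = (\<lambda>j. \<Sum>k<n. (b j k)\<^sup>2)"
  \<comment> \<open>The weight is the share of \<open>V\<close> taken up by the variance of the
    \<open>j\<close>-th term; it turns forms of different variances into a subconvex combination of
    normalised squares.\<close>
  define w where "w = (\<lambda>j. \<tau>\<^sup>2 * (c j * v j) / V)"
  define y where "y = (\<lambda>j \<omega>. (l j \<omega>)\<^sup>2 / (4 * (\<tau>\<^sup>2 * v j)))"
  have v0: "0 \<le> v j" for j by (auto simp: v_def intro: sum_nonneg)
  have w0: "0 \<le> w j" if "j \<in> J" for j using c[OF that] v0[of j] V by (auto simp: w_def)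
  have ws: "(\<Sum>j\<in>J. w j) \<le> 1"
    using le V by (simp add: w_def v_def sum_divide_distrib[symmetric] sum_distrib_left[symmetric])
  \<comment> \<open>If the variance vanishes, the quotient in \<open>y\<close> degenerates to 0, but
    then the linear form vanishes as well.\<close>
  have wy: "w j * y j \<omega> = c j * (l j \<omega>)\<^sup>2 / (4 * V)" for j \<omega>
  proof (cases "v j = 0")
    case True
    then have "\<forall>k<n. b j k = 0" unfolding v_def by (subst (asm) sum_nonneg_eq_0_iff) auto
    then show ?thesis by (simp add: l_def w_def True)
  next
    case False
    then show ?thesis using \<tau> V by (simp add: w_def y_def field_simps)
  qed
  define Q where "Q = (\<lambda>\<omega>. \<Sum>j\<in>J. c j * (l j \<omega>)\<^sup>2)"
  have [measurable]: "l j \<in> borel_measurable ?M" for j unfolding l_def by measurable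
  have [measurable]: "Q \<in> borel_measurable ?M" unfolding Q_def by measurable
  have [measurable]: "y j \<in> borel_measurable ?M" for j unfolding y_def by measurable
  have Qe: "exp (Q \<omega> / (4 * V)) \<le> (1 - (\<Sum>j\<in>J. w j)) + (\<Sum>j\<in>J. w j * exp (y j \<omega>))" for \<omega>
    using exp_weighted_sum_le[OF J w0 ws, of "\<lambda>j. y j \<omega>"]
    by (simp add: wy Q_def sum_divide_distrib)
  have "(\<integral>\<^sup>+\<omega>. ennreal (exp (Q \<omega> / (4 * V))) \<partial>?M)
      \<le> (\<integral>\<^sup>+\<omega>. ennreal (1 - (\<Sum>j\<in>J. w j)) + (\<Sum>j\<in>J. ennreal (w j) * ennreal (exp (y j \<omega>))) \<partial>?M)"
  proof (rule nn_integral_mono)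
    fix \<omega>
    have "ennreal (exp (Q \<omega> / (4 * V)))
        \<le> ennreal ((1 - (\<Sum>j\<in>J. w j)) + (\<Sum>j\<in>J. w j * exp (y j \<omega>)))"
      using Qe by (rule ennreal_leI)
    also have "\<dots> = ennreal (1 - (\<Sum>j\<in>J. w j)) + (\<Sum>j\<in>J. ennreal (w j) * ennreal (exp (y j \<omega>)))"
      using ws w0 by (subst ennreal_plus) (auto simp: sum_nonneg ennreal_mult[symmetric])
    finally show "ennreal (exp (Q \<omega> / (4 * V)))
        \<le> ennreal (1 - (\<Sum>j\<in>J. w j)) + (\<Sum>j\<in>J. ennreal (w j) * ennreal (exp (y j \<omega>)))" .
  qed
  also have "\<dots> = ennreal (1 - (\<Sum>j\<in>J. w j))
      + (\<Sum>j\<in>J. ennreal (w j) * (\<integral>\<^sup>+\<omega>. ennreal (exp (y j \<omega>)) \<partial>?M))"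
    by (simp add: nn_integral_add nn_integral_sum nn_integral_cmult emeasure_space_1)
  \<comment> \<open>The slack mass only contributes a factor 1; enlarging it to
    \<open>sqrt 2\<close> lets all weights recombine to total mass 1.\<close>
  also have "\<dots> \<le> ennreal (1 - (\<Sum>j\<in>J. w j)) * ennreal (sqrt 2)
      + (\<Sum>j\<in>J. ennreal (w j) * ennreal (sqrt 2))"
  proof (intro add_mono sum_mono mult_left_mono)
    show "ennreal (1 - (\<Sum>j\<in>J. w j)) \<le> ennreal (1 - (\<Sum>j\<in>J. w j)) * ennreal (sqrt 2)"
      using ws mult_left_mono[of 1 "sqrt 2" "1 - (\<Sum>j\<in>J. w j)"]
      by (auto simp: ennreal_mult[symmetric] intro!: ennreal_leI)
    fix j
    show "(\<integral>\<^sup>+\<omega>. ennreal (exp (y j \<omega>)) \<partial>?M) \<le> ennreal (sqrt 2)"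
      unfolding y_def l_def v_def by (rule gaussian_linear_form_exp_square[OF \<tau>])
  qed simp
  also have "\<dots> = ennreal (sqrt 2)"
    using ws w0 by (simp add: ennreal_mult[symmetric] ennreal_plus[symmetric] sum_nonneg
        sum_distrib_right[symmetric] left_diff_distrib del: ennreal_plus)
  finally have E: "(\<integral>\<^sup>+\<omega>. ennreal (exp (Q \<omega> / (4 * V))) \<partial>?M) \<le> ennreal (sqrt 2)" .
  have "{\<omega> \<in> space ?M. x * V < Q \<omega>}
      \<subseteq> {\<omega> \<in> space ?M. 1 \<le> ennreal (exp (- x / 4)) * ennreal (exp (Q \<omega> / (4 * V)))}"
  proof (intro Collect_mono conj_mono impI)
    fix \<omega> assume "x * V < Q \<omega>"
    then have "0 \<le> - x / 4 + Q \<omega> / (4 * V)" using V by (simp add: field_simps)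
    then have "1 \<le> exp (- x / 4) * exp (Q \<omega> / (4 * V))"
      by (subst exp_add[symmetric]) simp
    then show "1 \<le> ennreal (exp (- x / 4)) * ennreal (exp (Q \<omega> / (4 * V)))"
      by (simp add: ennreal_mult[symmetric])
  qed
  then have "emeasure ?M {\<omega> \<in> space ?M. x * V < Q \<omega>}
      \<le> emeasure ?M {\<omega> \<in> space ?M. 1 \<le> ennreal (exp (- x / 4)) * ennreal (exp (Q \<omega> / (4 * V)))}"
    by (intro emeasure_mono) measurable
  also have "\<dots> \<le> ennreal (exp (- x / 4)) * (\<integral>\<^sup>+\<omega>. ennreal (exp (Q \<omega> / (4 * V))) * indicator (space ?M) \<omega> \<partial>?M)"
    by (rule nn_integral_Markov_inequality) auto
  also have "(\<integral>\<^sup>+\<omega>. ennreal (exp (Q \<omega> / (4 * V))) * indicator (space ?M) \<omega> \<partial>?M)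
      = (\<integral>\<^sup>+\<omega>. ennreal (exp (Q \<omega> / (4 * V))) \<partial>?M)"
    by (intro nn_integral_cong) auto
  also have "ennreal (exp (- x / 4)) * \<dots> \<le> ennreal (exp (- x / 4)) * ennreal (sqrt 2)"
    using E by (rule mult_left_mono) simp
  also have "\<dots> = ennreal (sqrt 2 * exp (- x / 4))" by (simp add: ennreal_mult[symmetric] mult.commute)
  finally show ?thesis
    unfolding Q_def l_def by (simp add: emeasure_eq_measure)
qed

section \<open>Symmetric matrices over the reals\<close>

lemma scalar_prod_self_ge_0: "0 \<le> scalar_prod v (v :: real Matrix.vec)"
  unfolding scalar_prod_def by (simp add: sum_nonneg)

lemma scalar_prod_self_eq_0:
  assumes "v \<in> carrier_vec n" "scalar_prod v v = (0 :: real)"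
  shows "v = 0\<^sub>v n"
proof (rule eq_vecI)
  fix i assume i: "i < dim_vec (0\<^sub>v n)"
  have "(\<Sum>i\<in>{0..<n}. v $ i * v $ i) = 0" using assms by (simp add: scalar_prod_def)
  then have "\<forall>i\<in>{0..<n}. v $ i * v $ i = 0" by (subst (asm) sum_nonneg_eq_0_iff) auto
  then show "v $ i = 0\<^sub>v n $ i" using i by auto
qed (use assms in auto)

lemma enorm_sq: "(enorm v)\<^sup>2 = scalar_prod v v"
  by (simp add: enorm_def scalar_prod_self_ge_0)

text \<open>Serves for Cauchy-Schwarz in semidefinite forms, and for the normal equations of a
  minimiser, where \<open>a = 0\<close> forces \<open>b = 0\<close>. The sign of \<open>c\<close>
  has to be extracted from the inequality itself.\<close>

lemma quadratic_nonneg_discriminant: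
  fixes a b c :: real
  assumes "\<And>s. 0 \<le> a + 2 * s * b + s\<^sup>2 * c"
  shows "b\<^sup>2 \<le> a * c"
proof (cases "c = 0")
  case True
  have "b = 0"
  proof (rule ccontr)
    assume "b \<noteq> 0"
    then show False using assms[of "- (a + 1) / (2 * b)"] True by (simp add: field_simps)
  qed
  then show ?thesis using True by simp
next
  case False
  have c: "0 < c"
  proof (rule ccontr)
    assume "\<not> 0 < c"
    then have c: "c < 0" using False by simp
    \<comment> \<open>Chosen so that \<open>s * (- c)\<close> exceeds
      \<open>2 * \<bar>b\<bar> + \<bar>a\<bar>\<close> and \<open>s\<close> is at least 1; the
      quadratic term then outweighs the other two.\<close>
    define s where "s = (2 * \<bar>b\<bar> + \<bar>a\<bar> + 1) / (- c) + 1"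
    have s: "1 \<le> s" "s * (- c) = 2 * \<bar>b\<bar> + \<bar>a\<bar> + 1 - c"
      using c by (auto simp: s_def field_simps)
    have "s\<^sup>2 * c = - s * (s * (- c))" by (simp add: power2_eq_square)
    then have "s\<^sup>2 * c = - s * (2 * \<bar>b\<bar> + \<bar>a\<bar> + 1 - c)" by (simp only: s(2))
    moreover have "2 * s * b \<le> s * (2 * \<bar>b\<bar>)" using s(1) by (simp add: mult_left_mono)
    moreover have "a \<le> s * \<bar>a\<bar>"
      using mult_right_mono[OF s(1), of "\<bar>a\<bar>"] by simp
    moreover have "0 < s * (1 - c)" using s(1) c by simp
    ultimately show False using assms[of s] by (simp add: algebra_simps)
  qed
  show ?thesis using assms[of "- b / c"] c by (simp add: field_simps power2_eq_square)
qed

lemma scalar_prod_transpose_mult_vec: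
  fixes A :: "real Matrix.mat"
  assumes "A \<in> carrier_mat n k" "v \<in> carrier_vec k" "w \<in> carrier_vec n"
  shows "v \<bullet> (A\<^sup>T *\<^sub>v w) = (A *\<^sub>v v) \<bullet> w"
proof -
  have "v \<bullet> (A\<^sup>T *\<^sub>v w) = (A\<^sup>T *\<^sub>v w) \<bullet> v" using assms by (intro comm_scalar_prod[of _ k]) auto
  also have "\<dots> = w \<bullet> (A *\<^sub>v v)" by (rule transpose_vec_mult_scalar[OF assms])
  also have "\<dots> = (A *\<^sub>v v) \<bullet> w" using assms by (intro comm_scalar_prod[of _ n]) auto
  finally show ?thesis .
qed

definition psd :: "nat \<Rightarrow> real Matrix.mat \<Rightarrow> bool" where
  "psd k A \<longleftrightarrow> A \<in> carrier_mat k k \<and> A\<^sup>T = A \<and> (\<forall>v\<in>carrier_vec k. 0 \<le> v \<bullet> (A *\<^sub>v v))"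

lemma symmetric_mat_scalar_prod:
  fixes A :: "real Matrix.mat"
  assumes "A \<in> carrier_mat k k" "A\<^sup>T = A" "v \<in> carrier_vec k" "w \<in> carrier_vec k"
  shows "(A *\<^sub>v v) \<bullet> w = v \<bullet> (A *\<^sub>v w)"
  using transpose_vec_mult_scalar[of A k k w v] assms by simp

lemma psd_Cauchy_Schwarz:
  assumes "psd k A" and v: "v \<in> carrier_vec k" and w: "w \<in> carrier_vec k"
  shows "(v \<bullet> (A *\<^sub>v w))\<^sup>2 \<le> (v \<bullet> (A *\<^sub>v v)) * (w \<bullet> (A *\<^sub>v w))"
proof (rule quadratic_nonneg_discriminant)
  fix s :: real
  have A: "A \<in> carrier_mat k k" "A\<^sup>T = A" and pos: "\<And>v. v \<in> carrier_vec k \<Longrightarrow> 0 \<le> v \<bullet> (A *\<^sub>v v)"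
    using assms(1) by (auto simp: psd_def)
  have Av: "A *\<^sub>v v \<in> carrier_vec k" "A *\<^sub>v w \<in> carrier_vec k" using A v w by auto
  have sym: "w \<bullet> (A *\<^sub>v v) = v \<bullet> (A *\<^sub>v w)"
    using symmetric_mat_scalar_prod[OF A v w] comm_scalar_prod[OF w Av(1)] by simp
  have "0 \<le> (v + s \<cdot>\<^sub>v w) \<bullet> (A *\<^sub>v (v + s \<cdot>\<^sub>v w))" by (rule pos) (use v w in auto)
  also have "A *\<^sub>v (v + s \<cdot>\<^sub>v w) = A *\<^sub>v v + s \<cdot>\<^sub>v (A *\<^sub>v w)"
    using A v w by (simp add: mult_add_distrib_mat_vec[of _ k k] mult_mat_vec[of _ k k])
  also have "(v + s \<cdot>\<^sub>v w) \<bullet> (A *\<^sub>v v + s \<cdot>\<^sub>v (A *\<^sub>v w))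
      = v \<bullet> (A *\<^sub>v v) + 2 * s * (v \<bullet> (A *\<^sub>v w)) + s\<^sup>2 * (w \<bullet> (A *\<^sub>v w))"
    using v w Av sym by (simp add: add_scalar_prod_distrib[of _ k] scalar_prod_add_distrib[of _ k]
        power2_eq_square algebra_simps)
  finally show "0 \<le> v \<bullet> (A *\<^sub>v v) + 2 * s * (v \<bullet> (A *\<^sub>v w)) + s\<^sup>2 * (w \<bullet> (A *\<^sub>v w))" .
qed

text \<open>Cauchy-Schwarz for the form, applied to \<open>v\<close> and the vector
  \<open>A *\<^sub>v v\<close> itself.\<close>

lemma psd_kernel:
  assumes "psd k A" and v: "v \<in> carrier_vec k" and "v \<bullet> (A *\<^sub>v v) = 0"
  shows "A *\<^sub>v v = 0\<^sub>v k"
proof -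
  have w: "A *\<^sub>v v \<in> carrier_vec k" using assms by (auto simp: psd_def)
  from psd_Cauchy_Schwarz[OF assms(1) w v] assms(3) have "(A *\<^sub>v v) \<bullet> (A *\<^sub>v v) = 0" by simp
  then show ?thesis using scalar_prod_self_eq_0[OF w] by simp
qed

text \<open>Carrier-based vectors have no topology of their own, so the unit sphere is modelled
  inside the function space \<open>nat \<Rightarrow> real\<close> with its product topology, padded
  by zeros. It is a closed subset of a product of compact intervals.\<close>

lemma compact_coordinate_sphere:
  "compact {x :: nat \<Rightarrow> real. (\<forall>i\<ge>k. x i = 0) \<and> (\<Sum>i<k. (x i)\<^sup>2) = 1}" (is "compact ?S")
proof -
  define B where "B = (\<lambda>i. if i < k then {-1..1} else {0 :: real})"
  have "compactin (product_topology (\<lambda>i. euclidean) UNIV) (Pi\<^sub>E UNIV B)"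
    by (subst compactin_PiE) (auto simp: B_def)
  then have cB: "compact (Pi\<^sub>E UNIV B)"
    by (simp add: euclidean_product_topology)
  have cont: "continuous_on UNIV (\<lambda>x :: nat \<Rightarrow> real. x i)" for i by simp
  have "closed {x :: nat \<Rightarrow> real. (\<Sum>i<k. (x i)\<^sup>2) = 1}"
    by (intro closed_Collect_eq continuous_intros cont)
  then have "compact (Pi\<^sub>E UNIV B \<inter> {x. (\<Sum>i<k. (x i)\<^sup>2) = 1})"
    using cB by (rule compact_Int_closed[rotated])
  also have "Pi\<^sub>E UNIV B \<inter> {x. (\<Sum>i<k. (x i)\<^sup>2) = 1} = ?S"
  proof -
    have "x i \<in> {-1..1}" if "(\<Sum>i<k. (x i)\<^sup>2) = 1" "i < k" for x :: "nat \<Rightarrow> real" and i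
    proof -
      have "(x i)\<^sup>2 \<le> (\<Sum>i<k. (x i)\<^sup>2)" using that(2) by (intro member_le_sum) auto
      then have "\<bar>x i\<bar> \<le> 1" using that(1) by (simp add: abs_square_le_1)
      then show ?thesis by auto
    qed
    then show ?thesis by (auto simp: B_def PiE_iff split: if_splits)
  qed
  finally show ?thesis .
qed

text \<open>The smallest value of the quadratic form on the unit sphere is an eigenvalue.\<close>

lemma symmetric_mat_least_eigenvalue:
  fixes A :: "real Matrix.mat"
  assumes A: "A \<in> carrier_mat k k" and sym: "A\<^sup>T = A" and k: "0 < k"
  obtains l where "l \<in> spectrum A" "\<And>v. v \<in> carrier_vec k \<Longrightarrow> l * (v \<bullet> v) \<le> v \<bullet> (A *\<^sub>v v)"
proof -
  define S where "S = {x :: nat \<Rightarrow> real. (\<forall>i\<ge>k. x i = 0) \<and> (\<Sum>i<k. (x i)\<^sup>2) = 1}"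
  define f where "f = (\<lambda>x. \<Sum>i<k. x i * (\<Sum>j<k. A $$ (i, j) * x j))"
  have f: "v \<bullet> (A *\<^sub>v v) = f (\<lambda>i. v $ i)" if "v \<in> carrier_vec k" for v
    using that A by (simp add: f_def scalar_prod_def atLeast0LessThan)
  have f': "f x = Matrix.vec k x \<bullet> (A *\<^sub>v Matrix.vec k x)" for x
    by (subst f) (auto simp: f_def)
  have cont: "continuous_on S (\<lambda>x :: nat \<Rightarrow> real. x i)" for i
    by (rule continuous_on_subset[OF continuous_on_product_coordinates]) simp
  have "continuous_on S f" unfolding f_def by (intro continuous_intros cont)
  moreover have "(\<lambda>i. of_bool (i = 0)) \<in> S"
  proof -
    have "(\<Sum>i<k. (of_bool (i = 0) :: real)\<^sup>2) = (\<Sum>i<k. if i = 0 then 1 else 0)"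
      by (intro sum.cong) auto
    then show ?thesis using k by (auto simp: S_def)
  qed
  moreover have "compact S" unfolding S_def by (rule compact_coordinate_sphere)
  ultimately have "\<exists>x\<in>S. \<forall>y\<in>S. f x \<le> f y" by (intro continuous_attains_inf) auto
  then obtain x where x: "x \<in> S" and min: "\<And>y. y \<in> S \<Longrightarrow> f x \<le> f y" by blast
  define l where "l = f x"
  define u where "u = Matrix.vec k x"
  have u: "u \<in> carrier_vec k" "u \<bullet> u = 1"
    using x by (auto simp: u_def S_def scalar_prod_def power2_eq_square atLeast0LessThan)
  have le: "l * (v \<bullet> v) \<le> v \<bullet> (A *\<^sub>v v)" if v: "v \<in> carrier_vec k" for v
  proof (cases "v \<bullet> v = 0")
    case True
    then have "v = 0\<^sub>v k" by (rule scalar_prod_self_eq_0[OF v])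
    then show ?thesis using A by simp
  next
    case False
    define s where "s = sqrt (v \<bullet> v)"
    have s: "0 < s" "s\<^sup>2 = v \<bullet> v"
      using False scalar_prod_self_ge_0[of v] by (auto simp: s_def)
    define y where "y = (\<lambda>i. if i < k then v $ i / s else 0)"
    have "(\<Sum>i<k. (y i)\<^sup>2) = (\<Sum>i<k. (v $ i)\<^sup>2) / s\<^sup>2"
      by (simp add: y_def power_divide sum_divide_distrib)
    also have "\<dots> = 1"
      using s v False by (simp add: scalar_prod_def power2_eq_square atLeast0LessThan)
    finally have "y \<in> S" by (auto simp: S_def y_def)
    then have "l \<le> f y" by (simp add: l_def min)
    also have "f y = f (\<lambda>i. v $ i) / s\<^sup>2"
      by (simp add: f_def y_def sum_divide_distrib power2_eq_square)
        (simp add: sum_divide_distrib[symmetric] field_simps)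
    finally show ?thesis unfolding s(2)[symmetric] f[OF v] using s(1) by (simp add: field_simps)
  qed
  \<comment> \<open>Subtracting the minimum makes the form semidefinite with the minimiser
    \<open>u\<close> as a null vector; by \<open>psd_kernel\<close> a null vector lies in the
    kernel, which is the eigenvector equation.\<close>
  define B where "B = A - l \<cdot>\<^sub>m 1\<^sub>m k"
  have Bv: "B *\<^sub>v v = A *\<^sub>v v - l \<cdot>\<^sub>v v" if "v \<in> carrier_vec k" for v
  proof -
    have "B *\<^sub>v v = A *\<^sub>v v - (l \<cdot>\<^sub>m 1\<^sub>m k) *\<^sub>v v"
      unfolding B_def by (rule minus_mult_distrib_mat_vec) (use A that in auto)
    also have "(l \<cdot>\<^sub>m 1\<^sub>m k) *\<^sub>v v = l \<cdot>\<^sub>v v"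
      using that by (intro eq_vecI) (auto simp: row_smult)
    finally show ?thesis .
  qed
  have vB: "v \<bullet> (B *\<^sub>v v) = v \<bullet> (A *\<^sub>v v) - l * (v \<bullet> v)" if "v \<in> carrier_vec k" for v
    using that A by (simp add: Bv scalar_prod_minus_distrib[of _ k])
  have "psd k B"
    unfolding psd_def
  proof (intro conjI ballI)
    show "B\<^sup>T = B"
    proof (rule eq_matI)
      fix i j assume "i < dim_row B" "j < dim_col B"
      then have ij: "i < k" "j < k" using A by (auto simp: B_def)
      have "A $$ (j, i) = A $$ (i, j)"
        using arg_cong[OF sym, of "\<lambda>M. M $$ (i, j)"] A ij by simp
      then show "B\<^sup>T $$ (i, j) = B $$ (i, j)" using A ij by (auto simp: B_def)
    qed (use A in \<open>auto simp: B_def\<close>)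
  qed (use A le vB in \<open>auto simp: B_def\<close>)
  moreover have "u \<bullet> (B *\<^sub>v u) = 0"
    using u by (simp add: vB l_def f' u_def)
  ultimately have "B *\<^sub>v u = 0\<^sub>v k" using u by (intro psd_kernel)
  have "A *\<^sub>v u = l \<cdot>\<^sub>v u"
  proof (rule eq_vecI)
    fix i assume "i < dim_vec (l \<cdot>\<^sub>v u)"
    then have i: "i < k" using u by simp
    have "(A *\<^sub>v u - l \<cdot>\<^sub>v u) $ i = 0" using \<open>B *\<^sub>v u = 0\<^sub>v k\<close> Bv[OF u(1)] i by simp
    then show "(A *\<^sub>v u) $ i = (l \<cdot>\<^sub>v u) $ i" using i u A by simp
  qed (use u A in auto)
  moreover have "u \<noteq> 0\<^sub>v k" using u by auto
  ultimately have "l \<in> spectrum A"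
    using u A by (auto simp: spectrum_def eigenvalue_def eigenvector_def)
  then show ?thesis using le that by blast
qed

lemma min_eigenvalue_le_Rayleigh:
  assumes A: "A \<in> carrier_mat k k" "A\<^sup>T = A" "0 < k" and v: "v \<in> carrier_vec k"
  shows "min_eigenvalue A * (v \<bullet> v) \<le> v \<bullet> (A *\<^sub>v v)"
proof -
  obtain l where l: "l \<in> spectrum A" "l * (v \<bullet> v) \<le> v \<bullet> (A *\<^sub>v v)"
    using symmetric_mat_least_eigenvalue[OF A] v by blast
  have "min_eigenvalue A \<le> l"
    unfolding min_eigenvalue_def using card_finite_spectrum(1)[OF A(1)] l(1) by simp
  then have "min_eigenvalue A * (v \<bullet> v) \<le> l * (v \<bullet> v)"
    using scalar_prod_self_ge_0[of v] by (rule mult_right_mono)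
  then show ?thesis using l(2) by simp
qed

lemma uminus_mult_mat_vec:
  fixes A :: "real Matrix.mat"
  assumes "A \<in> carrier_mat k k" "v \<in> carrier_vec k"
  shows "(- A) *\<^sub>v v = - (A *\<^sub>v v)"
  using assms by (intro eq_vecI) (auto simp: scalar_prod_def sum_negf)

lemma spectrum_uminus:
  fixes A :: "real Matrix.mat"
  assumes A: "A \<in> carrier_mat k k"
  shows "l \<in> spectrum (- A) \<longleftrightarrow> - l \<in> spectrum A"
proof -
  have "- (A *\<^sub>v v) = l \<cdot>\<^sub>v v \<longleftrightarrow> A *\<^sub>v v = (- l) \<cdot>\<^sub>v v" if "v \<in> carrier_vec k" for v
    using that A by (auto simp: vec_eq_iff)
  then have "eigenvector (- A) v l \<longleftrightarrow> eigenvector A v (- l)" for v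
    using A by (auto simp: eigenvector_def uminus_mult_mat_vec)
  then show ?thesis by (simp add: spectrum_def eigenvalue_def)
qed

text \<open>Both parts come from the least eigenvalue of \<open>- A\<close>. Membership in the
  spectrum later supplies a top eigenvector for bounding traces from below.\<close>

lemma max_eigenvalue_in_spectrum_and_ge_Rayleigh:
  fixes A :: "real Matrix.mat"
  assumes A: "A \<in> carrier_mat k k" "A\<^sup>T = A" "0 < k"
  shows "max_eigenvalue A \<in> spectrum A"
    and "v \<in> carrier_vec k \<Longrightarrow> v \<bullet> (A *\<^sub>v v) \<le> max_eigenvalue A * (v \<bullet> v)"
proof -
  have fin: "finite (spectrum A)" by (rule card_finite_spectrum(1)[OF A(1)])
  have nA: "- A \<in> carrier_mat k k" "(- A)\<^sup>T = - A"
  proof -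
    show "(- A)\<^sup>T = - A"
    proof (rule eq_matI)
      fix i j assume "i < dim_row (- A)" "j < dim_col (- A)"
      then have "i < k" "j < k" using A by auto
      then show "(- A)\<^sup>T $$ (i, j) = (- A) $$ (i, j)"
        using A(1) arg_cong[OF A(2), of "\<lambda>M. M $$ (i, j)"] by simp
    qed (use A in auto)
  qed (use A in auto)
  obtain l where l: "l \<in> spectrum (- A)" "\<And>v. v \<in> carrier_vec k \<Longrightarrow> l * (v \<bullet> v) \<le> v \<bullet> ((- A) *\<^sub>v v)"
    using symmetric_mat_least_eigenvalue[OF nA A(3)] by blast
  have l': "- l \<in> spectrum A" using l(1) spectrum_uminus[OF A(1)] by simp
  then show "max_eigenvalue A \<in> spectrum A"
    unfolding max_eigenvalue_def using fin by (intro Max_in) auto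
  assume v: "v \<in> carrier_vec k"
  have "- l \<le> max_eigenvalue A" unfolding max_eigenvalue_def using fin l' by simp
  then have "- l * (v \<bullet> v) \<le> max_eigenvalue A * (v \<bullet> v)"
    using scalar_prod_self_ge_0[of v] by (rule mult_right_mono)
  then show "v \<bullet> (A *\<^sub>v v) \<le> max_eigenvalue A * (v \<bullet> v)"
    using l(2)[OF v] v A by (simp add: uminus_mult_mat_vec)
qed

lemma mat_diag_mult_vec_index:
  fixes f :: "nat \<Rightarrow> real"
  assumes "i < k" "v \<in> carrier_vec k"
  shows "(mat_diag k f *\<^sub>v v) $ i = f i * v $ i"
proof -
  have "(mat_diag k f *\<^sub>v v) $ i = (\<Sum>j\<in>{0..<k}. (if i = j then f j else 0) * v $ j)"
    using assms by (auto simp: mat_diag_def scalar_prod_def intro!: sum.cong)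
  also have "\<dots> = (\<Sum>j\<in>{0..<k}. if i = j then f j * v $ j else 0)"
    by (intro sum.cong) auto
  finally show ?thesis using assms by simp
qed

text \<open>Makes \<open>cond_number\<close> of \<open>D\<close> the ratio of its largest to its
  smallest diagonal entry.\<close>

lemma spectrum_mat_diag:
  fixes f :: "nat \<Rightarrow> real"
  shows "spectrum (mat_diag k f) = f ` {..<k}"
proof -
  have 1: "l \<in> f ` {..<k}" if l: "l \<in> spectrum (mat_diag k f)" for l
  proof -
    obtain v where v: "v \<in> carrier_vec k" "v \<noteq> 0\<^sub>v k" "mat_diag k f *\<^sub>v v = l \<cdot>\<^sub>v v"
      using l by (auto simp: spectrum_def eigenvalue_def eigenvector_def mat_diag_def)
    then obtain i where i: "i < k" "v $ i \<noteq> 0" by (auto simp: vec_eq_iff)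
    have "f i * v $ i = l * v $ i" using mat_diag_mult_vec_index[OF i(1) v(1), of f] v i by simp
    then show ?thesis using i by auto
  qed
  have 2: "f i \<in> spectrum (mat_diag k f)" if i: "i < k" for i
  proof -
    have "mat_diag k f *\<^sub>v unit_vec k i = f i \<cdot>\<^sub>v unit_vec k i"
    proof (rule eq_vecI)
      fix j assume "j < dim_vec (f i \<cdot>\<^sub>v unit_vec k i)"
      then have j: "j < k" by simp
      show "(mat_diag k f *\<^sub>v unit_vec k i) $ j = (f i \<cdot>\<^sub>v unit_vec k i) $ j"
        using i j by (subst mat_diag_mult_vec_index) (auto simp: unit_vec_def)
    qed (auto simp: mat_diag_def)
    moreover have "unit_vec k i \<noteq> (0\<^sub>v k :: real Matrix.vec)"
      using i by (auto simp: vec_eq_iff)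
    ultimately show ?thesis
      by (auto simp: spectrum_def eigenvalue_def eigenvector_def mat_diag_def
          intro!: exI[of _ "unit_vec k i"])
  qed
  show ?thesis using 1 2 by auto
qed

text \<open>Positivity excludes kernel vectors, so the determinant is nonzero and the option
  returned by \<open>mat_inverse\<close> is a \<open>Some\<close>.\<close>

lemma posdef_mat_inverse:
  fixes A :: "real Matrix.mat"
  assumes A: "A \<in> carrier_mat k k"
    and pos: "\<And>v. v \<in> carrier_vec k \<Longrightarrow> v \<noteq> 0\<^sub>v k \<Longrightarrow> 0 < v \<bullet> (A *\<^sub>v v)"
  obtains B where "mat_inverse A = Some B" "B \<in> carrier_mat k k" "A * B = 1\<^sub>m k"
proof -
  have "det A \<noteq> 0"
    unfolding det_0_iff_vec_prod_zero[OF A] using pos by fastforce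
  then have "A \<in> Units (ring_mat TYPE(real) k ())" by (rule det_non_zero_imp_unit[OF A])
  then obtain B where B: "mat_inverse A = Some B" using mat_inverse(1)[OF A, of "()"] by auto
  then show ?thesis using mat_inverse(2)[OF A B] that by blast
qed

section \<open>Powers and traces\<close>

lemma pow_mat_add:
  fixes A :: "real Matrix.mat"
  assumes A: "A \<in> carrier_mat k k"
  shows "A ^\<^sub>m (i + j) = A ^\<^sub>m i * A ^\<^sub>m j"
proof (induction j)
  case (Suc j)
  then show ?case using A by (simp add: assoc_mult_mat[of _ k k _ k _ k])
qed (use A in simp)

lemma transpose_pow_mat:
  fixes A :: "real Matrix.mat"
  assumes A: "A \<in> carrier_mat k k" "A\<^sup>T = A"
  shows "(A ^\<^sub>m j)\<^sup>T = A ^\<^sub>m j"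
proof (induction j)
  case (Suc j)
  have "(A ^\<^sub>m Suc j)\<^sup>T = A\<^sup>T * (A ^\<^sub>m j)\<^sup>T"
    using A by (simp add: transpose_mult[of _ k k _ k])
  also have "\<dots> = A ^\<^sub>m 1 * A ^\<^sub>m j" using A Suc by simp
  also have "\<dots> = A ^\<^sub>m Suc j" using pow_mat_add[OF A(1), of 1 j] by simp
  finally show ?case .
qed (use A in simp)

lemma scalar_prod_pow_mat:
  fixes A :: "real Matrix.mat"
  assumes A: "A \<in> carrier_mat k k" "A\<^sup>T = A" and v: "v \<in> carrier_vec k" and w: "w \<in> carrier_vec k"
  shows "(A ^\<^sub>m i *\<^sub>v v) \<bullet> (A ^\<^sub>m j *\<^sub>v w) = v \<bullet> (A ^\<^sub>m (i + j) *\<^sub>v w)"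
proof -
  have P: "A ^\<^sub>m l \<in> carrier_mat k k" for l using A by simp
  have "(A ^\<^sub>m i *\<^sub>v v) \<bullet> (A ^\<^sub>m j *\<^sub>v w) = v \<bullet> (A ^\<^sub>m i *\<^sub>v (A ^\<^sub>m j *\<^sub>v w))"
    by (rule symmetric_mat_scalar_prod[OF P transpose_pow_mat[OF A] v])
      (use P[of j] w in \<open>rule mult_mat_vec_carrier\<close>)
  also have "A ^\<^sub>m i *\<^sub>v (A ^\<^sub>m j *\<^sub>v w) = A ^\<^sub>m (i + j) *\<^sub>v w"
    using P w by (simp add: pow_mat_add[OF A(1)] assoc_mult_mat_vec[of _ k k _ k])
  finally show ?thesis .
qed

text \<open>Splitting by the parity of \<open>j\<close> and putting \<open>w = A\<^sup>h v\<close>,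
  the moment is \<open>w \<bullet> w\<close> or \<open>w \<bullet> A w\<close>, which gives
  nonnegativity. The growth bound is \<open>le\<close> at \<open>w\<close> in the even case. In the
  odd case it reads \<open>A w \<bullet> A w \<le> \<rho> (w \<bullet> A w)\<close>, which follows
  from Cauchy-Schwarz for the form at \<open>A w\<close> and \<open>w\<close>, followed by
  \<open>le\<close> at \<open>A w\<close>. No diagonalisation is involved.\<close>

lemma psd_moment_bounds:
  assumes A: "psd k A" and \<rho>: "0 \<le> \<rho>" and v: "v \<in> carrier_vec k"
    and le: "\<And>v. v \<in> carrier_vec k \<Longrightarrow> v \<bullet> (A *\<^sub>v v) \<le> \<rho> * (v \<bullet> v)"
  shows "0 \<le> v \<bullet> (A ^\<^sub>m j *\<^sub>v v)" "v \<bullet> (A ^\<^sub>m Suc j *\<^sub>v v) \<le> \<rho> * (v \<bullet> (A ^\<^sub>m j *\<^sub>v v))"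
proof -
  have A': "A \<in> carrier_mat k k" "A\<^sup>T = A" and pos: "\<And>v. v \<in> carrier_vec k \<Longrightarrow> 0 \<le> v \<bullet> (A *\<^sub>v v)"
    using A by (auto simp: psd_def)
  obtain h where h: "j = h + h \<or> j = h + (1 + h)"
  proof -
    have "j = j div 2 + j div 2 \<or> j = j div 2 + (1 + j div 2)" by presburger
    then show ?thesis using that by blast
  qed
  define w where "w = A ^\<^sub>m h *\<^sub>v v"
  have w: "w \<in> carrier_vec k" 
    unfolding w_def by (rule mult_mat_vec_carrier[OF _ v]) (use A' in simp)
  have P: "A ^\<^sub>m i *\<^sub>v w = A ^\<^sub>m (i + h) *\<^sub>v v" for i
    unfolding w_def pow_mat_add[OF A'(1)]
    by (rule assoc_mult_mat_vec[symmetric, of _ k k _ k]) (use A' v in simp_all)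
  have "A ^\<^sub>m 1 = A" using A' by simp
  then have P1: "A *\<^sub>v w = A ^\<^sub>m (1 + h) *\<^sub>v v" using P[of 1] by (simp only:)
  have Aw: "A *\<^sub>v w \<in> carrier_vec k" using A' w by auto
  have ww: "w \<bullet> w = v \<bullet> (A ^\<^sub>m (h + h) *\<^sub>v v)"
    unfolding w_def by (rule scalar_prod_pow_mat[OF A' v v])
  have wAw: "w \<bullet> (A *\<^sub>v w) = v \<bullet> (A ^\<^sub>m (h + (1 + h)) *\<^sub>v v)"
    unfolding P1 unfolding w_def by (rule scalar_prod_pow_mat[OF A' v v])
  have AwAw: "(A *\<^sub>v w) \<bullet> (A *\<^sub>v w) = v \<bullet> (A ^\<^sub>m ((1 + h) + (1 + h)) *\<^sub>v v)"
    unfolding P1 by (rule scalar_prod_pow_mat[OF A' v v])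
  have AwAw_le: "(A *\<^sub>v w) \<bullet> (A *\<^sub>v w) \<le> \<rho> * (w \<bullet> (A *\<^sub>v w))"
  proof (cases "(A *\<^sub>v w) \<bullet> (A *\<^sub>v w) = 0")
    case True
    then show ?thesis using pos[OF w] \<rho> by simp
  next
    case False
    have "((A *\<^sub>v w) \<bullet> (A *\<^sub>v w))\<^sup>2 \<le> ((A *\<^sub>v w) \<bullet> (A *\<^sub>v (A *\<^sub>v w))) * (w \<bullet> (A *\<^sub>v w))"
      by (rule psd_Cauchy_Schwarz[OF A Aw w])
    also have "\<dots> \<le> \<rho> * ((A *\<^sub>v w) \<bullet> (A *\<^sub>v w)) * (w \<bullet> (A *\<^sub>v w))"
      using le[OF Aw] pos[OF w] by (rule mult_right_mono)
    finally have "((A *\<^sub>v w) \<bullet> (A *\<^sub>v w)) * ((A *\<^sub>v w) \<bullet> (A *\<^sub>v w))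
        \<le> ((A *\<^sub>v w) \<bullet> (A *\<^sub>v w)) * (\<rho> * (w \<bullet> (A *\<^sub>v w)))"
      by (simp add: power2_eq_square mult_ac)
    then show ?thesis
      using False scalar_prod_self_ge_0[of "A *\<^sub>v w"] by simp
  qed
  have "0 \<le> v \<bullet> (A ^\<^sub>m j *\<^sub>v v) \<and> v \<bullet> (A ^\<^sub>m Suc j *\<^sub>v v) \<le> \<rho> * (v \<bullet> (A ^\<^sub>m j *\<^sub>v v))"
    using h
  proof (elim disjE)
    assume j: "j = h + h"
    then have "Suc j = h + (1 + h)" by simp
    then show ?thesis
      using scalar_prod_self_ge_0[of w] le[OF w] unfolding ww wAw by (simp only: j simp_thms)
  next
    assume j: "j = h + (1 + h)"
    then have "Suc j = (1 + h) + (1 + h)" by simp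
    then show ?thesis
      using pos[OF w] AwAw_le unfolding wAw AwAw by (simp only: j simp_thms)
  qed
  then show "0 \<le> v \<bullet> (A ^\<^sub>m j *\<^sub>v v)" "v \<bullet> (A ^\<^sub>m Suc j *\<^sub>v v) \<le> \<rho> * (v \<bullet> (A ^\<^sub>m j *\<^sub>v v))"
    by simp_all
qed

text \<open>Transfers the moment bounds of \<open>psd_moment_bounds\<close> to traces of
  powers.\<close>

lemma mat_trace_unit_vec:
  assumes "A \<in> carrier_mat k k"
  shows "mat_trace A = (\<Sum>i<k. unit_vec k i \<bullet> (A *\<^sub>v unit_vec k i))"
  unfolding mat_trace_def using assms by (intro sum.cong) auto

lemma mat_trace_comm:
  fixes A B :: "real Matrix.mat"
  assumes "A \<in> carrier_mat m k" "B \<in> carrier_mat k m"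
  shows "mat_trace (A * B) = mat_trace (B * A)"
proof -
  have "mat_trace (A * B) = (\<Sum>i<m. \<Sum>j<k. A $$ (i, j) * B $$ (j, i))"
    using assms by (simp add: mat_trace_def scalar_prod_def atLeast0LessThan)
  also have "\<dots> = (\<Sum>j<k. \<Sum>i<m. A $$ (i, j) * B $$ (j, i))" by (rule sum.swap)
  also have "\<dots> = mat_trace (B * A)"
    using assms by (simp add: mat_trace_def scalar_prod_def atLeast0LessThan mult.commute)
  finally show ?thesis .
qed

lemma mat_trace_transpose_mult:
  fixes F :: "real Matrix.mat"
  assumes "F \<in> carrier_mat m k"
  shows "mat_trace (F\<^sup>T * F) = (\<Sum>j<m. \<Sum>i<k. (F $$ (j, i))\<^sup>2)"
  using assms by (subst sum.swap)
    (simp add: mat_trace_def scalar_prod_def atLeast0LessThan power2_eq_square)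

text \<open>Cauchy-Schwarz in each row; the trace is the squared Frobenius norm of
  \<open>F\<close>.\<close>

lemma mult_mat_vec_sq_le_trace:
  fixes F :: "real Matrix.mat"
  assumes F: "F \<in> carrier_mat m k" and v: "v \<in> carrier_vec k"
  shows "(F *\<^sub>v v) \<bullet> (F *\<^sub>v v) \<le> mat_trace (F\<^sup>T * F) * (v \<bullet> v)"
proof -
  have "(F *\<^sub>v v) \<bullet> (F *\<^sub>v v) = (\<Sum>j<m. (\<Sum>i<k. F $$ (j, i) * v $ i)\<^sup>2)"
    using F v by (simp add: scalar_prod_def atLeast0LessThan power2_eq_square)
  also have "\<dots> \<le> (\<Sum>j<m. (\<Sum>i<k. (F $$ (j, i))\<^sup>2) * (\<Sum>i<k. (v $ i)\<^sup>2))"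
    by (intro sum_mono Cauchy_Schwarz_ineq_sum)
  also have "\<dots> = mat_trace (F\<^sup>T * F) * (v \<bullet> v)"
    using v by (simp add: mat_trace_transpose_mult[OF F] sum_distrib_right scalar_prod_def
        atLeast0LessThan power2_eq_square)
  finally show ?thesis .
qed

section \<open>A deterministic loss bound\<close>

lemma scalar_prod_minus_self_le:
  fixes v w :: "real Matrix.vec"
  assumes v: "v \<in> carrier_vec n" and w: "w \<in> carrier_vec n"
  shows "(v - w) \<bullet> (v - w) \<le> 2 * (v \<bullet> v) + 2 * (w \<bullet> w)"
proof -
  have "w \<bullet> v = v \<bullet> w" by (rule comm_scalar_prod[OF w v])
  then have "(v - w) \<bullet> (v - w) = v \<bullet> v - 2 * (v \<bullet> w) + w \<bullet> w"
    and "(v + w) \<bullet> (v + w) = v \<bullet> v + 2 * (v \<bullet> w) + w \<bullet> w"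
    using v w by (simp_all add: minus_scalar_prod_distrib[of _ n] scalar_prod_minus_distrib[of _ n]
        add_scalar_prod_distrib[of _ n] scalar_prod_add_distrib[of _ n])
  with scalar_prod_self_ge_0[of "v + w"] show ?thesis by linarith
qed

text \<open>Cauchy-Schwarz in each row after moving \<open>sqrt (d i)\<close> from one factor to the
  other. Used with the diagonal of \<open>D\<close> both for the noise design and for the signal
  design, and with unit weights for \<open>H *\<^sub>v \<Lambda>\<close>.\<close>

lemma mult_mat_vec_sq_le_weighted:
  fixes H :: "real Matrix.mat"
  assumes H: "H \<in> carrier_mat n k" and u: "u \<in> carrier_vec k" and d: "\<And>i. i < k \<Longrightarrow> 0 < d i"
  shows "(H *\<^sub>v u) \<bullet> (H *\<^sub>v u) \<le> (\<Sum>j<n. \<Sum>i<k. (H $$ (j, i))\<^sup>2 / d i) * (\<Sum>i<k. d i * (u $ i)\<^sup>2)"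
proof -
  have "(H *\<^sub>v u) \<bullet> (H *\<^sub>v u) = (\<Sum>j<n. (\<Sum>i<k. H $$ (j, i) * u $ i)\<^sup>2)"
    using H u by (simp add: scalar_prod_def atLeast0LessThan power2_eq_square)
  also have "\<dots> = (\<Sum>j<n. (\<Sum>i<k. (H $$ (j, i) / sqrt (d i)) * (sqrt (d i) * u $ i))\<^sup>2)"
    using d by (intro sum.cong refl arg_cong[where f = "\<lambda>x. x\<^sup>2"]) (auto dest: d)
  also have "\<dots> \<le> (\<Sum>j<n. (\<Sum>i<k. (H $$ (j, i) / sqrt (d i))\<^sup>2) * (\<Sum>i<k. (sqrt (d i) * u $ i)\<^sup>2))"
    by (intro sum_mono Cauchy_Schwarz_ineq_sum)
  also have "\<dots> = (\<Sum>j<n. \<Sum>i<k. (H $$ (j, i) / sqrt (d i))\<^sup>2) * (\<Sum>i<k. (sqrt (d i) * u $ i)\<^sup>2)"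
    by (rule sum_distrib_right[symmetric])
  also have "(\<Sum>j<n. \<Sum>i<k. (H $$ (j, i) / sqrt (d i))\<^sup>2) = (\<Sum>j<n. \<Sum>i<k. (H $$ (j, i))\<^sup>2 / d i)"
    by (intro sum.cong refl) (use d in \<open>auto simp: power_divide less_imp_le\<close>)
  also have "(\<Sum>i<k. (sqrt (d i) * u $ i)\<^sup>2) = (\<Sum>i<k. d i * (u $ i)\<^sup>2)"
    by (intro sum.cong refl) (use d in \<open>auto simp: power_mult_distrib less_imp_le\<close>)
  finally show ?thesis .
qed

text \<open>Here \<open>q\<close> is the squared norm of the projected noise,
  \<open>\<Delta>\<close> its coefficient vector, and \<open>\<alpha>\<close>, \<open>\<eta>\<close>
  are the parts of the score that are linear and quadratic in the noise. Two passes are made.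
  Cauchy-Schwarz in the metric of \<open>D\<close> together with \<open>low\<close> bounds the
  weighted norm of \<open>\<Delta>\<close> by a multiple of \<open>L\<close>. In the second pass the
  linear part is absorbed into \<open>q\<close>, and the quadratic part is paired with the bound on
  \<open>\<Delta>\<close> just obtained, which produces the square root.\<close>

lemma noise_energy_bound:
  fixes D \<alpha> \<eta> \<Delta> T :: "nat \<Rightarrow> real"
  assumes d: "\<And>i. i < K \<Longrightarrow> dmin \<le> D i" and dmin: "0 < dmin"
    and pos: "0 < N" "0 < r" "0 < x" "0 < t" "0 < a" "1 \<le> J" "0 < K" and L: "0 \<le> L"
    and q: "q = (\<Sum>i<K. \<Delta> i * \<alpha> i) + (\<Sum>i<K. \<Delta> i * \<eta> i)"
    and low: "N * r / 4 * (\<Sum>i<K. D i * (\<Delta> i)\<^sup>2) \<le> q"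
    and \<alpha>: "(\<Sum>i<K. (\<alpha> i)\<^sup>2 / D i) \<le> N\<^sup>2 * x * real K * a"
    and \<eta>: "\<And>i. i < K \<Longrightarrow> \<bar>\<eta> i\<bar> \<le> N * x * real K * a * T i"
    and T: "\<And>i. i < K \<Longrightarrow> (T i)\<^sup>2 * (a * real K * t) \<le> J * D i"
    and signal: "t * a * J \<le> L" and t: "4 * x / r \<le> t"
  shows "q \<le> N * a * (4 * x * real K / r
      + 2 * x * real K * sqrt (8 * real K / r + 2 * (real K)\<^sup>2) * sqrt (L / dmin * (\<Sum>i<K. (T i)\<^sup>2)))"
proof -
  define S where "S = (\<Sum>i<K. D i * (\<Delta> i)\<^sup>2)"
  define W where "W = (\<Sum>i<K. (\<alpha> i + \<eta> i)\<^sup>2 / D i)"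
  define k where "k = real K"
  have k: "1 \<le> k" using pos by (simp add: k_def)
  have D: "0 < D i" if "i < K" for i using d[OF that] dmin by simp
  have S0: "0 \<le> S" unfolding S_def by (intro sum_nonneg mult_nonneg_nonneg) (auto intro: less_imp_le D)
  have xt: "x / t \<le> r / 4" using t pos by (simp add: field_simps)
  have "(\<Sum>i<K. (\<eta> i)\<^sup>2 / D i) \<le> (\<Sum>i<K. N\<^sup>2 * x\<^sup>2 * k * a * J / t)"
  proof (rule sum_mono)
    fix i assume "i \<in> {..<K}"
    then have i: "i < K" by simp
    have "(\<eta> i)\<^sup>2 \<le> (N * x * k * a * T i)\<^sup>2"
      using \<eta>[OF i] by (metis k_def abs_le_square_iff abs_ge_self order_trans)
    also have "\<dots> = N\<^sup>2 * x\<^sup>2 * k * a / t * ((T i)\<^sup>2 * (a * k * t))"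
      using pos by (simp add: power2_eq_square)
    also have "\<dots> \<le> N\<^sup>2 * x\<^sup>2 * k * a / t * (J * D i)"
      using T[OF i] pos k by (intro mult_left_mono) (auto simp: k_def)
    finally show "(\<eta> i)\<^sup>2 / D i \<le> N\<^sup>2 * x\<^sup>2 * k * a * J / t"
      using D[OF i] by (simp add: field_simps)
  qed
  then have \<eta>2: "(\<Sum>i<K. (\<eta> i)\<^sup>2 / D i) \<le> N\<^sup>2 * x\<^sup>2 * k\<^sup>2 * a * J / t"
    by (simp add: k_def power2_eq_square mult_ac)
  have "W \<le> (\<Sum>i<K. 2 * ((\<alpha> i)\<^sup>2 / D i) + 2 * ((\<eta> i)\<^sup>2 / D i))"
    unfolding W_def
  proof (rule sum_mono)
    fix i assume "i \<in> {..<K}"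
    then have i: "i < K" by simp
    have "(\<alpha> i + \<eta> i)\<^sup>2 \<le> 2 * (\<alpha> i)\<^sup>2 + 2 * (\<eta> i)\<^sup>2"
      using zero_le_power2[of "\<alpha> i - \<eta> i"] by (simp add: power2_eq_square algebra_simps)
    from divide_right_mono[OF this less_imp_le[OF D[OF i]]]
    show "(\<alpha> i + \<eta> i)\<^sup>2 / D i \<le> 2 * ((\<alpha> i)\<^sup>2 / D i) + 2 * ((\<eta> i)\<^sup>2 / D i)"
      by (simp add: add_divide_distrib)
  qed
  also have "\<dots> = 2 * (\<Sum>i<K. (\<alpha> i)\<^sup>2 / D i) + 2 * (\<Sum>i<K. (\<eta> i)\<^sup>2 / D i)"
    by (simp add: sum.distrib sum_distrib_left)
  also have "\<dots> \<le> 2 * (N\<^sup>2 * x * k * a * J) + 2 * (N\<^sup>2 * x\<^sup>2 * k\<^sup>2 * a * J / t)"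
  proof -
    have "N\<^sup>2 * x * k * a * 1 \<le> N\<^sup>2 * x * k * a * J"
      using pos k by (intro mult_left_mono) auto
    then show ?thesis using \<alpha> \<eta>2 by (simp add: k_def)
  qed
  \<comment> \<open>The factor \<open>t * a * J\<close> is isolated because \<open>signal\<close>
    bounds it by \<open>L\<close>; the rest involves only \<open>k\<close> and \<open>x / t\<close>,
    and the latter is at most \<open>r / 4\<close>.\<close>
  also have "\<dots> = 2 * N\<^sup>2 * (t * a * J) * (k * (x / t) + k\<^sup>2 * (x / t)\<^sup>2)"
    using pos by (simp add: field_simps power2_eq_square)
  also have "\<dots> \<le> 2 * N\<^sup>2 * L * (k * (r / 4) + k\<^sup>2 * (r / 4)\<^sup>2)"
    using xt signal pos k L by (intro mult_mono add_mono power_mono mult_left_mono) auto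
  finally have W: "W \<le> 2 * N\<^sup>2 * L * (k * (r / 4) + k\<^sup>2 * (r / 4)\<^sup>2)" .
  \<comment> \<open>Combined with \<open>low\<close>, which bounds \<open>S\<close> by a multiple of
    \<open>q\<close>, this becomes a quadratic inequality in \<open>S\<close> alone.\<close>
  have "q\<^sup>2 \<le> S * W"
  proof -
    have "q = (\<Sum>i<K. (sqrt (D i) * \<Delta> i) * ((\<alpha> i + \<eta> i) / sqrt (D i)))"
      unfolding q sum.distrib[symmetric]
    proof (intro sum.cong refl)
      fix i assume "i \<in> {..<K}"
      then have "sqrt (D i) \<noteq> 0" using D[of i] by simp
      then show "\<Delta> i * \<alpha> i + \<Delta> i * \<eta> i = (sqrt (D i) * \<Delta> i) * ((\<alpha> i + \<eta> i) / sqrt (D i))"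
        by (simp add: field_simps)
    qed
    then have "q\<^sup>2 \<le> (\<Sum>i<K. (sqrt (D i) * \<Delta> i)\<^sup>2) * (\<Sum>i<K. ((\<alpha> i + \<eta> i) / sqrt (D i))\<^sup>2)"
      by (simp only: Cauchy_Schwarz_ineq_sum)
    also have "(\<Sum>i<K. (sqrt (D i) * \<Delta> i)\<^sup>2) = S"
      unfolding S_def by (intro sum.cong refl) (use D in \<open>auto simp: power_mult_distrib less_imp_le\<close>)
    also have "(\<Sum>i<K. ((\<alpha> i + \<eta> i) / sqrt (D i))\<^sup>2) = W"
      unfolding W_def by (intro sum.cong refl) (use D in \<open>auto simp: power_divide less_imp_le\<close>)
    finally show ?thesis .
  qed
  moreover have "(N * r / 4 * S)\<^sup>2 \<le> q\<^sup>2"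
    using low pos S0 by (intro power_mono) (auto simp: S_def)
  ultimately have SW: "S * (N\<^sup>2 * r\<^sup>2 / 16 * S) \<le> S * W" by (simp add: power2_eq_square mult_ac)
  \<comment> \<open>Obtained by dividing the bound on \<open>W\<close> by
    \<open>N\<^sup>2 * r\<^sup>2 / 16\<close>.\<close>
  define C where "C = 8 * k / r + 2 * k\<^sup>2"
  have C0: "0 \<le> C" using pos k by (simp add: C_def)
  have SC: "S \<le> C * L"
  proof (cases "S = 0")
    case True
    then show ?thesis using C0 L by simp
  next
    case False
    then have "N\<^sup>2 * r\<^sup>2 / 16 * S \<le> W" using SW S0 by simp
    also note W
    also have "2 * N\<^sup>2 * L * (k * (r / 4) + k\<^sup>2 * (r / 4)\<^sup>2) = N\<^sup>2 * r\<^sup>2 / 16 * (C * L)"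
      using pos by (simp add: C_def field_simps power2_eq_square)
    finally show ?thesis using pos by (simp add: mult_le_cancel_left)
  qed
  \<comment> \<open>Young's inequality, weighted so that by \<open>low\<close> the quadratic term in
    \<open>\<Delta>\<close> is at most \<open>q / 2\<close> and can be moved to the left-hand
    side.\<close>
  have "(\<Sum>i<K. \<Delta> i * \<alpha> i) \<le> (\<Sum>i<K. N * r / 8 * (D i * (\<Delta> i)\<^sup>2) + 2 / (N * r) * ((\<alpha> i)\<^sup>2 / D i))"
  proof (rule sum_mono)
    fix i assume "i \<in> {..<K}"
    then have Di: "0 < D i" using D by simp
    have "0 \<le> (N * r * D i * \<Delta> i - 4 * \<alpha> i)\<^sup>2 / (8 * N * r * D i)"
      using pos Di by simp
    also have "\<dots> = N * r / 8 * (D i * (\<Delta> i)\<^sup>2) + 2 / (N * r) * ((\<alpha> i)\<^sup>2 / D i) - \<Delta> i * \<alpha> i"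
      using pos Di by (simp add: power2_eq_square field_simps)
    finally show "\<Delta> i * \<alpha> i \<le> N * r / 8 * (D i * (\<Delta> i)\<^sup>2) + 2 / (N * r) * ((\<alpha> i)\<^sup>2 / D i)" by simp
  qed
  also have "\<dots> = N * r / 8 * S + 2 / (N * r) * (\<Sum>i<K. (\<alpha> i)\<^sup>2 / D i)"
    by (simp add: S_def sum.distrib sum_distrib_left)
  also have "\<dots> \<le> q / 2 + 2 / (N * r) * (N\<^sup>2 * x * k * a)"
    using low \<alpha> pos by (intro add_mono mult_left_mono) (auto simp: S_def k_def)
  also have "2 / (N * r) * (N\<^sup>2 * x * k * a) = N * a * (2 * x * k / r)"
    using pos by (simp add: field_simps power2_eq_square)
  finally have 1: "(\<Sum>i<K. \<Delta> i * \<alpha> i) \<le> q / 2 + N * a * (2 * x * k / r)" .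
  \<comment> \<open>The second pass is Euclidean: the target contains unweighted squares of
    \<open>T\<close>, and leaving the metric of \<open>D\<close> costs the factor
    \<open>1 / dmin\<close>, hence the condition number.\<close>
  have "(\<Sum>i<K. \<Delta> i * \<eta> i)\<^sup>2 \<le> (\<Sum>i<K. (\<Delta> i)\<^sup>2) * (\<Sum>i<K. (\<eta> i)\<^sup>2)"
    by (rule Cauchy_Schwarz_ineq_sum)
  also have "\<dots> \<le> (C * (L / dmin)) * ((N * x * k * a)\<^sup>2 * (\<Sum>i<K. (T i)\<^sup>2))"
  proof (rule mult_mono)
    have "dmin * (\<Sum>i<K. (\<Delta> i)\<^sup>2) \<le> S"
      unfolding S_def sum_distrib_left by (intro sum_mono mult_right_mono) (auto intro: d)
    then show "(\<Sum>i<K. (\<Delta> i)\<^sup>2) \<le> C * (L / dmin)" using SC dmin by (simp add: field_simps)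
    show "(\<Sum>i<K. (\<eta> i)\<^sup>2) \<le> (N * x * k * a)\<^sup>2 * (\<Sum>i<K. (T i)\<^sup>2)"
      unfolding sum_distrib_left
    proof (rule sum_mono)
      fix i assume "i \<in> {..<K}"
      then have "\<bar>\<eta> i\<bar> \<le> \<bar>N * x * k * a * T i\<bar>" using \<eta>[of i] by (simp add: k_def)
      then show "(\<eta> i)\<^sup>2 \<le> (N * x * k * a)\<^sup>2 * (T i)\<^sup>2"
        by (simp add: abs_le_square_iff power_mult_distrib)
    qed
  qed (use C0 L dmin in \<open>auto intro: sum_nonneg\<close>)
  also have "\<dots> = (N * x * k * a)\<^sup>2 * (C * (L / dmin * (\<Sum>i<K. (T i)\<^sup>2)))" by (simp add: mult_ac)
  finally have "(\<Sum>i<K. \<Delta> i * \<eta> i)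
      \<le> sqrt ((N * x * k * a)\<^sup>2 * (C * (L / dmin * (\<Sum>i<K. (T i)\<^sup>2))))"
    by (rule real_le_rsqrt)
  also have "\<dots> = N * x * k * a * (sqrt C * sqrt (L / dmin * (\<Sum>i<K. (T i)\<^sup>2)))"
  proof -
    have "0 \<le> N * x * k * a" using pos k by simp
    then show ?thesis
      by (subst real_sqrt_mult[of "(N * x * k * a)\<^sup>2"], subst real_sqrt_mult[of C]) simp
  qed
  finally have "q \<le> q / 2 + N * a * (2 * x * k / r)
      + N * x * k * a * (sqrt C * sqrt (L / dmin * (\<Sum>i<K. (T i)\<^sup>2)))"
    using 1 q by linarith
  then have "q \<le> 2 * (N * a * (2 * x * k / r))
      + 2 * (N * x * k * a * (sqrt C * sqrt (L / dmin * (\<Sum>i<K. (T i)\<^sup>2))))" by linarith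
  also have "\<dots> = N * a * (4 * x * k / r + 2 * x * k * sqrt C * sqrt (L / dmin * (\<Sum>i<K. (T i)\<^sup>2)))"
    by (simp add: distrib_left mult_ac)
  finally show ?thesis unfolding C_def k_def .
qed

text \<open>The loss splits orthogonally into the noise projected onto the range of \<open>A + H\<close> and the
  distance of the signal from that range, the latter being controlled by the competitor \<open>(A + H) \<Lambda>\<close>.\<close>

lemma least_squares_loss_bound:
  fixes A H :: "real Matrix.mat" and D T :: "nat \<Rightarrow> real"
  assumes A: "A \<in> carrier_mat n K" and H: "H \<in> carrier_mat n K"
    and m: "m \<in> carrier_vec n" and e: "e \<in> carrier_vec n"
    and lam: "lam \<in> carrier_vec K" and \<Lambda>: "\<Lambda> \<in> carrier_vec K"
    and normal: "(A + H)\<^sup>T *\<^sub>v (m + e - (A + H) *\<^sub>v lam) = 0\<^sub>v K"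
    and d: "\<And>i. i < K \<Longrightarrow> dmin \<le> D i" "\<And>i. i < K \<Longrightarrow> D i \<le> dmax" and dmin: "0 < dmin"
    and pos: "0 < N" "0 < r" "0 < x" "0 < t" "0 < a" "1 \<le> J" "0 < K"
    and low: "\<And>u. u \<in> carrier_vec K \<Longrightarrow>
      N * r * (\<Sum>i<K. D i * (u $ i)\<^sup>2) \<le> (A *\<^sub>v u) \<bullet> (A *\<^sub>v u)"
    and E1: "(\<Sum>j<n. \<Sum>i<K. (H $$ (j, i))\<^sup>2 / D i) \<le> N * r / 4"
    and E2: "(\<Sum>j<n. \<Sum>i<K. (H $$ (j, i))\<^sup>2) \<le> N * x * a * P"
    and E3: "(\<Sum>i<K. ((A\<^sup>T *\<^sub>v e) $ i)\<^sup>2 / D i) \<le> N\<^sup>2 * x * real K * a"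
    and E4: "\<And>i. i < K \<Longrightarrow> \<bar>(H\<^sup>T *\<^sub>v e) $ i\<bar> \<le> N * x * real K * a * T i"
    and T: "\<And>i. i < K \<Longrightarrow> (T i)\<^sup>2 * (a * real K * t) \<le> J * D i"
    and signal: "t * a * J \<le> (\<Sum>i<K. D i * (\<Lambda> $ i)\<^sup>2)" and t: "4 * x / r \<le> t"
    and P: "1 \<le> real K * (\<Lambda> \<bullet> \<Lambda>) * P"
  shows "((A + H) *\<^sub>v lam - m) \<bullet> ((A + H) *\<^sub>v lam - m) / N
    \<le> 2 / N * ((m - A *\<^sub>v \<Lambda>) \<bullet> (m - A *\<^sub>v \<Lambda>))
      + (2 * x + 4 * x * (real K)\<^sup>2 / r + 2 * x * real K * sqrt (8 * real K / r + 2 * (real K)\<^sup>2)) * a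
        * max (dmax / dmin * (\<Lambda> \<bullet> \<Lambda>) * P) (sqrt (dmax / dmin * (\<Lambda> \<bullet> \<Lambda>) * (\<Sum>i<K. (T i)\<^sup>2)))"
proof -
  define B where "B = A + H"
  have B: "B \<in> carrier_mat n K" using A H by (simp add: B_def)
  have D: "0 < D i" if "i < K" for i using d(1)[OF that] dmin by simp
  have Bu: "B *\<^sub>v u = A *\<^sub>v u + H *\<^sub>v u" if "u \<in> carrier_vec K" for u
    unfolding B_def using A H that by (rule add_mult_distrib_mat_vec)
  \<comment> \<open>By \<open>E1\<close> the perturbation \<open>H\<close> takes away at most half
    of the lower bound \<open>low\<close>, and the inequality for squared norms of differences costs
    another factor 2; this explains \<open>r / 4\<close>.\<close>
  have lowB: "N * r / 4 * (\<Sum>i<K. D i * (u $ i)\<^sup>2) \<le> (B *\<^sub>v u) \<bullet> (B *\<^sub>v u)"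
    if u: "u \<in> carrier_vec K" for u
  proof -
    have Av: "A *\<^sub>v u \<in> carrier_vec n" "H *\<^sub>v u \<in> carrier_vec n" "B *\<^sub>v u \<in> carrier_vec n"
      using A H B u by auto
    have "A *\<^sub>v u = B *\<^sub>v u - H *\<^sub>v u"
      using Av A H unfolding Bu[OF u] by (auto simp: vec_eq_iff)
    then have "(A *\<^sub>v u) \<bullet> (A *\<^sub>v u) \<le> 2 * ((B *\<^sub>v u) \<bullet> (B *\<^sub>v u)) + 2 * ((H *\<^sub>v u) \<bullet> (H *\<^sub>v u))"
      using scalar_prod_minus_self_le[OF Av(3,2)] by simp
    moreover have "(H *\<^sub>v u) \<bullet> (H *\<^sub>v u) \<le> N * r / 4 * (\<Sum>i<K. D i * (u $ i)\<^sup>2)"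
      using mult_mat_vec_sq_le_weighted[OF H u D] E1
      by (rule order_trans[OF _ mult_right_mono]) (auto intro!: sum_nonneg mult_nonneg_nonneg dest: D)
    ultimately show ?thesis using low[OF u] by simp
  qed
  have BB: "B\<^sup>T * B \<in> carrier_mat K K" using B by simp
  note adj = scalar_prod_transpose_mult_vec[OF B]
  have BBv: "(B\<^sup>T * B) *\<^sub>v v = B\<^sup>T *\<^sub>v (B *\<^sub>v v)" if "v \<in> carrier_vec K" for v
    using B that by (intro assoc_mult_mat_vec) auto
  have "0 < v \<bullet> ((B\<^sup>T * B) *\<^sub>v v)" if v: "v \<in> carrier_vec K" "v \<noteq> 0\<^sub>v K" for v
  proof -
    obtain i where i: "i < K" "v $ i \<noteq> 0" using v by (auto simp: vec_eq_iff)
    have "0 < (\<Sum>i<K. D i * (v $ i)\<^sup>2)"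
      by (rule sum_pos2[of _ i]) (use i D in \<open>auto intro!: mult_nonneg_nonneg less_imp_le[OF D]\<close>)
    then have "0 < N * r / 4 * (\<Sum>i<K. D i * (v $ i)\<^sup>2)" using pos by simp
    also note lowB[OF v(1)]
    finally show ?thesis using v B by (simp add: BBv adj)
  qed
  then obtain C where C: "C \<in> carrier_mat K K" "(B\<^sup>T * B) * C = 1\<^sub>m K"
    using posdef_mat_inverse[OF BB] by metis
  \<comment> \<open>Coefficients of the noise projected onto the range of \<open>B\<close>.\<close>
  define \<Delta> where "\<Delta> = C *\<^sub>v (B\<^sup>T *\<^sub>v e)"
  have BTe: "B\<^sup>T *\<^sub>v e \<in> carrier_vec K" using B e by auto
  have \<Delta>: "\<Delta> \<in> carrier_vec K" unfolding \<Delta>_def using C BTe by auto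
  have \<Delta>eq: "B\<^sup>T *\<^sub>v (B *\<^sub>v \<Delta>) = B\<^sup>T *\<^sub>v e"
  proof -
    have "B\<^sup>T *\<^sub>v (B *\<^sub>v \<Delta>) = ((B\<^sup>T * B) * C) *\<^sub>v (B\<^sup>T *\<^sub>v e)"
      unfolding BBv[OF \<Delta>, symmetric] unfolding \<Delta>_def
      by (rule assoc_mult_mat_vec[OF BB C(1) BTe, symmetric])
    then show ?thesis using C BTe by simp
  qed
  define z where "z = B *\<^sub>v lam"
  define p where "p = B *\<^sub>v \<Delta>"
  \<comment> \<open>Since \<open>z\<close> and \<open>p\<close> are the projections of
    \<open>m + e\<close> and \<open>e\<close>, the vector \<open>z - p\<close> is the projection of
    \<open>m\<close>, and \<open>y\<close> is minus the residual of \<open>m\<close>.\<close>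
  define y where "y = z - p - m"
  have c: "z \<in> carrier_vec n" "p \<in> carrier_vec n" "y \<in> carrier_vec n"
    unfolding z_def p_def y_def using B lam \<Delta> m by auto
  have orth: "(B *\<^sub>v u) \<bullet> y = 0" if u: "u \<in> carrier_vec K" for u
  proof -
    have "y = (e - p) - (m + e - z)" unfolding y_def using c m e by (auto simp: vec_eq_iff)
    then have "(B *\<^sub>v u) \<bullet> y = (B *\<^sub>v u) \<bullet> e - (B *\<^sub>v u) \<bullet> p - (B *\<^sub>v u) \<bullet> (m + e - z)"
      using c m e B u by (simp add: scalar_prod_minus_distrib[of _ n])
    also have "(B *\<^sub>v u) \<bullet> p = (B *\<^sub>v u) \<bullet> e"
      unfolding p_def adj[OF u e, symmetric] using adj[of u "B *\<^sub>v \<Delta>"] u \<Delta> B \<Delta>eq by simp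
    also have "(B *\<^sub>v u) \<bullet> (m + e - z) = u \<bullet> (B\<^sup>T *\<^sub>v (m + e - z))"
      using u m e c by (simp add: adj)
    also have "B\<^sup>T *\<^sub>v (m + e - z) = 0\<^sub>v K" using normal by (simp add: B_def z_def)
    finally show ?thesis using u by simp
  qed
  have pyth: "(B *\<^sub>v u + y) \<bullet> (B *\<^sub>v u + y) = (B *\<^sub>v u) \<bullet> (B *\<^sub>v u) + y \<bullet> y"
    if u: "u \<in> carrier_vec K" for u
  proof -
    have "B *\<^sub>v u \<in> carrier_vec n" using B u by auto
    moreover from this have "y \<bullet> (B *\<^sub>v u) = 0"
      using orth[OF u] comm_scalar_prod[OF c(3)] by simp
    ultimately show ?thesis using c orth[OF u]
      by (simp add: add_scalar_prod_distrib[of _ n] scalar_prod_add_distrib[of _ n])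
  qed
  have zm: "(z - m) \<bullet> (z - m) = p \<bullet> p + y \<bullet> y"
  proof -
    have "z - m = B *\<^sub>v \<Delta> + y" using c m unfolding y_def p_def[symmetric] by (auto simp: vec_eq_iff)
    then show ?thesis using pyth[OF \<Delta>] by (simp add: p_def)
  qed
  have yy: "y \<bullet> y \<le> 2 * ((m - A *\<^sub>v \<Lambda>) \<bullet> (m - A *\<^sub>v \<Lambda>)) + 2 * ((H *\<^sub>v \<Lambda>) \<bullet> (H *\<^sub>v \<Lambda>))"
  proof -
    have cl: "A *\<^sub>v \<Lambda> \<in> carrier_vec n" "H *\<^sub>v \<Lambda> \<in> carrier_vec n" using A H \<Lambda> by auto
    \<comment> \<open>The error of the competitor \<open>B *\<^sub>v \<Lambda>\<close> is a vector
      of the range plus \<open>y\<close>, so by \<open>pyth\<close> it is at least as long as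
      \<open>y\<close>. On the other hand it equals \<open>H *\<^sub>v \<Lambda>\<close> minus the
      oracle residual.\<close>
    have "B *\<^sub>v (\<Lambda> - lam + \<Delta>) = B *\<^sub>v (\<Lambda> - lam) + B *\<^sub>v \<Delta>"
      by (rule mult_add_distrib_mat_vec[OF B]) (use \<Lambda> lam \<Delta> in auto)
    also have "B *\<^sub>v (\<Lambda> - lam) = B *\<^sub>v \<Lambda> - z"
      unfolding z_def by (rule mult_minus_distrib_mat_vec[OF B \<Lambda> lam])
    finally have "B *\<^sub>v (\<Lambda> - lam + \<Delta>) + y = H *\<^sub>v \<Lambda> - (m - A *\<^sub>v \<Lambda>)"
      unfolding Bu[OF \<Lambda>] y_def p_def[symmetric]
    proof -
      have "a = b + g - z + p \<Longrightarrow> a + (z - p - m) = g - (m - b)"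
        if "b \<in> carrier_vec n" "g \<in> carrier_vec n" for a b g
        using that c m by (auto simp: vec_eq_iff)
      from this[OF cl] show "B *\<^sub>v (\<Lambda> - lam + \<Delta>) = A *\<^sub>v \<Lambda> + H *\<^sub>v \<Lambda> - z + p \<Longrightarrow>
        B *\<^sub>v (\<Lambda> - lam + \<Delta>) + (z - p - m) = H *\<^sub>v \<Lambda> - (m - A *\<^sub>v \<Lambda>)" .
    qed
    then have "y \<bullet> y \<le> (H *\<^sub>v \<Lambda> - (m - A *\<^sub>v \<Lambda>)) \<bullet> (H *\<^sub>v \<Lambda> - (m - A *\<^sub>v \<Lambda>))"
      using pyth[of "\<Lambda> - lam + \<Delta>"] \<Lambda> lam \<Delta> scalar_prod_self_ge_0[of "B *\<^sub>v (\<Lambda> - lam + \<Delta>)"] by simp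
    also have "\<dots> \<le> 2 * ((H *\<^sub>v \<Lambda>) \<bullet> (H *\<^sub>v \<Lambda>)) + 2 * ((m - A *\<^sub>v \<Lambda>) \<bullet> (m - A *\<^sub>v \<Lambda>))"
      by (rule scalar_prod_minus_self_le[of _ n]) (use cl m in auto)
    finally show ?thesis by simp
  qed
  have LL: "\<Lambda> \<bullet> \<Lambda> = (\<Sum>i<K. (\<Lambda> $ i)\<^sup>2)"
    using \<Lambda> by (simp add: scalar_prod_def power2_eq_square atLeast0LessThan)
  have HL: "(H *\<^sub>v \<Lambda>) \<bullet> (H *\<^sub>v \<Lambda>) \<le> (N * x * a * P) * (\<Lambda> \<bullet> \<Lambda>)"
    using mult_mat_vec_sq_le_weighted[OF H \<Lambda>, of "\<lambda>_. 1"] mult_right_mono[OF E2, of "\<Lambda> \<bullet> \<Lambda>"]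
      scalar_prod_self_ge_0[of \<Lambda>] by (simp add: LL)
  have d01: "dmin \<le> dmax" using d[of 0] pos(7) by simp
  define L where "L = dmax * (\<Lambda> \<bullet> \<Lambda>)"
  have L0: "0 \<le> L" using d01 dmin scalar_prod_self_ge_0[of \<Lambda>] by (simp add: L_def)
  have "(\<Sum>i<K. D i * (\<Lambda> $ i)\<^sup>2) \<le> L"
    unfolding L_def LL sum_distrib_left by (intro sum_mono mult_right_mono) (auto intro: d)
  then have sig: "t * a * J \<le> L" using signal by simp
  have pp: "p \<bullet> p = (\<Sum>i<K. \<Delta> $ i * (A\<^sup>T *\<^sub>v e) $ i) + (\<Sum>i<K. \<Delta> $ i * (H\<^sup>T *\<^sub>v e) $ i)"
  proof -
    have "p \<bullet> p = \<Delta> \<bullet> (B\<^sup>T *\<^sub>v e)"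
      unfolding \<Delta>eq[symmetric] using adj[OF \<Delta>, of p] c by (simp add: p_def)
    also have "B\<^sup>T *\<^sub>v e = A\<^sup>T *\<^sub>v e + H\<^sup>T *\<^sub>v e"
      unfolding B_def transpose_add[OF A H] using A H e by (intro add_mult_distrib_mat_vec) auto
    also have "\<Delta> \<bullet> \<dots> = \<Delta> \<bullet> (A\<^sup>T *\<^sub>v e) + \<Delta> \<bullet> (H\<^sup>T *\<^sub>v e)"
      by (rule scalar_prod_add_distrib[of _ K]) (use A H e \<Delta> in auto)
    finally show ?thesis using A H by (simp add: scalar_prod_def atLeast0LessThan)
  qed
  define M1 where "M1 = dmax / dmin * (\<Lambda> \<bullet> \<Lambda>) * P"
  define M2 where "M2 = sqrt (dmax / dmin * (\<Lambda> \<bullet> \<Lambda>) * (\<Sum>i<K. (T i)\<^sup>2))"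
  have P0: "0 \<le> P"
  proof (rule ccontr)
    assume "\<not> 0 \<le> P"
    then have "real K * (\<Lambda> \<bullet> \<Lambda>) * P \<le> 0"
      using scalar_prod_self_ge_0[of \<Lambda>] by (intro mult_nonneg_nonpos) auto
    then show False using P by simp
  qed
  have M1: "(\<Lambda> \<bullet> \<Lambda>) * P \<le> M1"
  proof -
    have "1 * ((\<Lambda> \<bullet> \<Lambda>) * P) \<le> dmax / dmin * ((\<Lambda> \<bullet> \<Lambda>) * P)"
      using d01 dmin P0 scalar_prod_self_ge_0[of \<Lambda>] by (intro mult_right_mono) auto
    then show ?thesis by (simp add: M1_def)
  qed
  have "p \<bullet> p \<le> N * a * (4 * x * real K / r
      + 2 * x * real K * sqrt (8 * real K / r + 2 * (real K)\<^sup>2) * sqrt (L / dmin * (\<Sum>i<K. (T i)\<^sup>2)))"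
    by (rule noise_energy_bound[OF d(1) dmin pos L0 pp _ E3 E4 T sig t])
      (use lowB[OF \<Delta>] in \<open>auto simp: p_def\<close>)
  also have "sqrt (L / dmin * (\<Sum>i<K. (T i)\<^sup>2)) = M2" by (simp add: L_def M2_def)
  finally have q: "p \<bullet> p / N \<le> a * (4 * x * real K / r + 2 * x * real K * sqrt (8 * real K / r + 2 * (real K)\<^sup>2) * M2)"
    using pos by (simp add: field_simps)
  \<comment> \<open>The only term without a factor \<open>\<Lambda>\<close>; hypothesis
    \<open>P\<close> permits multiplying it by
    \<open>real K * (\<Lambda> \<bullet> \<Lambda>) * P\<close>, at the price of one more factor
    \<open>K\<close> in the constant.\<close>
  have "4 * x * real K / r * 1 \<le> 4 * x * real K / r * (real K * ((\<Lambda> \<bullet> \<Lambda>) * P))"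
    using P pos by (intro mult_left_mono) (auto simp: mult_ac)
  also have "\<dots> \<le> 4 * x * real K / r * (real K * M1)"
    using M1 pos by (intro mult_left_mono) auto
  finally have k1: "4 * x * real K / r \<le> 4 * x * (real K)\<^sup>2 / r * M1" by (simp add: power2_eq_square mult_ac)
  have "((z - m) \<bullet> (z - m)) / N \<le> 2 / N * ((m - A *\<^sub>v \<Lambda>) \<bullet> (m - A *\<^sub>v \<Lambda>))
      + 2 / N * ((H *\<^sub>v \<Lambda>) \<bullet> (H *\<^sub>v \<Lambda>)) + p \<bullet> p / N"
    using divide_right_mono[OF yy, of N] pos by (simp add: zm add_divide_distrib)
  also have "2 / N * ((H *\<^sub>v \<Lambda>) \<bullet> (H *\<^sub>v \<Lambda>)) \<le> 2 / N * ((N * x * a * P) * (\<Lambda> \<bullet> \<Lambda>))"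
    using HL pos by (intro mult_left_mono) auto
  also have "\<dots> = 2 * x * a * ((\<Lambda> \<bullet> \<Lambda>) * P)" using pos by simp
  also have "\<dots> \<le> 2 * x * a * M1" using M1 pos by (intro mult_left_mono) auto
  finally have f: "((z - m) \<bullet> (z - m)) / N \<le> 2 / N * ((m - A *\<^sub>v \<Lambda>) \<bullet> (m - A *\<^sub>v \<Lambda>))
      + 2 * x * a * M1 + a * (4 * x * (real K)\<^sup>2 / r * M1 + 2 * x * real K * sqrt (8 * real K / r + 2 * (real K)\<^sup>2) * M2)"
    using q mult_left_mono[OF k1, of a] pos by (simp add: algebra_simps)
  have g1: "2 * x * a * M1 \<le> 2 * x * a * max M1 M2"
    using pos by (intro mult_left_mono) auto
  have g2: "4 * x * (real K)\<^sup>2 / r * M1 \<le> 4 * x * (real K)\<^sup>2 / r * max M1 M2"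
    using pos by (intro mult_left_mono) auto
  have g3: "2 * x * real K * sqrt (8 * real K / r + 2 * (real K)\<^sup>2) * M2 \<le> 2 * x * real K * sqrt (8 * real K / r + 2 * (real K)\<^sup>2) * max M1 M2"
    using pos by (intro mult_left_mono) auto
  have "a * (4 * x * (real K)\<^sup>2 / r * M1 + 2 * x * real K * sqrt (8 * real K / r + 2 * (real K)\<^sup>2) * M2)
      \<le> a * (4 * x * (real K)\<^sup>2 / r * max M1 M2 + 2 * x * real K * sqrt (8 * real K / r + 2 * (real K)\<^sup>2) * max M1 M2)"
    using g2 g3 pos by (intro mult_left_mono add_mono) auto
  with f g1 have "((z - m) \<bullet> (z - m)) / N \<le> 2 / N * ((m - A *\<^sub>v \<Lambda>) \<bullet> (m - A *\<^sub>v \<Lambda>))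
      + 2 * x * a * max M1 M2
      + a * (4 * x * (real K)\<^sup>2 / r * max M1 M2 + 2 * x * real K * sqrt (8 * real K / r + 2 * (real K)\<^sup>2) * max M1 M2)"
    by linarith
  then show ?thesis unfolding z_def B_def M1_def M2_def by (simp add: algebra_simps)
qed

section \<open>The Krylov design\<close>

lemma Sigma_mat_carrier: "X \<in> carrier_mat n p \<Longrightarrow> Sigma_mat X \<in> carrier_mat p p"
  by (simp add: Sigma_mat_def)

lemma transpose_smult_mat:
  fixes A :: "real Matrix.mat"
  shows "(c \<cdot>\<^sub>m A)\<^sup>T = c \<cdot>\<^sub>m A\<^sup>T"
  by (intro eq_matI) auto

lemma smult_mat_mult_vec:
  fixes A :: "real Matrix.mat"
  assumes "A \<in> carrier_mat n k" "v \<in> carrier_vec k"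
  shows "(c \<cdot>\<^sub>m A) *\<^sub>v v = c \<cdot>\<^sub>v (A *\<^sub>v v)"
  using assms by (intro eq_vecI) (auto simp: row_smult)

lemma transpose_Sigma_mat:
  assumes X: "X \<in> carrier_mat n p"
  shows "(Sigma_mat X)\<^sup>T = Sigma_mat X"
  using X by (simp add: Sigma_mat_def transpose_smult_mat transpose_mult[of _ p n _ p])

lemma Sigma_mat_mult_vec:
  assumes X: "X \<in> carrier_mat n p" and v: "v \<in> carrier_vec p"
  shows "Sigma_mat X *\<^sub>v v = (1 / real n) \<cdot>\<^sub>v (X\<^sup>T *\<^sub>v (X *\<^sub>v v))"
proof -
  have "Sigma_mat X *\<^sub>v v = (1 / real n) \<cdot>\<^sub>v ((X\<^sup>T * X) *\<^sub>v v)"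
    unfolding Sigma_mat_def using X v by (subst smult_mat_mult_vec[of _ p p]) auto
  then show ?thesis using X v by (simp add: assoc_mult_mat_vec[of _ p n _ p])
qed

lemma scalar_prod_Sigma_mat:
  assumes X: "X \<in> carrier_mat n p" and v: "v \<in> carrier_vec p" and w: "w \<in> carrier_vec p"
  shows "v \<bullet> (Sigma_mat X *\<^sub>v w) = ((X *\<^sub>v v) \<bullet> (X *\<^sub>v w)) / real n"
  using assms scalar_prod_transpose_mult_vec[OF X v, of "X *\<^sub>v w"]
  by (simp add: Sigma_mat_mult_vec[OF X])

lemma psd_Sigma_mat: "X \<in> carrier_mat n p \<Longrightarrow> psd p (Sigma_mat X)"
  unfolding psd_def
  by (simp add: Sigma_mat_carrier transpose_Sigma_mat scalar_prod_Sigma_mat[of X n p] scalar_prod_self_ge_0)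

text \<open>The map sending the response \<open>Y\<close> to the \<open>i\<close>-th column of \<open>X\<close> times the Krylov matrix of \<open>Y\<close>;
  it is the \<open>(i + 1)\<close>-st power of \<open>X X\<^sup>T / n\<close>.\<close>

definition krylov_map :: "real Matrix.mat \<Rightarrow> nat \<Rightarrow> real Matrix.mat" where
  "krylov_map X i = (1 / real (dim_row X)) \<cdot>\<^sub>m (X * (Sigma_mat X ^\<^sub>m i * X\<^sup>T))"

definition krylov_design :: "real Matrix.mat \<Rightarrow> nat \<Rightarrow> real Matrix.vec \<Rightarrow> real Matrix.mat" where
  "krylov_design X K y = X * G_hat X y K"

context
  fixes X :: "real Matrix.mat" and n p :: nat
  assumes X: "X \<in> carrier_mat n p"
begin

private abbreviation (input) "S \<equiv> Sigma_mat X"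

private lemma S: "S \<in> carrier_mat p p" "S\<^sup>T = S"
  by (rule Sigma_mat_carrier[OF X], rule transpose_Sigma_mat[OF X])

private lemma P: "S ^\<^sub>m i \<in> carrier_mat p p"
  by (rule pow_carrier_mat[OF S(1)])

private lemma XT: "X\<^sup>T \<in> carrier_mat p n"
  using X by simp

private lemma dims: "dim_row X = n" "dim_col X = p"
  using X by auto

lemma krylov_map_carrier: "krylov_map X i \<in> carrier_mat n n"
  unfolding krylov_map_def by (intro smult_carrier_mat mult_carrier_mat[OF X] mult_carrier_mat[OF P XT])

lemma transpose_krylov_map: "(krylov_map X i)\<^sup>T = krylov_map X i"
proof -
  have "(X * (S ^\<^sub>m i * X\<^sup>T))\<^sup>T = (S ^\<^sub>m i * X\<^sup>T)\<^sup>T * X\<^sup>T"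
    by (rule transpose_mult[OF X mult_carrier_mat[OF P XT]])
  also have "(S ^\<^sub>m i * X\<^sup>T)\<^sup>T = X * S ^\<^sub>m i"
    unfolding transpose_mult[OF P XT] transpose_pow_mat[OF S] by simp
  also have "(X * S ^\<^sub>m i) * X\<^sup>T = X * (S ^\<^sub>m i * X\<^sup>T)" by (rule assoc_mult_mat[OF X P XT])
  finally have "(X * (S ^\<^sub>m i * X\<^sup>T))\<^sup>T = X * (S ^\<^sub>m i * X\<^sup>T)" .
  then show ?thesis by (simp add: krylov_map_def transpose_smult_mat)
qed

text \<open>Cyclicity of the trace moves \<open>X\<close> to the right of \<open>X\<^sup>T\<close>,
  where the two form one further factor \<open>Sigma_mat X\<close>; hence the exponent
  \<open>Suc i\<close>.\<close>

lemma trace_krylov_map: "mat_trace (krylov_map X i) = mat_trace (S ^\<^sub>m Suc i)"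
proof -
  have sm: "mat_trace (c \<cdot>\<^sub>m A) = c * mat_trace A" if "A \<in> carrier_mat q q" for c A q
    using that by (simp add: mat_trace_def sum_distrib_left)
  have "mat_trace (X * (S ^\<^sub>m i * X\<^sup>T)) = mat_trace ((S ^\<^sub>m i * X\<^sup>T) * X)"
    by (rule mat_trace_comm[OF X mult_carrier_mat[OF P XT]])
  also have "(S ^\<^sub>m i * X\<^sup>T) * X = S ^\<^sub>m i * (X\<^sup>T * X)"
    by (rule assoc_mult_mat[OF P XT X])
  finally have "mat_trace (krylov_map X i) = (1 / real n) * mat_trace (S ^\<^sub>m i * (X\<^sup>T * X))"
    unfolding krylov_map_def dims sm[OF mult_carrier_mat[OF X mult_carrier_mat[OF P XT]]] by simp
  also have "\<dots> = mat_trace ((1 / real n) \<cdot>\<^sub>m (S ^\<^sub>m i * (X\<^sup>T * X)))"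
    unfolding sm[OF mult_carrier_mat[OF P mult_carrier_mat[OF XT X]]] ..
  also have "(1 / real n) \<cdot>\<^sub>m (S ^\<^sub>m i * (X\<^sup>T * X)) = S ^\<^sub>m i * S"
    using mult_smult_distrib[OF P mult_carrier_mat[OF XT X], of i "1 / real n"]
    by (simp only: Sigma_mat_def[of X] dims)
  finally show ?thesis by simp
qed

text \<open>The exponents are offset by one: the powers \<open>i + 1\<close> and
  \<open>j + 1\<close> multiply to the power \<open>i + j + 2\<close>, which carries the index
  \<open>i + j + 1\<close>.\<close>

lemma krylov_map_mult: "krylov_map X i * krylov_map X j = krylov_map X (i + j + 1)"
proof -
  have c: "X\<^sup>T \<in> carrier_mat p n" "S ^\<^sub>m i * X\<^sup>T \<in> carrier_mat p n" "S ^\<^sub>m j * X\<^sup>T \<in> carrier_mat p n"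
    "X * (S ^\<^sub>m i * X\<^sup>T) \<in> carrier_mat n n" "X * (S ^\<^sub>m j * X\<^sup>T) \<in> carrier_mat n n"
    by (intro XT mult_carrier_mat[OF X] mult_carrier_mat[OF P XT])+
  have XX: "X\<^sup>T * X \<in> carrier_mat p p" by (rule mult_carrier_mat[OF XT X])
  have "(X * (S ^\<^sub>m i * X\<^sup>T)) * (X * (S ^\<^sub>m j * X\<^sup>T))
      = X * ((S ^\<^sub>m i * X\<^sup>T) * (X * (S ^\<^sub>m j * X\<^sup>T)))"
    by (rule assoc_mult_mat[OF X c(2) c(5)])
  also have "(S ^\<^sub>m i * X\<^sup>T) * (X * (S ^\<^sub>m j * X\<^sup>T)) = S ^\<^sub>m i * (X\<^sup>T * (X * (S ^\<^sub>m j * X\<^sup>T)))"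
    by (rule assoc_mult_mat[OF P c(1) c(5)])
  also have "X\<^sup>T * (X * (S ^\<^sub>m j * X\<^sup>T)) = (X\<^sup>T * X) * (S ^\<^sub>m j * X\<^sup>T)"
    by (rule assoc_mult_mat[OF c(1) X c(3), symmetric])
  finally have "(1 / real n) \<cdot>\<^sub>m ((X * (S ^\<^sub>m i * X\<^sup>T)) * (X * (S ^\<^sub>m j * X\<^sup>T)))
      = (1 / real n) \<cdot>\<^sub>m (X * (S ^\<^sub>m i * ((X\<^sup>T * X) * (S ^\<^sub>m j * X\<^sup>T))))" by simp
  also have "\<dots> = X * ((1 / real n) \<cdot>\<^sub>m (S ^\<^sub>m i * ((X\<^sup>T * X) * (S ^\<^sub>m j * X\<^sup>T))))"
    by (rule mult_smult_distrib[OF X, symmetric]) (rule mult_carrier_mat[OF P mult_carrier_mat[OF XX c(3)]])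
  also have "(1 / real n) \<cdot>\<^sub>m (S ^\<^sub>m i * ((X\<^sup>T * X) * (S ^\<^sub>m j * X\<^sup>T)))
      = S ^\<^sub>m i * ((1 / real n) \<cdot>\<^sub>m ((X\<^sup>T * X) * (S ^\<^sub>m j * X\<^sup>T)))"
    by (rule mult_smult_distrib[OF P, symmetric]) (rule mult_carrier_mat[OF XX c(3)])
  also have "(1 / real n) \<cdot>\<^sub>m ((X\<^sup>T * X) * (S ^\<^sub>m j * X\<^sup>T))
      = ((1 / real n) \<cdot>\<^sub>m (X\<^sup>T * X)) * (S ^\<^sub>m j * X\<^sup>T)"
    by (rule mult_smult_assoc_mat[OF XX c(3), symmetric])
  also have "((1 / real n) \<cdot>\<^sub>m (X\<^sup>T * X)) = S ^\<^sub>m 1"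
    using S(1) by (simp add: Sigma_mat_def dims)
  also have "S ^\<^sub>m i * (S ^\<^sub>m 1 * (S ^\<^sub>m j * X\<^sup>T)) = S ^\<^sub>m (i + j + 1) * X\<^sup>T"
  proof -
    have "S ^\<^sub>m (i + j + 1) = S ^\<^sub>m (i + (1 + j))" by simp
    also have "\<dots> = S ^\<^sub>m i * (S ^\<^sub>m 1 * S ^\<^sub>m j)" unfolding pow_mat_add[OF S(1)] ..
    also have "\<dots> * X\<^sup>T = S ^\<^sub>m i * ((S ^\<^sub>m 1 * S ^\<^sub>m j) * X\<^sup>T)"
      by (rule assoc_mult_mat[OF P mult_carrier_mat[OF P P] c(1)])
    also have "(S ^\<^sub>m 1 * S ^\<^sub>m j) * X\<^sup>T = S ^\<^sub>m 1 * (S ^\<^sub>m j * X\<^sup>T)"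
      by (rule assoc_mult_mat[OF P P c(1)])
    finally show ?thesis by (rule sym)
  qed
  finally have eq: "(1 / real n) \<cdot>\<^sub>m ((X * (S ^\<^sub>m i * X\<^sup>T)) * (X * (S ^\<^sub>m j * X\<^sup>T)))
      = X * (S ^\<^sub>m (i + j + 1) * X\<^sup>T)" .
  have "krylov_map X i * krylov_map X j
      = (1 / real n) \<cdot>\<^sub>m ((X * (S ^\<^sub>m i * X\<^sup>T)) * ((1 / real n) \<cdot>\<^sub>m (X * (S ^\<^sub>m j * X\<^sup>T))))"
    unfolding krylov_map_def dims by (rule mult_smult_assoc_mat[OF c(4) smult_carrier_mat[OF c(5)]])
  also have "(X * (S ^\<^sub>m i * X\<^sup>T)) * ((1 / real n) \<cdot>\<^sub>m (X * (S ^\<^sub>m j * X\<^sup>T)))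
      = (1 / real n) \<cdot>\<^sub>m ((X * (S ^\<^sub>m i * X\<^sup>T)) * (X * (S ^\<^sub>m j * X\<^sup>T)))"
    by (rule mult_smult_distrib[OF c(4,5)])
  finally show ?thesis unfolding eq krylov_map_def dims .
qed

lemma krylov_map_mult_vec:
  assumes y: "y \<in> carrier_vec n"
  shows "krylov_map X i *\<^sub>v y = X *\<^sub>v (S ^\<^sub>m i *\<^sub>v sigma_hat X y)"
proof -
  have "krylov_map X i *\<^sub>v y = (1 / real n) \<cdot>\<^sub>v ((X * (S ^\<^sub>m i * X\<^sup>T)) *\<^sub>v y)"
    unfolding krylov_map_def dims
    by (rule smult_mat_mult_vec[OF mult_carrier_mat[OF X mult_carrier_mat[OF P XT]] y])
  also have "(X * (S ^\<^sub>m i * X\<^sup>T)) *\<^sub>v y = X *\<^sub>v (S ^\<^sub>m i *\<^sub>v (X\<^sup>T *\<^sub>v y))"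
  proof -
      show ?thesis
      unfolding assoc_mult_mat_vec[OF X mult_carrier_mat[OF P XT] y] assoc_mult_mat_vec[OF P XT y] ..
  qed
  also have "(1 / real n) \<cdot>\<^sub>v \<dots> = X *\<^sub>v (S ^\<^sub>m i *\<^sub>v sigma_hat X y)"
  proof -
    have v: "X\<^sup>T *\<^sub>v y \<in> carrier_vec p" by (rule mult_mat_vec_carrier[OF XT y])
    show ?thesis
      unfolding sigma_hat_def dims mult_mat_vec[OF P v] mult_mat_vec[OF X mult_mat_vec_carrier[OF P v]] ..
  qed
  finally show ?thesis .
qed

lemma sigma_hat_carrier: "sigma_hat X y \<in> carrier_vec p"
  unfolding sigma_hat_def using dims by (intro carrier_vecI) simp

lemma G_hat_carrier: "G_hat X y K \<in> carrier_mat p K"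
  unfolding G_hat_def krylov_mat_def using sigma_hat_carrier[of y] by (intro carrier_matI) simp_all

lemma col_G_hat:
  assumes "i < K"
  shows "col (G_hat X y K) i = S ^\<^sub>m i *\<^sub>v sigma_hat X y"
proof -
  have d: "dim_vec (sigma_hat X y) = p" using sigma_hat_carrier by (rule carrier_vecD)
  have "col (mat_of_cols p (map (\<lambda>i. S ^\<^sub>m i *\<^sub>v sigma_hat X y) [0..<K])) i
      = map (\<lambda>i. S ^\<^sub>m i *\<^sub>v sigma_hat X y) [0..<K] ! i"
    using assms mult_mat_vec_carrier[OF P sigma_hat_carrier] by (intro col_mat_of_cols) simp_all
  then show ?thesis using assms by (simp add: G_hat_def krylov_mat_def d)
qed

lemma krylov_design_carrier: "krylov_design X K y \<in> carrier_mat n K"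
  unfolding krylov_design_def by (rule mult_carrier_mat[OF X G_hat_carrier])

lemma col_krylov_design:
  assumes "i < K" "y \<in> carrier_vec n"
  shows "col (krylov_design X K y) i = krylov_map X i *\<^sub>v y"
  unfolding krylov_design_def krylov_map_mult_vec[OF assms(2)] col_mult2[OF X G_hat_carrier assms(1)]
  by (simp add: col_G_hat[OF assms(1)])

lemma krylov_design_index:
  assumes "i < K" "y \<in> carrier_vec n" "j < n"
  shows "krylov_design X K y $$ (j, i) = (\<Sum>l<n. krylov_map X i $$ (j, l) * y $ l)"
proof -
  have "krylov_design X K y $$ (j, i) = col (krylov_design X K y) i $ j"
    using carrier_matD[OF krylov_design_carrier[of K y]] assms by simp
  also have "\<dots> = (\<Sum>l<n. krylov_map X i $$ (j, l) * y $ l)"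
    using assms carrier_matD[OF krylov_map_carrier[of i]] by (simp add: col_krylov_design scalar_prod_def atLeast0LessThan)
  finally show ?thesis .
qed

text \<open>Each column is a fixed matrix applied to the response. With the signal and the noise as
  summands this gives the decomposition \<open>A + H\<close>.\<close>

lemma krylov_design_add:
  assumes "y \<in> carrier_vec n" "z \<in> carrier_vec n"
  shows "krylov_design X K (y + z) = krylov_design X K y + krylov_design X K z"
proof (rule eq_matI)
  note c = krylov_design_carrier[of K y] krylov_design_carrier[of K z] krylov_design_carrier[of K "y + z"]
  show "dim_row (krylov_design X K (y + z)) = dim_row (krylov_design X K y + krylov_design X K z)"
    "dim_col (krylov_design X K (y + z)) = dim_col (krylov_design X K y + krylov_design X K z)"
    using c by auto
  fix j i
  assume "j < dim_row (krylov_design X K y + krylov_design X K z)"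
    "i < dim_col (krylov_design X K y + krylov_design X K z)"
  then have "j < n" "i < K" using c by auto
  then show "krylov_design X K (y + z) $$ (j, i) = (krylov_design X K y + krylov_design X K z) $$ (j, i)"
    using c assms by (simp add: krylov_design_index sum.distrib distrib_left)
qed

text \<open>An odd index belongs to an even power, the square of a symmetric
  \<open>krylov_map\<close>. For an even index \<open>h + h\<close> the factor is
  \<open>Sigma_mat X ^\<^sub>m h * X\<^sup>T\<close> scaled by \<open>1 / sqrt n\<close>. The
  factorisation writes the quadratic form of the matrix as a sum of squared linear forms.\<close>

lemma krylov_map_factor:
  assumes n: "0 < n"
  obtains q F where "F \<in> carrier_mat q n" "F\<^sup>T * F = krylov_map X i"
proof -
  obtain h where h: "i = h + h \<or> i = h + h + 1"
  proof -
    have "i = i div 2 + i div 2 \<or> i = i div 2 + i div 2 + 1" by presburger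
    then show ?thesis using that by blast
  qed
  show ?thesis
    using h
  proof
    assume "i = h + h + 1"
    then have "(krylov_map X h)\<^sup>T * krylov_map X h = krylov_map X i"
      by (simp add: transpose_krylov_map krylov_map_mult)
    then show ?thesis by (rule that[OF krylov_map_carrier])
  next
    assume i: "i = h + h"
    define F where "F = (1 / sqrt (real n)) \<cdot>\<^sub>m (S ^\<^sub>m h * X\<^sup>T)"
    have c: "S ^\<^sub>m h * X\<^sup>T \<in> carrier_mat p n" "X * S ^\<^sub>m h \<in> carrier_mat n p" "X\<^sup>T \<in> carrier_mat p n"
      by (intro XT mult_carrier_mat[OF X P] mult_carrier_mat[OF P XT])+
    have F: "F \<in> carrier_mat p n" unfolding F_def using c(1) by simp
    have FT: "F\<^sup>T = (1 / sqrt (real n)) \<cdot>\<^sub>m (X * S ^\<^sub>m h)"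
      unfolding F_def transpose_smult_mat transpose_mult[OF P c(3)] transpose_pow_mat[OF S] by simp
    have "F\<^sup>T * F = (1 / sqrt (real n)) \<cdot>\<^sub>m ((X * S ^\<^sub>m h) * F)"
      unfolding FT by (rule mult_smult_assoc_mat[OF c(2) F])
    also have "(X * S ^\<^sub>m h) * F = (1 / sqrt (real n)) \<cdot>\<^sub>m ((X * S ^\<^sub>m h) * (S ^\<^sub>m h * X\<^sup>T))"
      unfolding F_def by (rule mult_smult_distrib[OF c(2,1)])
    finally have "F\<^sup>T * F = (1 / sqrt (real n)) \<cdot>\<^sub>m ((1 / sqrt (real n)) \<cdot>\<^sub>m ((X * S ^\<^sub>m h) * (S ^\<^sub>m h * X\<^sup>T)))" .
    also have "\<dots> = (1 / real n) \<cdot>\<^sub>m ((X * S ^\<^sub>m h) * (S ^\<^sub>m h * X\<^sup>T))"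
      using n by (intro eq_matI) auto
    also have "(X * S ^\<^sub>m h) * (S ^\<^sub>m h * X\<^sup>T) = X * (S ^\<^sub>m h * (S ^\<^sub>m h * X\<^sup>T))"
      by (rule assoc_mult_mat[OF X P c(1)])
    also have "S ^\<^sub>m h * (S ^\<^sub>m h * X\<^sup>T) = S ^\<^sub>m i * X\<^sup>T"
      unfolding i pow_mat_add[OF S(1)] by (rule assoc_mult_mat[OF P P c(3), symmetric])
    finally have "F\<^sup>T * F = krylov_map X i" by (simp add: krylov_map_def dims)
    then show ?thesis using that[of F p] F by simp
  qed
qed

lemma sigma_vec_eq_sigma_hat:
  assumes "\<beta> \<in> carrier_vec p"
  shows "sigma_vec X \<beta> = sigma_hat X (X *\<^sub>v \<beta>)"
  by (simp add: sigma_vec_def sigma_hat_def Sigma_mat_mult_vec[OF X assms] dims)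

lemma G_mat_eq_G_hat:
  assumes "\<beta> \<in> carrier_vec p"
  shows "G_mat X \<beta> K = G_hat X (X *\<^sub>v \<beta>) K"
  by (simp add: G_mat_def G_hat_def sigma_vec_eq_sigma_hat[OF assms])

end

section \<open>The population quantities\<close>

lemma mat_mult_unit_vec:
  fixes A :: "real Matrix.mat"
  assumes "A \<in> carrier_mat n k" "i < k"
  shows "A *\<^sub>v unit_vec k i = col A i"
  using assms by (intro eq_vecI) auto

lemma eigenvector_pow_mat:
  fixes A :: "real Matrix.mat"
  assumes A: "A \<in> carrier_mat k k" and v: "v \<in> carrier_vec k" and eq: "A *\<^sub>v v = l \<cdot>\<^sub>v v"
  shows "A ^\<^sub>m j *\<^sub>v v = l ^ j \<cdot>\<^sub>v v"
proof (induction j)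
  case 0
  then show ?case using A v by simp
next
  case (Suc j)
  have P: "A ^\<^sub>m j \<in> carrier_mat k k" using A by (rule pow_carrier_mat)
  have "A ^\<^sub>m Suc j *\<^sub>v v = A ^\<^sub>m j *\<^sub>v (A *\<^sub>v v)"
    using assoc_mult_mat_vec[OF P A v] by simp
  also have "\<dots> = l \<cdot>\<^sub>v (A ^\<^sub>m j *\<^sub>v v)" unfolding eq by (rule mult_mat_vec[OF P v])
  also have "\<dots> = l ^ Suc j \<cdot>\<^sub>v v" unfolding Suc by (simp add: smult_smult_assoc)
  finally show ?case .
qed

text \<open>The upper bound sums the moment inequality over unit vectors. The lower bound inserts a
  top eigenvector into the Frobenius bound for \<open>A ^\<^sub>m j\<close>, whose squared Frobenius
  norm is the trace of the power \<open>2 * j\<close>.\<close>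

lemma psd_trace_bounds:
  assumes A: "psd k A" and k: "0 < k"
  shows "0 \<le> max_eigenvalue A"
    and "0 \<le> mat_trace (A ^\<^sub>m j)"
    and "mat_trace (A ^\<^sub>m Suc j) \<le> max_eigenvalue A * mat_trace (A ^\<^sub>m j)"
    and "max_eigenvalue A ^ (2 * j) \<le> mat_trace (A ^\<^sub>m (2 * j))"
proof -
  let ?\<rho> = "max_eigenvalue A"
  have A': "A \<in> carrier_mat k k" "A\<^sup>T = A" and pos: "\<And>v. v \<in> carrier_vec k \<Longrightarrow> 0 \<le> v \<bullet> (A *\<^sub>v v)"
    using A by (auto simp: psd_def)
  have P: "A ^\<^sub>m i \<in> carrier_mat k k" for i using A'(1) by (rule pow_carrier_mat)
  obtain u where u: "u \<in> carrier_vec k" "u \<noteq> 0\<^sub>v k" "A *\<^sub>v u = ?\<rho> \<cdot>\<^sub>v u"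
    using max_eigenvalue_in_spectrum_and_ge_Rayleigh(1)[OF A' k] A'
    by (auto simp: spectrum_def eigenvalue_def eigenvector_def)
  have uu: "0 < u \<bullet> u"
    using scalar_prod_self_ge_0[of u] scalar_prod_self_eq_0[OF u(1)] u(2) by fastforce
  have "0 \<le> ?\<rho> * (u \<bullet> u)" using pos[OF u(1)] u by simp
  then show \<rho>: "0 \<le> ?\<rho>" using uu by (simp add: zero_le_mult_iff)
  note mom = psd_moment_bounds[OF A \<rho> _ max_eigenvalue_in_spectrum_and_ge_Rayleigh(2)[OF A' k]]
  show "0 \<le> mat_trace (A ^\<^sub>m j)"
    unfolding mat_trace_unit_vec[OF P] by (intro sum_nonneg mom(1)) simp
  show "mat_trace (A ^\<^sub>m Suc j) \<le> ?\<rho> * mat_trace (A ^\<^sub>m j)"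
    unfolding mat_trace_unit_vec[OF P] sum_distrib_left by (intro sum_mono mom(2)) simp
  have "(?\<rho> ^ j)\<^sup>2 * (u \<bullet> u) = (A ^\<^sub>m j *\<^sub>v u) \<bullet> (A ^\<^sub>m j *\<^sub>v u)"
    using u(1) by (simp add: eigenvector_pow_mat[OF A'(1) u(1,3)] power2_eq_square)
  also have "\<dots> \<le> mat_trace ((A ^\<^sub>m j)\<^sup>T * A ^\<^sub>m j) * (u \<bullet> u)"
    by (rule mult_mat_vec_sq_le_trace[OF P u(1)])
  also have "(A ^\<^sub>m j)\<^sup>T * A ^\<^sub>m j = A ^\<^sub>m (2 * j)"
    unfolding transpose_pow_mat[OF A'] mult_2 pow_mat_add[OF A'(1)] ..
  finally show "?\<rho> ^ (2 * j) \<le> mat_trace (A ^\<^sub>m (2 * j))"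
    using uu by (simp add: power_even_eq)
qed

context
  fixes X :: "real Matrix.mat" and n p K :: nat and \<beta> :: "real Matrix.vec"
  assumes X: "X \<in> carrier_mat n p" and n: "0 < n" and K: "0 < K" and \<beta>: "\<beta> \<in> carrier_vec p"
begin

private abbreviation (input) "\<Sigma> \<equiv> Sigma_mat X"
private abbreviation (input) "\<sigma> \<equiv> sigma_vec X \<beta>"
private abbreviation (input) "G \<equiv> G_mat X \<beta> K"
private abbreviation (input) "\<Theta> \<equiv> Theta_mat X \<beta> K"
private abbreviation (input) "A \<equiv> krylov_design X K (X *\<^sub>v \<beta>)"
private abbreviation (input) "D i \<equiv> D_mat X \<beta> K $$ (i, i)"

private lemma m: "X *\<^sub>v \<beta> \<in> carrier_vec n"
  by (rule mult_mat_vec_carrier[OF X \<beta>])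

private lemma \<Sigma>: "\<Sigma> \<in> carrier_mat p p" "\<Sigma>\<^sup>T = \<Sigma>"
  by (rule Sigma_mat_carrier[OF X], rule transpose_Sigma_mat[OF X])

private lemma \<sigma>: "\<sigma> \<in> carrier_vec p"
  unfolding sigma_vec_eq_sigma_hat[OF X \<beta>] by (rule sigma_hat_carrier[OF X])

private lemma G: "G \<in> carrier_mat p K" "G\<^sup>T \<in> carrier_mat K p"
  unfolding G_mat_eq_G_hat[OF X \<beta>] using G_hat_carrier[OF X] by auto

private lemma A: "A \<in> carrier_mat n K" "A\<^sup>T \<in> carrier_mat K n"
  using krylov_design_carrier[OF X] by auto

private lemma A_mult_vec: "v \<in> carrier_vec K \<Longrightarrow> A *\<^sub>v v = X *\<^sub>v (G *\<^sub>v v)"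
  unfolding krylov_design_def G_mat_eq_G_hat[OF X \<beta>, symmetric]
  by (rule assoc_mult_mat_vec[OF X G(1)])

lemma Theta_mat_carrier: "\<Theta> \<in> carrier_mat K K"
  unfolding Theta_mat_def by (rule mult_carrier_mat[OF mult_carrier_mat[OF G(2) \<Sigma>(1)] G(1)])

lemma Theta_mat_mult_vec: "v \<in> carrier_vec K \<Longrightarrow> \<Theta> *\<^sub>v v = G\<^sup>T *\<^sub>v (\<Sigma> *\<^sub>v (G *\<^sub>v v))"
  unfolding Theta_mat_def
  by (simp only: assoc_mult_mat_vec[OF mult_carrier_mat[OF G(2) \<Sigma>(1)] G(1)]
      assoc_mult_mat_vec[OF G(2) \<Sigma>(1) mult_mat_vec_carrier[OF G(1)]])

lemma transpose_Theta_mat: "\<Theta>\<^sup>T = \<Theta>"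
proof -
  have "\<Theta>\<^sup>T = G\<^sup>T * (G\<^sup>T * \<Sigma>)\<^sup>T"
    unfolding Theta_mat_def by (rule transpose_mult[OF mult_carrier_mat[OF G(2) \<Sigma>(1)] G(1)])
  also have "(G\<^sup>T * \<Sigma>)\<^sup>T = \<Sigma> * G" unfolding transpose_mult[OF G(2) \<Sigma>(1)] \<Sigma>(2) by simp
  also have "G\<^sup>T * (\<Sigma> * G) = \<Theta>"
    unfolding Theta_mat_def by (rule assoc_mult_mat[OF G(2) \<Sigma>(1) G(1), symmetric])
  finally show ?thesis .
qed

lemma Theta_mat_form:
  assumes "v \<in> carrier_vec K" "w \<in> carrier_vec K"
  shows "v \<bullet> (\<Theta> *\<^sub>v w) = ((A *\<^sub>v v) \<bullet> (A *\<^sub>v w)) / n"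
proof -
  have c: "G *\<^sub>v v \<in> carrier_vec p" "G *\<^sub>v w \<in> carrier_vec p"
    using mult_mat_vec_carrier[OF G(1)] assms by auto
  have "v \<bullet> (\<Theta> *\<^sub>v w) = (G *\<^sub>v v) \<bullet> (\<Sigma> *\<^sub>v (G *\<^sub>v w))"
    unfolding Theta_mat_mult_vec[OF assms(2)]
    by (rule scalar_prod_transpose_mult_vec[OF G(1) assms(1) mult_mat_vec_carrier[OF \<Sigma>(1) c(2)]])
  also have "\<dots> = ((A *\<^sub>v v) \<bullet> (A *\<^sub>v w)) / n"
    unfolding A_mult_vec[OF assms(1)] A_mult_vec[OF assms(2)] by (rule scalar_prod_Sigma_mat[OF X c])
  finally show ?thesis .
qed

lemma psd_Theta_mat: "psd K \<Theta>"
  unfolding psd_def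
  using Theta_mat_carrier transpose_Theta_mat scalar_prod_self_ge_0 by (simp add: Theta_mat_form)

lemma D_mat_index: "i < K \<Longrightarrow> D i = \<Theta> $$ (i, i)"
  by (simp add: D_mat_def mat_diag_def)

lemma Theta_mat_index:
  assumes "i < K" "j < K"
  shows "\<Theta> $$ (i, j) = unit_vec K i \<bullet> (\<Theta> *\<^sub>v unit_vec K j)"
  using Theta_mat_carrier assms by simp

lemma D_mat_eq_col_norm:
  assumes "i < K"
  shows "D i = (col A i \<bullet> col A i) / n"
  unfolding D_mat_index[OF assms] Theta_mat_index[OF assms assms]
  using Theta_mat_form[of "unit_vec K i" "unit_vec K i"] mat_mult_unit_vec[OF A(1) assms] by simp

text \<open>Connects the diagonal with hypothesis (ii): indices start at 0 here and at 1 there, so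
  \<open>2 * i + 1\<close> is the exponent \<open>2 * i - 1\<close> of the hypothesis taken at
  \<open>Suc i\<close>.\<close>

lemma D_mat_eq_moment:
  assumes "i < K"
  shows "D i = \<sigma> \<bullet> (\<Sigma> ^\<^sub>m (2 * i + 1) *\<^sub>v \<sigma>)"
proof -
  have P: "\<Sigma> ^\<^sub>m i *\<^sub>v \<sigma> \<in> carrier_vec p"
    by (rule mult_mat_vec_carrier[OF pow_carrier_mat[OF \<Sigma>(1)] \<sigma>])
  have "col A i = X *\<^sub>v (\<Sigma> ^\<^sub>m i *\<^sub>v \<sigma>)"
    unfolding col_krylov_design[OF X assms m] krylov_map_mult_vec[OF X m] sigma_vec_eq_sigma_hat[OF X \<beta>] ..
  then have "D i = (\<Sigma> ^\<^sub>m i *\<^sub>v \<sigma>) \<bullet> (\<Sigma> *\<^sub>v (\<Sigma> ^\<^sub>m i *\<^sub>v \<sigma>))"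
    unfolding D_mat_eq_col_norm[OF assms] using scalar_prod_Sigma_mat[OF X P P] by simp
  also have "\<Sigma> *\<^sub>v (\<Sigma> ^\<^sub>m i *\<^sub>v \<sigma>) = \<Sigma> ^\<^sub>m (1 + i) *\<^sub>v \<sigma>"
    unfolding pow_mat_add[OF \<Sigma>(1)] using \<Sigma>(1)
      assoc_mult_mat_vec[OF \<Sigma>(1) pow_carrier_mat[OF \<Sigma>(1)] \<sigma>] by simp
  also have "(\<Sigma> ^\<^sub>m i *\<^sub>v \<sigma>) \<bullet> (\<Sigma> ^\<^sub>m (1 + i) *\<^sub>v \<sigma>) = \<sigma> \<bullet> (\<Sigma> ^\<^sub>m (i + (1 + i)) *\<^sub>v \<sigma>)"
    by (rule scalar_prod_pow_mat[OF \<Sigma> \<sigma> \<sigma>])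
  also have "i + (1 + i) = 2 * i + 1" by simp
  finally show ?thesis .
qed

text \<open>The equation for \<open>\<Lambda>\<close> says that \<open>A *\<^sub>v \<Lambda>\<close>
  is the orthogonal projection of \<open>X *\<^sub>v \<beta>\<close> onto the range of
  \<open>A\<close>; Pythagoras then compares it with every other point of that range.\<close>

lemma INF_column_span_ge:
  assumes L: "\<Lambda> \<in> carrier_vec K" and eq: "\<Theta> *\<^sub>v \<Lambda> = G\<^sup>T *\<^sub>v \<sigma>"
  shows "(X *\<^sub>v \<beta> - A *\<^sub>v \<Lambda>) \<bullet> (X *\<^sub>v \<beta> - A *\<^sub>v \<Lambda>)
    \<le> (INF v \<in> column_span G. (enorm (X *\<^sub>v (\<beta> - v)))\<^sup>2)"
proof (rule cINF_greatest)
  interpret vec_space "TYPE(real)" p .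
  have span: "column_span G = {v \<in> carrier_vec p. \<exists>u\<in>carrier_vec K. G *\<^sub>v u = v}"
    using col_space_eq[OF G(1)] G(1) by auto
  show "column_span G \<noteq> {}" using L mult_mat_vec_carrier[OF G(1) L] unfolding span by blast
  fix v assume "v \<in> column_span G"
  then obtain u where u: "u \<in> carrier_vec K" "v = G *\<^sub>v u" unfolding span by auto
  define g where "g = X *\<^sub>v \<beta> - A *\<^sub>v \<Lambda>"
  define h where "h = A *\<^sub>v (\<Lambda> - u)"
  have w: "\<Lambda> - u \<in> carrier_vec K" using L u by simp
  have c: "A *\<^sub>v \<Lambda> \<in> carrier_vec n" "A *\<^sub>v u \<in> carrier_vec n" "g \<in> carrier_vec n" "h \<in> carrier_vec n"
    unfolding g_def h_def using mult_mat_vec_carrier[OF A(1)] L u w m by auto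
  have Gw: "G *\<^sub>v (\<Lambda> - u) \<in> carrier_vec p" by (rule mult_mat_vec_carrier[OF G(1) w])
  have "h \<bullet> (X *\<^sub>v \<beta>) = n * ((G *\<^sub>v (\<Lambda> - u)) \<bullet> (\<Sigma> *\<^sub>v \<beta>))"
    unfolding h_def A_mult_vec[OF w] scalar_prod_Sigma_mat[OF X Gw \<beta>] using n by simp
  also have "(G *\<^sub>v (\<Lambda> - u)) \<bullet> (\<Sigma> *\<^sub>v \<beta>) = (\<Lambda> - u) \<bullet> (G\<^sup>T *\<^sub>v \<sigma>)"
    using scalar_prod_transpose_mult_vec[OF G(1) w \<sigma>] by (simp add: sigma_vec_def)
  also have "\<dots> = (\<Lambda> - u) \<bullet> (\<Theta> *\<^sub>v \<Lambda>)" by (simp add: eq)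
  also have "n * \<dots> = h \<bullet> (A *\<^sub>v \<Lambda>)" unfolding Theta_mat_form[OF w L] h_def using n by simp
  finally have "h \<bullet> (X *\<^sub>v \<beta>) = h \<bullet> (A *\<^sub>v \<Lambda>)" .
  then have hg: "h \<bullet> g = 0" unfolding g_def using c m by (simp add: scalar_prod_minus_distrib[of _ n])
  then have gh: "g \<bullet> h = 0" using comm_scalar_prod[OF c(3,4)] by simp
  have "h = A *\<^sub>v \<Lambda> - A *\<^sub>v u" unfolding h_def by (rule mult_minus_distrib_mat_vec[OF A(1) L u(1)])
  then have "X *\<^sub>v \<beta> - A *\<^sub>v u = g + h" unfolding g_def using c m by (auto simp: vec_eq_iff)
  moreover have "X *\<^sub>v (\<beta> - v) = X *\<^sub>v \<beta> - A *\<^sub>v u"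
    unfolding u(2) A_mult_vec[OF u(1)]
    by (rule mult_minus_distrib_mat_vec[OF X \<beta> mult_mat_vec_carrier[OF G(1) u(1)]])
  ultimately have "(enorm (X *\<^sub>v (\<beta> - v)))\<^sup>2 = (g + h) \<bullet> (g + h)" by (simp add: enorm_sq)
  also have "\<dots> = g \<bullet> g + h \<bullet> h"
    using c hg gh by (simp add: add_scalar_prod_distrib[of _ n] scalar_prod_add_distrib[of _ n])
  finally show "(X *\<^sub>v \<beta> - A *\<^sub>v \<Lambda>) \<bullet> (X *\<^sub>v \<beta> - A *\<^sub>v \<Lambda>) \<le> (enorm (X *\<^sub>v (\<beta> - v)))\<^sup>2"
    using scalar_prod_self_ge_0[of h] by (simp add: g_def)
qed

context
  assumes D: "\<forall>i<K. 0 < D i"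
begin

lemma R_mat_symmetric: "R_mat X \<beta> K \<in> carrier_mat K K" "(R_mat X \<beta> K)\<^sup>T = R_mat X \<beta> K"
proof -
  let ?E = "D_inv_sqrt X \<beta> K"
  have E: "?E \<in> carrier_mat K K" "?E\<^sup>T = ?E"
    by (auto simp: D_inv_sqrt_def mat_diag_def intro!: eq_matI)
  note c = mult_carrier_mat[OF E(1) Theta_mat_carrier]
  show "R_mat X \<beta> K \<in> carrier_mat K K"
    unfolding R_mat_def by (rule mult_carrier_mat[OF c E(1)])
  have "(R_mat X \<beta> K)\<^sup>T = ?E * (?E * \<Theta>)\<^sup>T"
    unfolding R_mat_def transpose_mult[OF c E(1)] E(2) ..
  also have "(?E * \<Theta>)\<^sup>T = \<Theta> * ?E"
    unfolding transpose_mult[OF E(1) Theta_mat_carrier] E(2) transpose_Theta_mat ..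
  also have "?E * (\<Theta> * ?E) = R_mat X \<beta> K"
    unfolding R_mat_def by (rule assoc_mult_mat[OF E(1) Theta_mat_carrier E(1), symmetric])
  finally show "(R_mat X \<beta> K)\<^sup>T = R_mat X \<beta> K" .
qed

text \<open>Rayleigh bound for \<open>R\<close> at the vector
  \<open>D\<^sup>1\<^sup>/\<^sup>2 u\<close>, where the form of \<open>R\<close> becomes the form of
  \<open>\<Theta>\<close> at \<open>u\<close>.\<close>

lemma min_eigenvalue_R_mat_le:
  assumes u: "u \<in> carrier_vec K"
  shows "n * min_eigenvalue (R_mat X \<beta> K) * (\<Sum>i<K. D i * (u $ i)\<^sup>2) \<le> (A *\<^sub>v u) \<bullet> (A *\<^sub>v u)"
proof -
  let ?E = "D_inv_sqrt X \<beta> K"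
  define v where "v = Matrix.vec K (\<lambda>i. sqrt (D i) * u $ i)"
  have v: "v \<in> carrier_vec K" by (simp add: v_def)
  have E: "?E \<in> carrier_mat K K" "?E\<^sup>T = ?E"
    by (auto simp: D_inv_sqrt_def mat_diag_def intro!: eq_matI)
  have Ev: "?E *\<^sub>v v = u"
  proof (rule eq_vecI)
    fix i assume "i < dim_vec u"
    then have i: "i < K" using u by simp
    then have "sqrt (D i) \<noteq> 0" using D by auto
    then show "(?E *\<^sub>v v) $ i = u $ i"
      using i unfolding D_inv_sqrt_def mat_diag_mult_vec_index[OF i v] by (simp add: v_def)
  qed (use u E(1) in auto)
  have "R_mat X \<beta> K *\<^sub>v v = ?E *\<^sub>v (\<Theta> *\<^sub>v u)"
    unfolding R_mat_def assoc_mult_mat_vec[OF mult_carrier_mat[OF E(1) Theta_mat_carrier] E(1) v] Ev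
    by (rule assoc_mult_mat_vec[OF E(1) Theta_mat_carrier u])
  then have "v \<bullet> (R_mat X \<beta> K *\<^sub>v v) = u \<bullet> (\<Theta> *\<^sub>v u)"
    using symmetric_mat_scalar_prod[OF E v mult_mat_vec_carrier[OF Theta_mat_carrier u]] Ev by simp
  then have "min_eigenvalue (R_mat X \<beta> K) * (v \<bullet> v) \<le> (A *\<^sub>v u) \<bullet> (A *\<^sub>v u) / n"
    using min_eigenvalue_le_Rayleigh[OF R_mat_symmetric K v] Theta_mat_form[OF u u] by simp
  moreover have "v \<bullet> v = (\<Sum>i<K. D i * (u $ i)\<^sup>2)"
  proof -
    have "v \<bullet> v = (\<Sum>i<K. (sqrt (D i) * u $ i)\<^sup>2)"
      using v by (simp add: scalar_prod_def atLeast0LessThan power2_eq_square v_def)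
    also have "\<dots> = (\<Sum>i<K. D i * (u $ i)\<^sup>2)"
      by (intro sum.cong refl) (use D in \<open>auto simp: power_mult_distrib less_imp_le\<close>)
    finally show ?thesis .
  qed
  ultimately show ?thesis using n by (simp add: field_simps)
qed

text \<open>\<open>min_eigenvalue_R_mat_le\<close> makes \<open>\<Theta>\<close> positive definite,
  so the \<open>the\<close> in \<open>Lambda_vec\<close> is applied to a genuine inverse.\<close>

lemma Lambda_vec_solves:
  assumes r: "0 < min_eigenvalue (R_mat X \<beta> K)"
  shows "Lambda_vec X \<beta> K \<in> carrier_vec K" "\<Theta> *\<^sub>v Lambda_vec X \<beta> K = G\<^sup>T *\<^sub>v \<sigma>"
proof -
  have "0 < v \<bullet> (\<Theta> *\<^sub>v v)" if v: "v \<in> carrier_vec K" "v \<noteq> 0\<^sub>v K" for v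
  proof -
    obtain i where i: "i < K" "v $ i \<noteq> 0" using v by (auto simp: vec_eq_iff)
    have "0 < (\<Sum>i<K. D i * (v $ i)\<^sup>2)"
      by (rule sum_pos2[of _ i]) (use i D in \<open>auto intro!: mult_nonneg_nonneg intro: less_imp_le\<close>)
    then have "0 < n * min_eigenvalue (R_mat X \<beta> K) * (\<Sum>i<K. D i * (v $ i)\<^sup>2)" using r n by simp
    also note min_eigenvalue_R_mat_le[OF v(1)]
    finally show ?thesis using n by (simp add: Theta_mat_form[OF v(1) v(1)])
  qed
  then obtain B where B: "mat_inverse \<Theta> = Some B" "B \<in> carrier_mat K K" "\<Theta> * B = 1\<^sub>m K"
    using posdef_mat_inverse[OF Theta_mat_carrier] by metis
  have c: "G\<^sup>T *\<^sub>v \<sigma> \<in> carrier_vec K" by (rule mult_mat_vec_carrier[OF G(2) \<sigma>])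
  have L: "Lambda_vec X \<beta> K = B *\<^sub>v (G\<^sup>T *\<^sub>v \<sigma>)" by (simp add: Lambda_vec_def B(1))
  show "Lambda_vec X \<beta> K \<in> carrier_vec K" unfolding L by (rule mult_mat_vec_carrier[OF B(2) c])
  show "\<Theta> *\<^sub>v Lambda_vec X \<beta> K = G\<^sup>T *\<^sub>v \<sigma>"
    unfolding L assoc_mult_mat_vec[OF Theta_mat_carrier B(2) c, symmetric] B(3) using c by simp
qed

text \<open>The first normal equation reads \<open>\<sigma> \<bullet> \<sigma> = unit_vec K 0
  \<bullet> (\<Theta> *\<^sub>v \<Lambda>)\<close>. Cauchy-Schwarz in the form of
  \<open>\<Theta>\<close> bounds the square of the right-hand side by \<open>D 0\<close> times the
  form at \<open>\<Lambda>\<close>, and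
  \<open>D 0 \<le> \<rho> (\<sigma> \<bullet> \<sigma>)\<close> turns this into a lower bound on the
  weighted norm of \<open>\<Lambda>\<close>. The last part iterates the moment bound.\<close>

lemma D_mat_0_le:
  assumes p: "0 < p" and L: "\<Lambda> \<in> carrier_vec K" and eq: "\<Theta> *\<^sub>v \<Lambda> = G\<^sup>T *\<^sub>v \<sigma>"
  shows "0 < max_eigenvalue \<Sigma>"
    and "D 0 \<le> (max_eigenvalue \<Sigma>)\<^sup>2 * (K * (\<Sum>i<K. D i * (\<Lambda> $ i)\<^sup>2))"
    and "i < K \<Longrightarrow> D i \<le> max_eigenvalue \<Sigma> ^ (2 * i) * D 0"
proof -
  let ?\<rho> = "max_eigenvalue \<Sigma>"
  define Q where "Q = (\<Sum>i<K. D i * (\<Lambda> $ i)\<^sup>2)"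
  have \<rho>0: "0 \<le> ?\<rho>" by (rule psd_trace_bounds(1)[OF psd_Sigma_mat[OF X] p])
  note mom = psd_moment_bounds[OF psd_Sigma_mat[OF X] \<rho>0 \<sigma>
      max_eigenvalue_in_spectrum_and_ge_Rayleigh(2)[OF \<Sigma> p]]
  have S0: "\<sigma> \<bullet> (\<Sigma> ^\<^sub>m 0 *\<^sub>v \<sigma>) = \<sigma> \<bullet> \<sigma>" using \<Sigma>(1) \<sigma> by simp
  have D0: "0 < D 0" using D K by simp
  have le0: "D 0 \<le> ?\<rho> * (\<sigma> \<bullet> \<sigma>)"
    using mom(2)[of 0] S0 D_mat_eq_moment[OF K] by simp
  then show \<rho>: "0 < ?\<rho>" using D0 \<rho>0 by (cases "?\<rho> = 0") auto
  have "unit_vec K 0 \<bullet> (G\<^sup>T *\<^sub>v \<sigma>) = (G *\<^sub>v unit_vec K 0) \<bullet> \<sigma>"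
    by (rule scalar_prod_transpose_mult_vec[OF G(1) unit_vec_carrier \<sigma>])
  also have "G *\<^sub>v unit_vec K 0 = \<sigma>"
    unfolding mat_mult_unit_vec[OF G(1) K] unfolding G_mat_eq_G_hat[OF X \<beta>] col_G_hat[OF X K]
      sigma_vec_eq_sigma_hat[OF X \<beta>] using \<Sigma>(1) sigma_hat_carrier[OF X] by simp
  finally have "(\<sigma> \<bullet> \<sigma>)\<^sup>2 = (unit_vec K 0 \<bullet> (\<Theta> *\<^sub>v \<Lambda>))\<^sup>2" by (simp add: eq)
  also have "\<dots> \<le> (unit_vec K 0 \<bullet> (\<Theta> *\<^sub>v unit_vec K 0)) * (\<Lambda> \<bullet> (\<Theta> *\<^sub>v \<Lambda>))"
    by (rule psd_Cauchy_Schwarz[OF psd_Theta_mat unit_vec_carrier L])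
  also have "unit_vec K 0 \<bullet> (\<Theta> *\<^sub>v unit_vec K 0) = D 0"
    by (simp only: Theta_mat_index[OF K K] D_mat_index[OF K])
  also have "\<Lambda> \<bullet> (\<Theta> *\<^sub>v \<Lambda>) \<le> K * Q"
  proof -
    \<comment> \<open>Columns of \<open>A\<close> divided by \<open>sqrt (D i)\<close> have squared
      length \<open>n\<close>, so the weighted Frobenius norm is \<open>n * K\<close>; the factor
      \<open>K\<close> is the trace of \<open>R\<close>.\<close>
    have "(A *\<^sub>v \<Lambda>) \<bullet> (A *\<^sub>v \<Lambda>) \<le> (\<Sum>j<n. \<Sum>i<K. (A $$ (j, i))\<^sup>2 / D i) * Q"
      unfolding Q_def using D by (intro mult_mat_vec_sq_le_weighted[OF A(1) L]) auto
    also have "(\<Sum>j<n. \<Sum>i<K. (A $$ (j, i))\<^sup>2 / D i) = (\<Sum>i<K. (\<Sum>j<n. (A $$ (j, i))\<^sup>2) / D i)"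
      by (subst sum.swap) (simp add: sum_divide_distrib)
    also have "\<dots> = (\<Sum>i<K. real n)"
    proof (intro sum.cong refl)
      fix i assume "i \<in> {..<K}"
      then have i: "i < K" by simp
      have "(\<Sum>j<n. (A $$ (j, i))\<^sup>2) = col A i \<bullet> col A i"
        using A(1) i by (simp add: scalar_prod_def atLeast0LessThan power2_eq_square)
      also have "\<dots> = n * D i" unfolding D_mat_eq_col_norm[OF i] using n by simp
      finally show "(\<Sum>j<n. (A $$ (j, i))\<^sup>2) / D i = real n" using D i by auto
    qed
    finally show ?thesis unfolding Theta_mat_form[OF L L] using n by (simp add: field_simps)
  qed
  finally have "(\<sigma> \<bullet> \<sigma>)\<^sup>2 \<le> D 0 * (K * Q)" using D0 by simp
  then have "?\<rho>\<^sup>2 * (\<sigma> \<bullet> \<sigma>)\<^sup>2 \<le> ?\<rho>\<^sup>2 * (D 0 * (K * Q))" by (intro mult_left_mono) auto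
  moreover have "(D 0)\<^sup>2 \<le> (?\<rho> * (\<sigma> \<bullet> \<sigma>))\<^sup>2" using le0 D0 by (intro power_mono) auto
  ultimately have "D 0 * D 0 \<le> D 0 * (?\<rho>\<^sup>2 * (K * Q))"
    by (simp add: power2_eq_square mult_ac)
  then show "D 0 \<le> ?\<rho>\<^sup>2 * (K * (\<Sum>i<K. D i * (\<Lambda> $ i)\<^sup>2))" using D0 by (simp add: Q_def)
  have mono: "\<sigma> \<bullet> (\<Sigma> ^\<^sub>m (i + 1) *\<^sub>v \<sigma>) \<le> ?\<rho> ^ i * (\<sigma> \<bullet> (\<Sigma> ^\<^sub>m 1 *\<^sub>v \<sigma>))" for i
  proof (induction i)
    case (Suc i)
    have "\<sigma> \<bullet> (\<Sigma> ^\<^sub>m (Suc i + 1) *\<^sub>v \<sigma>) \<le> ?\<rho> * (\<sigma> \<bullet> (\<Sigma> ^\<^sub>m (i + 1) *\<^sub>v \<sigma>))"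
      using mom(2)[of "i + 1"] by simp
    also have "\<dots> \<le> ?\<rho> * (?\<rho> ^ i * (\<sigma> \<bullet> (\<Sigma> ^\<^sub>m 1 *\<^sub>v \<sigma>)))"
      using Suc \<rho>0 by (rule mult_left_mono)
    finally show ?case by simp
  qed simp
  assume i: "i < K"
  show "D i \<le> ?\<rho> ^ (2 * i) * D 0"
    using mono[of "2 * i"] unfolding D_mat_eq_moment[OF i] D_mat_eq_moment[OF K] by simp
qed

end

end

section \<open>Fitted values\<close>

text \<open>First variation: moving the coefficients by a multiple \<open>s\<close> of
  \<open>w\<close> cannot decrease the criterion, so the linear coefficient in \<open>s\<close>
  vanishes. Only the fitted value is described, as the minimiser itself may be ambiguous.\<close>

lemma is_pls_normal_equations:
  assumes X: "X \<in> carrier_mat n p" and Y: "Y \<in> carrier_vec n" and pls: "is_pls X K Y b"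
  obtains u where "u \<in> carrier_vec K" "X *\<^sub>v b = krylov_design X K Y *\<^sub>v u"
    "(krylov_design X K Y)\<^sup>T *\<^sub>v (Y - krylov_design X K Y *\<^sub>v u) = 0\<^sub>v K"
proof -
  interpret vec_space "TYPE(real)" p .
  let ?G = "G_hat X Y K"
  let ?C = "krylov_design X K Y"
  note G = G_hat_carrier[OF X, of Y K]
  note C = krylov_design_carrier[OF X, of K Y]
  have CT: "?C\<^sup>T \<in> carrier_mat K n" using C by simp
  have span: "column_span ?G = {v \<in> carrier_vec p. \<exists>u\<in>carrier_vec K. ?G *\<^sub>v u = v}"
    using col_space_eq[OF G] G by auto
  have Cu: "?C *\<^sub>v u = X *\<^sub>v (?G *\<^sub>v u)" if "u \<in> carrier_vec K" for u
    unfolding krylov_design_def by (rule assoc_mult_mat_vec[OF X G that])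
  from pls obtain u where u: "u \<in> carrier_vec K" "b = ?G *\<^sub>v u"
    unfolding is_pls_def is_arg_min_def span by auto
  define g where "g = Y - ?C *\<^sub>v u"
  have g: "g \<in> carrier_vec n"
    unfolding g_def using Y mult_mat_vec_carrier[OF C u(1)] by simp
  have orth: "g \<bullet> (?C *\<^sub>v w) = 0" if w: "w \<in> carrier_vec K" for w
  proof -
    have Cw: "?C *\<^sub>v w \<in> carrier_vec n" by (rule mult_mat_vec_carrier[OF C w])
    \<comment> \<open>The constant term of the quadratic in \<open>s\<close> is 0, so the
      discriminant bound leaves 0 on the right.\<close>
    have "(- (g \<bullet> (?C *\<^sub>v w)))\<^sup>2 \<le> 0 * ((?C *\<^sub>v w) \<bullet> (?C *\<^sub>v w))"
    proof (rule quadratic_nonneg_discriminant)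
      fix s :: real
      have us: "u + s \<cdot>\<^sub>v w \<in> carrier_vec K" using u w by simp
      have "?G *\<^sub>v (u + s \<cdot>\<^sub>v w) \<in> column_span ?G"
        unfolding span using us mult_mat_vec_carrier[OF G us] by blast
      with pls have "(enorm (Y - X *\<^sub>v b))\<^sup>2 \<le> (enorm (Y - X *\<^sub>v (?G *\<^sub>v (u + s \<cdot>\<^sub>v w))))\<^sup>2"
        unfolding is_pls_def is_arg_min_def by (meson not_less)
      then have "g \<bullet> g \<le> (Y - ?C *\<^sub>v (u + s \<cdot>\<^sub>v w)) \<bullet> (Y - ?C *\<^sub>v (u + s \<cdot>\<^sub>v w))"
        unfolding enorm_sq g_def Cu[OF us] Cu[OF u(1)] u(2) .
      also have "?C *\<^sub>v (u + s \<cdot>\<^sub>v w) = ?C *\<^sub>v u + s \<cdot>\<^sub>v (?C *\<^sub>v w)"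
        using u w by (simp add: mult_add_distrib_mat_vec[OF C] mult_mat_vec[OF C])
      also have "Y - (?C *\<^sub>v u + s \<cdot>\<^sub>v (?C *\<^sub>v w)) = g - s \<cdot>\<^sub>v (?C *\<^sub>v w)"
        unfolding g_def using Y Cw mult_mat_vec_carrier[OF C u(1)] by (auto simp: vec_eq_iff)
      also have "(g - s \<cdot>\<^sub>v (?C *\<^sub>v w)) \<bullet> (g - s \<cdot>\<^sub>v (?C *\<^sub>v w))
          = g \<bullet> g + 2 * s * - (g \<bullet> (?C *\<^sub>v w)) + s\<^sup>2 * ((?C *\<^sub>v w) \<bullet> (?C *\<^sub>v w))"
        using g Cw comm_scalar_prod[OF Cw g]
        by (simp add: minus_scalar_prod_distrib[of _ n] scalar_prod_minus_distrib[of _ n]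
            power2_eq_square algebra_simps)
      finally show "0 \<le> 0 + 2 * s * - (g \<bullet> (?C *\<^sub>v w)) + s\<^sup>2 * ((?C *\<^sub>v w) \<bullet> (?C *\<^sub>v w))" by simp
    qed
    then show ?thesis by simp
  qed
  have w: "?C\<^sup>T *\<^sub>v g \<in> carrier_vec K" by (rule mult_mat_vec_carrier[OF CT g])
  have "(?C\<^sup>T *\<^sub>v g) \<bullet> (?C\<^sup>T *\<^sub>v g) = 0"
    using transpose_vec_mult_scalar[OF C w g] orth[OF w] by simp
  then have "?C\<^sup>T *\<^sub>v g = 0\<^sub>v K" by (rule scalar_prod_self_eq_0[OF w])
  then show ?thesis using that[OF u(1)] u Cu[OF u(1)] by (simp add: g_def)
qed

text \<open>Supplies a countable family of coefficient vectors whose images are dense in the range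
  of \<open>C\<close>, with an index set that is the same for every sample.\<close>

lemma dense_rational_image:
  fixes C :: "real Matrix.mat"
  assumes C: "C \<in> carrier_mat n K" and u: "u \<in> carrier_vec K" and \<eta>: "0 < \<eta>"
  obtains l :: "rat list" where
    "\<And>j. j < n \<Longrightarrow> \<bar>(C *\<^sub>v Matrix.vec K (\<lambda>i. real_of_rat (l ! i))) $ j - (C *\<^sub>v u) $ j\<bar> < \<eta>"
proof -
  \<comment> \<open>Strictly larger than every absolute row sum of \<open>C\<close>, so coefficient
    errors below \<open>\<eta> / M\<close> produce entry errors below \<open>\<eta>\<close>.\<close>
  define M where "M = 1 + (\<Sum>j<n. \<Sum>i<K. \<bar>C $$ (j, i)\<bar>)"
  have M: "0 < M" unfolding M_def by (intro add_pos_nonneg sum_nonneg) auto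
  have "\<exists>q. \<bar>real_of_rat q - u $ i\<bar> < \<eta> / M" for i
  proof -
    obtain q where "u $ i < real_of_rat q" "real_of_rat q < u $ i + \<eta> / M"
      using of_rat_dense[of "u $ i" "u $ i + \<eta> / M"] \<eta> M by auto
    then show ?thesis by (intro exI[of _ q]) auto
  qed
  then obtain q where q: "\<And>i. \<bar>real_of_rat (q i) - u $ i\<bar> < \<eta> / M" by metis
  define l where "l = map q [0..<K]"
  show thesis
  proof (rule that[of l])
    fix j assume j: "j < n"
    have "\<bar>(C *\<^sub>v Matrix.vec K (\<lambda>i. real_of_rat (l ! i))) $ j - (C *\<^sub>v u) $ j\<bar>
        = \<bar>\<Sum>i<K. C $$ (j, i) * (real_of_rat (q i) - u $ i)\<bar>"
      using C u j by (simp add: l_def scalar_prod_def atLeast0LessThan sum_subtractf[symmetric] right_diff_distrib)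
    also have "\<dots> \<le> (\<Sum>i<K. \<bar>C $$ (j, i)\<bar> * (\<eta> / M))"
    proof (rule order_trans[OF sum_abs], rule sum_mono)
      fix i
      show "\<bar>C $$ (j, i) * (real_of_rat (q i) - u $ i)\<bar> \<le> \<bar>C $$ (j, i)\<bar> * (\<eta> / M)"
        unfolding abs_mult by (intro mult_left_mono less_imp_le[OF q]) simp
    qed
    also have "\<dots> = (\<Sum>i<K. \<bar>C $$ (j, i)\<bar>) * (\<eta> / M)" by (rule sum_distrib_right[symmetric])
    also have "(\<Sum>i<K. \<bar>C $$ (j, i)\<bar>) \<le> (\<Sum>j<n. \<Sum>i<K. \<bar>C $$ (j, i)\<bar>)"
      by (rule member_le_sum) (use j in \<open>auto intro: sum_nonneg\<close>)
    then have "(\<Sum>i<K. \<bar>C $$ (j, i)\<bar>) * (\<eta> / M) < M * (\<eta> / M)"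
      using \<eta> M by (intro mult_strict_right_mono) (auto simp: M_def)
    also have "M * (\<eta> / M) = \<eta>" using M by simp
    finally show "\<bar>(C *\<^sub>v Matrix.vec K (\<lambda>i. real_of_rat (l ! i))) $ j - (C *\<^sub>v u) $ j\<bar> < \<eta>" .
  qed
qed

text \<open>Membership of the projection \<open>z\<close> in a ball, in terms of countably many competitors \<open>y l\<close>
  only. This makes the loss measurable although the estimator is an arbitrary selection.\<close>

lemma projection_loss_le_iff:
  fixes z Y m :: "real Matrix.vec" and y :: "'l \<Rightarrow> real Matrix.vec"
  assumes c: "z \<in> carrier_vec n" "m \<in> carrier_vec n" "\<And>l. y l \<in> carrier_vec n"
    and pyth: "\<And>l. (Y - y l) \<bullet> (Y - y l) = (Y - z) \<bullet> (Y - z) + (z - y l) \<bullet> (z - y l)"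
    and dense: "\<And>\<eta>. 0 < \<eta> \<Longrightarrow> \<exists>l. \<forall>j<n. \<bar>y l $ j - z $ j\<bar> < \<eta>"
  shows "(z - m) \<bullet> (z - m) \<le> r \<longleftrightarrow> (\<forall>k::nat. \<exists>l.
    (\<forall>l'. (Y - y l) \<bullet> (Y - y l) \<le> (Y - y l') \<bullet> (Y - y l') + 1 / real (Suc k)) \<and>
    (y l - m) \<bullet> (y l - m) \<le> r + 1 / real (Suc k))" (is "?L \<longleftrightarrow> ?R")
proof -
  have sp: "(v - w) \<bullet> (v - w) = (\<Sum>j<n. (v $ j - w $ j)\<^sup>2)"
    if "v \<in> carrier_vec n" "w \<in> carrier_vec n" for v w :: "real Matrix.vec"
    using that by (simp add: scalar_prod_def atLeast0LessThan power2_eq_square)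
  note sp' = sp[OF c(1) c(3)] sp[OF c(3) c(2)] sp[OF c(1,2)]
  have "\<exists>s. \<forall>k. \<forall>j<n. \<bar>y (s k) $ j - z $ j\<bar> < 1 / real (Suc k)"
    by (intro choice allI dense) simp
  then obtain s where s: "\<And>k j. j < n \<Longrightarrow> \<bar>y (s k) $ j - z $ j\<bar> < 1 / real (Suc k)" by blast
  have lim: "(\<lambda>k. y (s k) $ j) \<longlonglongrightarrow> z $ j" if "j < n" for j
  proof (rule LIM_zero_cancel, rule Lim_null_comparison)
    show "\<forall>\<^sub>F k in sequentially. norm (y (s k) $ j - z $ j) \<le> 1 / real (Suc k)"
      using s[OF that] by (intro always_eventually allI) (simp add: less_imp_le)
    show "(\<lambda>k. 1 / real (Suc k)) \<longlonglongrightarrow> 0"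
      using LIMSEQ_inverse_real_of_nat by (simp add: inverse_eq_divide)
  qed
  have lim0: "(\<lambda>k. (z - y (s k)) \<bullet> (z - y (s k))) \<longlonglongrightarrow> 0"
  proof -
    have "(\<lambda>k. \<Sum>j<n. (z $ j - y (s k) $ j)\<^sup>2) \<longlonglongrightarrow> (\<Sum>j<n. (z $ j - z $ j)\<^sup>2)"
      by (intro tendsto_sum tendsto_power tendsto_diff tendsto_const lim) simp
    then show ?thesis by (simp add: sp')
  qed
  have lim_m: "(\<lambda>k. (y (f k) - m) \<bullet> (y (f k) - m)) \<longlonglongrightarrow> (z - m) \<bullet> (z - m)"
    if "\<And>j. j < n \<Longrightarrow> (\<lambda>k. y (f k) $ j) \<longlonglongrightarrow> z $ j" for f :: "nat \<Rightarrow> 'l"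
    unfolding sp' by (intro tendsto_sum tendsto_power tendsto_diff tendsto_const that) simp
  show ?thesis
  proof
    assume L: ?L
    show ?R
    proof
      fix k :: nat
      have "\<forall>\<^sub>F i in sequentially. (z - y (s i)) \<bullet> (z - y (s i)) < 1 / real (Suc k)"
        using lim0 by (rule order_tendstoD) simp
      moreover have "\<forall>\<^sub>F i in sequentially. (y (s i) - m) \<bullet> (y (s i) - m) < r + 1 / real (Suc k)"
      proof (rule order_tendstoD(2)[OF lim_m[of s, OF lim]])
        have "0 < 1 / real (Suc k)" by simp
        then show "(z - m) \<bullet> (z - m) < r + 1 / real (Suc k)" using L by linarith
      qed
      ultimately have "\<forall>\<^sub>F i in sequentially. (z - y (s i)) \<bullet> (z - y (s i)) < 1 / real (Suc k) \<and>
          (y (s i) - m) \<bullet> (y (s i) - m) < r + 1 / real (Suc k)" by (rule eventually_conj)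
      then obtain i where i: "(z - y (s i)) \<bullet> (z - y (s i)) < 1 / real (Suc k)"
        "(y (s i) - m) \<bullet> (y (s i) - m) < r + 1 / real (Suc k)"
        using eventually_happens'[OF sequentially_bot] by blast
      show "\<exists>l. (\<forall>l'. (Y - y l) \<bullet> (Y - y l) \<le> (Y - y l') \<bullet> (Y - y l') + 1 / real (Suc k)) \<and>
          (y l - m) \<bullet> (y l - m) \<le> r + 1 / real (Suc k)"
      proof (intro exI conjI allI)
        fix l'
        show "(Y - y (s i)) \<bullet> (Y - y (s i)) \<le> (Y - y l') \<bullet> (Y - y l') + 1 / real (Suc k)"
          using i(1) pyth[of "s i"] pyth[of l'] scalar_prod_self_ge_0[of "z - y l'"] by linarith
        show "(y (s i) - m) \<bullet> (y (s i) - m) \<le> r + 1 / real (Suc k)" using i(2) by simp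
      qed
    qed
  next
    assume R: ?R
    from choice[OF R] obtain f where
      f: "\<And>k l'. (Y - y (f k)) \<bullet> (Y - y (f k)) \<le> (Y - y l') \<bullet> (Y - y l') + 1 / real (Suc k)"
        "\<And>k. (y (f k) - m) \<bullet> (y (f k) - m) \<le> r + 1 / real (Suc k)" by blast
    have inv: "(\<lambda>k. 1 / real (Suc k)) \<longlonglongrightarrow> 0"
      using LIMSEQ_inverse_real_of_nat by (simp add: inverse_eq_divide)
    \<comment> \<open>By \<open>pyth\<close>, being within \<open>1 / real (Suc k)\<close> of all
      competitors in the criterion means squared distance at most that much from \<open>z\<close>,
      because the competitors approach \<open>z\<close> arbitrarily closely.\<close>
    have near: "(z - y (f k)) \<bullet> (z - y (f k)) \<le> 1 / real (Suc k)" for k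
    proof -
      have "(\<lambda>i. (z - y (s i)) \<bullet> (z - y (s i)) + 1 / real (Suc k)) \<longlonglongrightarrow> 0 + 1 / real (Suc k)"
        by (intro tendsto_add lim0 tendsto_const)
      moreover have "(z - y (f k)) \<bullet> (z - y (f k)) \<le> (z - y (s i)) \<bullet> (z - y (s i)) + 1 / real (Suc k)" for i
        using f(1)[of k "s i"] pyth[of "f k"] pyth[of "s i"] by linarith
      ultimately have "(z - y (f k)) \<bullet> (z - y (f k)) \<le> 0 + 1 / real (Suc k)"
        by (intro LIMSEQ_le_const) auto
      then show ?thesis by simp
    qed
    have "(\<lambda>k. y (f k) $ j) \<longlonglongrightarrow> z $ j" if j: "j < n" for j
    proof -
      have "(\<lambda>k. (y (f k) $ j - z $ j)\<^sup>2) \<longlonglongrightarrow> 0"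
      proof (rule Lim_null_comparison[OF _ inv])
        have "(y (f k) $ j - z $ j)\<^sup>2 \<le> 1 / real (Suc k)" for k
        proof -
          have "(z $ j - y (f k) $ j)\<^sup>2 \<le> (\<Sum>j<n. (z $ j - y (f k) $ j)\<^sup>2)"
            by (rule member_le_sum[of j]) (use j in auto)
          also have "\<dots> \<le> 1 / real (Suc k)" using near[of k] by (simp add: sp')
          finally show ?thesis by (simp add: power2_commute)
        qed
        then show "\<forall>\<^sub>F k in sequentially. norm ((y (f k) $ j - z $ j)\<^sup>2) \<le> 1 / real (Suc k)"
          by (intro always_eventually allI) simp
      qed
      then have "(\<lambda>k. y (f k) $ j - z $ j) \<longlonglongrightarrow> 0"
        by (simp add: power_tendsto_0_iff)
      then show ?thesis by (rule LIM_zero_cancel)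
    qed
    then have "(\<lambda>k. (y (f k) - m) \<bullet> (y (f k) - m)) \<longlonglongrightarrow> (z - m) \<bullet> (z - m)" by (rule lim_m)
    moreover have "(\<lambda>k. r + 1 / real (Suc k)) \<longlonglongrightarrow> r + 0" by (intro tendsto_add tendsto_const inv)
    ultimately have "(z - m) \<bullet> (z - m) \<le> r + 0"
      by (rule LIMSEQ_le) (use f(2) in auto)
    then show ?L by simp
  qed
qed

text \<open>A set outside the sigma-algebra has \<open>measure\<close> 0, so the final probability
  bound depends on this. The loss involves the selection \<open>b\<close> only through the fitted
  value, which is a projection, and \<open>projection_loss_le_iff\<close> expresses it by countably
  many measurable functions.\<close>

lemma pls_loss_measurable:
  assumes X: "X \<in> carrier_mat n p" and m: "m \<in> carrier_vec n"
    and pls: "\<forall>Y\<in>carrier_vec n. is_pls X K Y (b Y)"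
  shows "{\<omega> \<in> space (gaussian_noise n \<tau>).
    (enorm (X *\<^sub>v b (m + Matrix.vec n \<omega>) - m))\<^sup>2 \<le> r} \<in> sets (gaussian_noise n \<tau>)"
proof -
  let ?M = "gaussian_noise n \<tau>"
  define Y where "Y = (\<lambda>\<omega>. m + Matrix.vec n \<omega> :: real Matrix.vec)"
  define C where "C = (\<lambda>\<omega>. krylov_design X K (Y \<omega>))"
  \<comment> \<open>For lists shorter than \<open>K\<close> the missing entries \<open>l ! i\<close>
    are fixed unspecified rationals, which does no harm: each \<open>q l\<close> is still a constant
    vector.\<close>
  define q where "q = (\<lambda>l :: rat list. Matrix.vec K (\<lambda>i. real_of_rat (l ! i)))"
  define y where "y = (\<lambda>l \<omega>. C \<omega> *\<^sub>v q l)"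
  define f where "f = (\<lambda>l \<omega>. (Y \<omega> - y l \<omega>) \<bullet> (Y \<omega> - y l \<omega>))"
  define g where "g = (\<lambda>l \<omega>. (y l \<omega> - m) \<bullet> (y l \<omega> - m))"
  have Y: "Y \<omega> \<in> carrier_vec n" for \<omega> using m by (simp add: Y_def)
  have C: "C \<omega> \<in> carrier_mat n K" for \<omega> unfolding C_def by (rule krylov_design_carrier[OF X])
  have q: "q l \<in> carrier_vec K" for l by (simp add: q_def)
  have y: "y l \<omega> \<in> carrier_vec n" for l \<omega> unfolding y_def by (rule mult_mat_vec_carrier[OF C q])
  have y_index: "y l \<omega> $ j = (\<Sum>i<K. (\<Sum>h<n. krylov_map X i $$ (j, h) * (m $ h + \<omega> h)) * real_of_rat (l ! i))"
    if "j < n" for l \<omega> j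
  proof -
    have "y l \<omega> $ j = (\<Sum>i<K. C \<omega> $$ (j, i) * real_of_rat (l ! i))"
      using that C[of \<omega>] by (simp add: y_def q_def scalar_prod_def atLeast0LessThan)
    also have "\<dots> = (\<Sum>i<K. (\<Sum>h<n. krylov_map X i $$ (j, h) * (m $ h + \<omega> h)) * real_of_rat (l ! i))"
    proof (intro sum.cong refl)
      fix i assume "i \<in> {..<K}"
      then have "C \<omega> $$ (j, i) = (\<Sum>h<n. krylov_map X i $$ (j, h) * Y \<omega> $ h)"
        unfolding C_def using krylov_design_index[OF X _ Y that] by simp
      also have "\<dots> = (\<Sum>h<n. krylov_map X i $$ (j, h) * (m $ h + \<omega> h))"
        using m by (intro sum.cong refl) (simp add: Y_def)
      finally show "C \<omega> $$ (j, i) * real_of_rat (l ! i)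
          = (\<Sum>h<n. krylov_map X i $$ (j, h) * (m $ h + \<omega> h)) * real_of_rat (l ! i)" by simp
    qed
    finally show ?thesis .
  qed
  have y_meas: "(\<lambda>\<omega>. y l \<omega> $ j) \<in> borel_measurable ?M" if "j < n" for l j
    unfolding y_index[OF that]
    by (intro borel_measurable_sum borel_measurable_times borel_measurable_add borel_measurable_const
        measurable_gaussian_noise_coord) auto
  have f_sum: "f l \<omega> = (\<Sum>j<n. (m $ j + \<omega> j - y l \<omega> $ j)\<^sup>2)" for l \<omega>
    using y[of l \<omega>] m by (simp add: f_def Y_def scalar_prod_def atLeast0LessThan power2_eq_square)
  have g_sum: "g l \<omega> = (\<Sum>j<n. (y l \<omega> $ j - m $ j)\<^sup>2)" for l \<omega>
    using y[of l \<omega>] m by (simp add: g_def scalar_prod_def atLeast0LessThan power2_eq_square)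
  have f_meas: "f l \<in> borel_measurable ?M" for l
    unfolding f_sum[abs_def]
    by (intro borel_measurable_sum borel_measurable_power borel_measurable_diff borel_measurable_add
        borel_measurable_const measurable_gaussian_noise_coord y_meas) auto
  have g_meas: "g l \<in> borel_measurable ?M" for l
    unfolding g_sum[abs_def]
    by (intro borel_measurable_sum borel_measurable_power borel_measurable_diff
        borel_measurable_const y_meas) auto
  have [measurable]: "Measurable.pred ?M (\<lambda>\<omega>. f l \<omega> \<le> f l' \<omega> + c)" for l l' c
    unfolding pred_def by (intro borel_measurable_le borel_measurable_add borel_measurable_const f_meas)
  have [measurable]: "Measurable.pred ?M (\<lambda>\<omega>. g l \<omega> \<le> c)" for l c
    unfolding pred_def by (intro borel_measurable_le borel_measurable_const g_meas)
  have iff: "(enorm (X *\<^sub>v b (Y \<omega>) - m))\<^sup>2 \<le> r \<longleftrightarrow> (\<forall>k::nat. \<exists>l.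
      (\<forall>l'. f l \<omega> \<le> f l' \<omega> + 1 / real (Suc k)) \<and> g l \<omega> \<le> r + 1 / real (Suc k))" for \<omega>
  proof -
    have "is_pls X K (Y \<omega>) (b (Y \<omega>))" using pls Y by blast
    then obtain u where u: "u \<in> carrier_vec K" "X *\<^sub>v b (Y \<omega>) = C \<omega> *\<^sub>v u"
      "(C \<omega>)\<^sup>T *\<^sub>v (Y \<omega> - C \<omega> *\<^sub>v u) = 0\<^sub>v K"
      unfolding C_def by (rule is_pls_normal_equations[OF X Y])
    have z: "C \<omega> *\<^sub>v u \<in> carrier_vec n" by (rule mult_mat_vec_carrier[OF C u(1)])
    show ?thesis
      unfolding enorm_sq u(2) f_def g_def
    proof (rule projection_loss_le_iff[OF z m y])
      fix l
      let ?a = "Y \<omega> - C \<omega> *\<^sub>v u" and ?d = "C \<omega> *\<^sub>v (u - q l)"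
      have uq: "u - q l \<in> carrier_vec K" using u(1) q by simp
      have a: "?a \<in> carrier_vec n" using Y z by simp
      have d: "?d \<in> carrier_vec n" by (rule mult_mat_vec_carrier[OF C uq])
      have "?d \<bullet> ?a = 0"
        using scalar_prod_transpose_mult_vec[OF C[of \<omega>] uq a] u(3) uq by simp
      moreover from this have "?a \<bullet> ?d = 0" using comm_scalar_prod[OF a d] by simp
      moreover have d_eq: "?d = C \<omega> *\<^sub>v u - y l \<omega>"
        unfolding y_def by (rule mult_minus_distrib_mat_vec[OF C u(1) q])
      moreover have "Y \<omega> - y l \<omega> = ?a + ?d"
      proof -
        have "v - v'' = (v - v') + (v' - v'')"
          if "v \<in> carrier_vec n" "v' \<in> carrier_vec n" "v'' \<in> carrier_vec n"
          for v v' v'' :: "real Matrix.vec"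
          using that by (auto simp: vec_eq_iff)
        from this[OF Y z y] show ?thesis unfolding d_eq .
      qed
      ultimately show "(Y \<omega> - y l \<omega>) \<bullet> (Y \<omega> - y l \<omega>)
          = ?a \<bullet> ?a + (C \<omega> *\<^sub>v u - y l \<omega>) \<bullet> (C \<omega> *\<^sub>v u - y l \<omega>)"
        using a d by (simp add: add_scalar_prod_distrib[of _ n] scalar_prod_add_distrib[of _ n])
    next
      fix \<eta> :: real assume "0 < \<eta>"
      then obtain l where "\<And>j. j < n \<Longrightarrow> \<bar>(C \<omega> *\<^sub>v q l) $ j - (C \<omega> *\<^sub>v u) $ j\<bar> < \<eta>"
        unfolding q_def using dense_rational_image[OF C u(1)] by metis
      then show "\<exists>l. \<forall>j<n. \<bar>y l \<omega> $ j - (C \<omega> *\<^sub>v u) $ j\<bar> < \<eta>" unfolding y_def by blast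
    qed
  qed
  have "{\<omega> \<in> space ?M. \<forall>k::nat. \<exists>l.
      (\<forall>l'. f l \<omega> \<le> f l' \<omega> + 1 / real (Suc k)) \<and> g l \<omega> \<le> r + 1 / real (Suc k)} \<in> sets ?M"
    by measurable
  then show ?thesis unfolding iff[symmetric] Y_def .
qed

section \<open>Control of the noise\<close>

text \<open>Hides the sum of squares behind a function \<open>Q\<close>, so that a statistic can be
  controlled in its matrix form outside an exceptional event.\<close>

lemma gaussian_quadratic_form_bad_set:
  fixes b :: "'j \<Rightarrow> nat \<Rightarrow> real"
  assumes \<tau>: "0 < \<tau>" and J: "finite J" and c: "\<And>j. j \<in> J \<Longrightarrow> 0 \<le> c j" and V: "0 < V"
    and le: "\<tau>\<^sup>2 * (\<Sum>j\<in>J. c j * (\<Sum>k<n. (b j k)\<^sup>2)) \<le> V"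
    and Q: "\<And>\<omega>. Q \<omega> = (\<Sum>j\<in>J. c j * (\<Sum>k<n. b j k * \<omega> k)\<^sup>2)"
  obtains B where "B \<in> sets (gaussian_noise n \<tau>)"
    "measure (gaussian_noise n \<tau>) B \<le> sqrt 2 * exp (- x / 4)"
    "\<And>\<omega>. \<omega> \<in> space (gaussian_noise n \<tau>) - B \<Longrightarrow> Q \<omega> \<le> x * V"
proof (rule that)
  let ?M = "gaussian_noise n \<tau>"
  let ?B = "{\<omega> \<in> space ?M. x * V < (\<Sum>j\<in>J. c j * (\<Sum>k<n. b j k * \<omega> k)\<^sup>2)}"
  show "?B \<in> sets ?M" by measurable
  show "measure ?M ?B \<le> sqrt 2 * exp (- x / 4)"
    by (rule gaussian_quadratic_form_tail[OF \<tau> J c V le])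
  show "Q \<omega> \<le> x * V" if "\<omega> \<in> space ?M - ?B" for \<omega> using that by (auto simp: Q)
qed

lemma linear_noise_bad_set:
  assumes \<tau>: "0 < \<tau>" and A: "A \<in> carrier_mat n K" and c: "\<And>i. i < K \<Longrightarrow> 0 \<le> c i" and V: "0 < V"
    and le: "\<tau>\<^sup>2 * (\<Sum>i<K. c i * (col A i \<bullet> col A i)) \<le> V"
  obtains B where "B \<in> sets (gaussian_noise n \<tau>)"
    "measure (gaussian_noise n \<tau>) B \<le> sqrt 2 * exp (- x / 4)"
    "\<And>\<omega>. \<omega> \<in> space (gaussian_noise n \<tau>) - B \<Longrightarrow>
      (\<Sum>i<K. c i * ((A\<^sup>T *\<^sub>v Matrix.vec n \<omega>) $ i)\<^sup>2) \<le> x * V"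
proof (rule gaussian_quadratic_form_bad_set[of \<tau> "{..<K}" c V "\<lambda>i l. A $$ (l, i)" n
      "\<lambda>\<omega>. \<Sum>i<K. c i * ((A\<^sup>T *\<^sub>v Matrix.vec n \<omega>) $ i)\<^sup>2" x])
  show "\<tau>\<^sup>2 * (\<Sum>i<K. c i * (\<Sum>l<n. (A $$ (l, i))\<^sup>2)) \<le> V"
    using le A by (simp add: scalar_prod_def atLeast0LessThan power2_eq_square)
  show "(\<Sum>i<K. c i * ((A\<^sup>T *\<^sub>v Matrix.vec n \<omega>) $ i)\<^sup>2) = (\<Sum>i<K. c i * (\<Sum>l<n. A $$ (l, i) * \<omega> l)\<^sup>2)" for \<omega>
    using A by (simp add: scalar_prod_def atLeast0LessThan)
qed (use \<tau> V c that in auto)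

context
  fixes X :: "real Matrix.mat" and n p K :: nat and \<tau> :: real
  assumes X: "X \<in> carrier_mat n p" and n: "0 < n" and \<tau>: "0 < \<tau>"
begin

text \<open>Each entry of the noise design is a linear form whose coefficients are a row of
  \<open>krylov_map X i\<close>. The squared Frobenius norm of this symmetric matrix is the trace of
  its square, that is, of the power \<open>2 * Suc i\<close> of \<open>Sigma_mat X\<close>.\<close>

lemma krylov_noise_frobenius_bad_set:
  assumes c: "\<And>i. i < K \<Longrightarrow> 0 \<le> c i" and V: "0 < V"
    and le: "\<tau>\<^sup>2 * (\<Sum>i<K. c i * mat_trace (Sigma_mat X ^\<^sub>m (2 * Suc i))) \<le> V"
  obtains B where "B \<in> sets (gaussian_noise n \<tau>)"
    "measure (gaussian_noise n \<tau>) B \<le> sqrt 2 * exp (- x / 4)"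
    "\<And>\<omega>. \<omega> \<in> space (gaussian_noise n \<tau>) - B \<Longrightarrow>
      (\<Sum>j<n. \<Sum>i<K. c i * (krylov_design X K (Matrix.vec n \<omega>) $$ (j, i))\<^sup>2) \<le> x * V"
proof (rule gaussian_quadratic_form_bad_set[of \<tau> "{..<n} \<times> {..<K}" "\<lambda>(j, i). c i" V
      "\<lambda>(j, i) l. krylov_map X i $$ (j, l)" n
      "\<lambda>\<omega>. \<Sum>j<n. \<Sum>i<K. c i * (krylov_design X K (Matrix.vec n \<omega>) $$ (j, i))\<^sup>2" x])
  have "(\<Sum>j<n. \<Sum>l<n. (krylov_map X i $$ (j, l))\<^sup>2) = mat_trace (Sigma_mat X ^\<^sub>m (2 * Suc i))" for i
  proof -
    have "(\<Sum>j<n. \<Sum>l<n. (krylov_map X i $$ (j, l))\<^sup>2) = mat_trace (krylov_map X (i + i + 1))"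
      using mat_trace_transpose_mult[OF krylov_map_carrier[OF X]]
      by (simp add: transpose_krylov_map[OF X] krylov_map_mult[OF X])
    also have "\<dots> = mat_trace (Sigma_mat X ^\<^sub>m Suc (i + i + 1))" by (rule trace_krylov_map[OF X])
    also have "Suc (i + i + 1) = 2 * Suc i" by simp
    finally show ?thesis .
  qed
  then have "(\<Sum>i<K. \<Sum>j<n. c i * (\<Sum>l<n. (krylov_map X i $$ (j, l))\<^sup>2))
      = (\<Sum>i<K. c i * mat_trace (Sigma_mat X ^\<^sub>m (2 * Suc i)))"
    by (simp only: sum_distrib_left[symmetric])
  then show "\<tau>\<^sup>2 * (\<Sum>z\<in>{..<n} \<times> {..<K}. (case z of (j, i) \<Rightarrow> c i) *
      (\<Sum>l<n. ((case z of (j, i) \<Rightarrow> \<lambda>l. krylov_map X i $$ (j, l)) l)\<^sup>2)) \<le> V"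
  proof -
    assume *: "(\<Sum>i<K. \<Sum>j<n. c i * (\<Sum>l<n. (krylov_map X i $$ (j, l))\<^sup>2))
      = (\<Sum>i<K. c i * mat_trace (Sigma_mat X ^\<^sub>m (2 * Suc i)))"
    have "(\<Sum>z\<in>{..<n} \<times> {..<K}. (case z of (j, i) \<Rightarrow> c i) *
        (\<Sum>l<n. ((case z of (j, i) \<Rightarrow> \<lambda>l. krylov_map X i $$ (j, l)) l)\<^sup>2))
        = (\<Sum>j<n. \<Sum>i<K. c i * (\<Sum>l<n. (krylov_map X i $$ (j, l))\<^sup>2))"
      by (simp add: sum.cartesian_product case_prod_unfold)
    also have "\<dots> = (\<Sum>i<K. \<Sum>j<n. c i * (\<Sum>l<n. (krylov_map X i $$ (j, l))\<^sup>2))"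
      by (rule sum.swap)
    finally show ?thesis using le * by simp
  qed
  show "(\<Sum>j<n. \<Sum>i<K. c i * (krylov_design X K (Matrix.vec n \<omega>) $$ (j, i))\<^sup>2)
      = (\<Sum>z\<in>{..<n} \<times> {..<K}. (case z of (j, i) \<Rightarrow> c i) *
        (\<Sum>l<n. (case z of (j, i) \<Rightarrow> \<lambda>l. krylov_map X i $$ (j, l)) l * \<omega> l)\<^sup>2)" for \<omega>
  proof -
    have "(\<Sum>j<n. \<Sum>i<K. c i * (krylov_design X K (Matrix.vec n \<omega>) $$ (j, i))\<^sup>2)
        = (\<Sum>j<n. \<Sum>i<K. c i * (\<Sum>l<n. krylov_map X i $$ (j, l) * \<omega> l)\<^sup>2)"
      by (intro sum.cong refl) (simp add: krylov_design_index[OF X])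
    then show ?thesis by (simp add: sum.cartesian_product case_prod_unfold)
  qed
qed (use \<tau> V c that in auto)

text \<open>The \<open>i\<close>-th coordinate is the quadratic form of
  \<open>krylov_map X i\<close> at the noise, hence a sum of squares by
  \<open>krylov_map_factor\<close>. Nonnegativity is recorded so that single coordinates can be read
  off from the weighted sum.\<close>

lemma krylov_noise_form_bad_set:
  assumes c: "\<And>i. i < K \<Longrightarrow> 0 \<le> c i" and V: "0 < V"
    and le: "\<tau>\<^sup>2 * (\<Sum>i<K. c i * mat_trace (Sigma_mat X ^\<^sub>m Suc i)) \<le> V"
  obtains B where "B \<in> sets (gaussian_noise n \<tau>)"
    "measure (gaussian_noise n \<tau>) B \<le> sqrt 2 * exp (- x / 4)"
    "\<And>\<omega>. \<omega> \<in> space (gaussian_noise n \<tau>) - B \<Longrightarrow>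
      (\<Sum>i<K. c i * (((krylov_design X K (Matrix.vec n \<omega>))\<^sup>T *\<^sub>v Matrix.vec n \<omega>) $ i)) \<le> x * V
      \<and> (\<forall>i<K. 0 \<le> ((krylov_design X K (Matrix.vec n \<omega>))\<^sup>T *\<^sub>v Matrix.vec n \<omega>) $ i)"
proof -
  have "\<forall>i. \<exists>F q. F \<in> carrier_mat q n \<and> F\<^sup>T * F = krylov_map X i"
    using krylov_map_factor[OF X n] by metis
  then obtain F q where F: "\<And>i. F i \<in> carrier_mat (q i) n" "\<And>i. (F i)\<^sup>T * F i = krylov_map X i"
    by metis
  have form: "((krylov_design X K (Matrix.vec n \<omega>))\<^sup>T *\<^sub>v Matrix.vec n \<omega>) $ i
      = (\<Sum>j<q i. (\<Sum>l<n. F i $$ (j, l) * \<omega> l)\<^sup>2)" if i: "i < K" for i \<omega>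
  proof -
    let ?e = "Matrix.vec n \<omega>"
    have e: "?e \<in> carrier_vec n" by simp
    have FT: "(F i)\<^sup>T \<in> carrier_mat n (q i)" using F(1) by simp
    have "((krylov_design X K ?e)\<^sup>T *\<^sub>v ?e) $ i = col (krylov_design X K ?e) i \<bullet> ?e"
      using krylov_design_carrier[OF X, of K ?e] i by simp
    also have "\<dots> = ((F i)\<^sup>T *\<^sub>v (F i *\<^sub>v ?e)) \<bullet> ?e"
      unfolding col_krylov_design[OF X i e] F(2)[symmetric] assoc_mult_mat_vec[OF FT F(1) e] ..
    also have "\<dots> = (F i *\<^sub>v ?e) \<bullet> (F i *\<^sub>v ?e)"
      by (rule transpose_vec_mult_scalar[OF F(1) e mult_mat_vec_carrier[OF F(1) e]])
    also have "\<dots> = (\<Sum>j<q i. (\<Sum>l<n. F i $$ (j, l) * \<omega> l)\<^sup>2)"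
      using F(1)[of i] by (simp add: scalar_prod_def atLeast0LessThan power2_eq_square)
    finally show ?thesis .
  qed
  obtain B where B: "B \<in> sets (gaussian_noise n \<tau>)"
    "measure (gaussian_noise n \<tau>) B \<le> sqrt 2 * exp (- x / 4)"
    "\<And>\<omega>. \<omega> \<in> space (gaussian_noise n \<tau>) - B \<Longrightarrow>
      (\<Sum>i<K. c i * (((krylov_design X K (Matrix.vec n \<omega>))\<^sup>T *\<^sub>v Matrix.vec n \<omega>) $ i)) \<le> x * V"
  proof (rule gaussian_quadratic_form_bad_set[of \<tau> "SIGMA i:{..<K}. {..<q i}" "\<lambda>(i, j). c i" V
        "\<lambda>(i, j) l. F i $$ (j, l)" n
        "\<lambda>\<omega>. \<Sum>i<K. c i * (((krylov_design X K (Matrix.vec n \<omega>))\<^sup>T *\<^sub>v Matrix.vec n \<omega>) $ i)" x])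
    have "(\<Sum>j<q i. \<Sum>l<n. (F i $$ (j, l))\<^sup>2) = mat_trace (Sigma_mat X ^\<^sub>m Suc i)" for i
      using mat_trace_transpose_mult[OF F(1)] by (simp only: F(2) trace_krylov_map[OF X])
    then have "(\<Sum>i<K. \<Sum>j<q i. c i * (\<Sum>l<n. (F i $$ (j, l))\<^sup>2))
        = (\<Sum>i<K. c i * mat_trace (Sigma_mat X ^\<^sub>m Suc i))"
      by (simp only: sum_distrib_left[symmetric])
    then show "\<tau>\<^sup>2 * (\<Sum>z\<in>(SIGMA i:{..<K}. {..<q i}). (case z of (i, j) \<Rightarrow> c i) *
        (\<Sum>l<n. ((case z of (i, j) \<Rightarrow> \<lambda>l. F i $$ (j, l)) l)\<^sup>2)) \<le> V"
      using le by (simp add: sum.Sigma case_prod_unfold)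
    show "(\<Sum>i<K. c i * (((krylov_design X K (Matrix.vec n \<omega>))\<^sup>T *\<^sub>v Matrix.vec n \<omega>) $ i))
        = (\<Sum>z\<in>(SIGMA i:{..<K}. {..<q i}). (case z of (i, j) \<Rightarrow> c i) *
          (\<Sum>l<n. (case z of (i, j) \<Rightarrow> \<lambda>l. F i $$ (j, l)) l * \<omega> l)\<^sup>2)" for \<omega>
    proof -
      have "(\<Sum>i<K. c i * (((krylov_design X K (Matrix.vec n \<omega>))\<^sup>T *\<^sub>v Matrix.vec n \<omega>) $ i))
          = (\<Sum>i<K. \<Sum>j<q i. c i * (\<Sum>l<n. F i $$ (j, l) * \<omega> l)\<^sup>2)"
        by (intro sum.cong refl) (simp only: form lessThan_iff sum_distrib_left)
      then show ?thesis by (simp add: sum.Sigma case_prod_unfold)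
    qed
  qed (use \<tau> V c in auto)
  show ?thesis
    using B by (intro that[of B]) (auto simp only: form intro!: sum_nonneg zero_le_power2)
qed

end

section \<open>The oracle inequality\<close>

theorem theorem3p1:
  shows "\<exists>C :: real \<Rightarrow> real Matrix.mat \<Rightarrow> real.
    \<forall>(\<delta> :: real) (n :: nat) (p :: nat) (K :: nat) (X :: real Matrix.mat) (\<beta> :: real Matrix.vec)
      (\<tau> :: real) (t :: real) (\<beta>_hat :: real Matrix.vec \<Rightarrow> real Matrix.vec).
      0 < \<delta> \<and> \<delta> < 1 \<and> 0 < n \<and> K \<in> {1..p} \<and> 0 < \<tau> \<and>
      X \<in> carrier_mat n p \<and> \<beta> \<in> carrier_vec p \<and>
      (\<forall>Y \<in> carrier_vec n. is_pls X K Y (\<beta>_hat Y)) \<and>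
      (\<forall>i<K. D_mat X \<beta> K $$ (i, i) > 0) \<and>
      min_eigenvalue (R_mat X \<beta> K) > 0 \<and>
      t \<ge> 128 * (ln (6 * real K / \<delta>) / min_eigenvalue (R_mat X \<beta> K)) \<and>
      (\<forall>i \<in> {1..K}.
         scalar_prod (sigma_vec X \<beta>) ((Sigma_mat X ^\<^sub>m (2 * i - 1)) *\<^sub>v sigma_vec X \<beta>)
           \<ge> t * (\<tau>\<^sup>2 / real n) * real K * max_eigenvalue (Sigma_mat X) ^ i
               * mat_trace (Sigma_mat X ^\<^sub>m i))
      \<longrightarrow>
      \<P>(\<omega> in gaussian_noise n \<tau>.
          (1 / real n) *
            (enorm (X *\<^sub>v \<beta>_hat (X *\<^sub>v \<beta> + Matrix.vec n \<omega>) - X *\<^sub>v \<beta>))\<^sup>2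
          \<le> (2 / real n) * (INF v \<in> column_span (G_mat X \<beta> K). (enorm (X *\<^sub>v (\<beta> - v)))\<^sup>2)
            + C \<delta> (R_mat X \<beta> K) * (\<tau>\<^sup>2 / real n) *
              max (cond_number (D_mat X \<beta> K) * (enorm (Lambda_vec X \<beta> K))\<^sup>2
                     * (\<Sum>i=1..K. mat_trace (Sigma_mat X ^\<^sub>m (2 * i))))
                  (sqrt (cond_number (D_mat X \<beta> K) * (enorm (Lambda_vec X \<beta> K))\<^sup>2
                     * (\<Sum>i=1..K. (mat_trace (Sigma_mat X ^\<^sub>m i))\<^sup>2)))) > 1 - \<delta>"
proof -
  \<comment> \<open>The number \<open>K\<close> is recovered as the dimension of \<open>R\<close>,
    so the constant depends on \<delta> and \<open>R\<close> alone.\<close>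
  define C where "C = (\<lambda>\<delta> R. let k = real (dim_row R); r = min_eigenvalue R; x = 32 * ln (6 * k / \<delta>)
    in 2 * x + 4 * x * k\<^sup>2 / r + 2 * x * k * sqrt (8 * k / r + 2 * k\<^sup>2))"
  show ?thesis
  proof (intro exI[of _ C] allI impI, elim conjE)
    fix \<delta> \<tau> t :: real and n p K :: nat and X :: "real Matrix.mat" and \<beta> :: "real Matrix.vec"
      and \<beta>_hat :: "real Matrix.vec \<Rightarrow> real Matrix.vec"
    assume \<delta>: "0 < \<delta>" "\<delta> < 1" and n: "0 < n" and Kp: "K \<in> {1..p}" and \<tau>: "0 < \<tau>"
      and X: "X \<in> carrier_mat n p" and \<beta>: "\<beta> \<in> carrier_vec p"
      and pls: "\<forall>Y\<in>carrier_vec n. is_pls X K Y (\<beta>_hat Y)"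
      and D: "\<forall>i<K. D_mat X \<beta> K $$ (i, i) > 0"
      and r0: "min_eigenvalue (R_mat X \<beta> K) > 0"
      and t0: "t \<ge> 128 * (ln (6 * real K / \<delta>) / min_eigenvalue (R_mat X \<beta> K))"
      and cond: "\<forall>i\<in>{1..K}.
         sigma_vec X \<beta> \<bullet> ((Sigma_mat X ^\<^sub>m (2 * i - 1)) *\<^sub>v sigma_vec X \<beta>)
           \<ge> t * (\<tau>\<^sup>2 / real n) * real K * max_eigenvalue (Sigma_mat X) ^ i
               * mat_trace (Sigma_mat X ^\<^sub>m i)"
    have K: "0 < K" and p: "0 < p" using Kp by auto
    define m where "m = X *\<^sub>v \<beta>"
    define A where "A = krylov_design X K m"
    define d where "d = (\<lambda>i. D_mat X \<beta> K $$ (i, i))"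
    define r where "r = min_eigenvalue (R_mat X \<beta> K)"
    define \<rho> where "\<rho> = max_eigenvalue (Sigma_mat X)"
    define T where "T = (\<lambda>i. mat_trace (Sigma_mat X ^\<^sub>m i))"
    define \<Lambda> where "\<Lambda> = Lambda_vec X \<beta> K"
    define a where "a = \<tau>\<^sup>2 / real n"
    define L where "L = ln (6 * real K / \<delta>)"
    \<comment> \<open>With 32 the requirement \<open>4 * x / r \<le> t\<close> is exactly the
      threshold 128 of the hypothesis, and \<open>exp (- x / 4)\<close> is the eighth power of
      \<open>\<delta> / (6 * K)\<close>.\<close>
    define x where "x = 32 * L"
    define dmin where "dmin = Min (spectrum (D_mat X \<beta> K))"
    define dmax where "dmax = Max (spectrum (D_mat X \<beta> K))"
    define P where "P = (\<Sum>i<K. T (2 * Suc i))"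
    define bound where "bound = (2 / real n) * (INF v \<in> column_span (G_mat X \<beta> K). (enorm (X *\<^sub>v (\<beta> - v)))\<^sup>2)
            + C \<delta> (R_mat X \<beta> K) * (\<tau>\<^sup>2 / real n) *
              max (cond_number (D_mat X \<beta> K) * (enorm (Lambda_vec X \<beta> K))\<^sup>2
                     * (\<Sum>i=1..K. mat_trace (Sigma_mat X ^\<^sub>m (2 * i))))
                  (sqrt (cond_number (D_mat X \<beta> K) * (enorm (Lambda_vec X \<beta> K))\<^sup>2
                     * (\<Sum>i=1..K. (mat_trace (Sigma_mat X ^\<^sub>m i))\<^sup>2)))"
    interpret prob_space "gaussian_noise n \<tau>" by (rule prob_space_gaussian_noise[OF \<tau>])
    have m: "m \<in> carrier_vec n" unfolding m_def by (rule mult_mat_vec_carrier[OF X \<beta>])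
    have A: "A \<in> carrier_mat n K" unfolding A_def by (rule krylov_design_carrier[OF X])
    have d: "0 < d i" if "i < K" for i using D that by (simp add: d_def)
    have r: "0 < r" using r0 by (simp add: r_def)
    have a: "0 < a" using \<tau> n by (simp add: a_def)
    have "1 < 6 * real K / \<delta>" using \<delta> K by (simp add: field_simps)
    then have L: "0 < L" by (simp add: L_def)
    then have x: "0 < x" by (simp add: x_def)
    have tx: "4 * x / r \<le> t" using t0 by (simp add: x_def L_def r_def)
    then have t: "0 < t" using x r by (smt (verit) divide_pos_pos)
    have dspec: "spectrum (D_mat X \<beta> K) = d ` {..<K}"
      unfolding D_mat_def spectrum_mat_diag d_def by (auto simp: mat_diag_def)
    have dne: "finite (d ` {..<K})" "d ` {..<K} \<noteq> {}" using K by auto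
    have dmin: "0 < dmin" unfolding dmin_def dspec using Min_in[OF dne] d by auto
    have dbounds: "dmin \<le> d i" "d i \<le> dmax" if "i < K" for i
      unfolding dmin_def dmax_def dspec using that dne by auto
    have \<Lambda>: "\<Lambda> \<in> carrier_vec K" "Theta_mat X \<beta> K *\<^sub>v \<Lambda> = (G_mat X \<beta> K)\<^sup>T *\<^sub>v sigma_vec X \<beta>"
      unfolding \<Lambda>_def by (rule Lambda_vec_solves[OF X n K \<beta> D r0])+

    \<comment> \<open>Eigenvalue and trace inequalities for powers of the covariance matrix\<close>
    note D0 = D_mat_0_le[OF X n K \<beta> D p \<Lambda>, folded \<rho>_def]
    note tr = psd_trace_bounds[OF psd_Sigma_mat[OF X] p, folded \<rho>_def T_def]
    have \<rho>: "0 < \<rho>" by (rule D0(1))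
    have T0: "0 \<le> T j" for j using tr(2)[of j] by (simp add: T_def)
    have TSuc: "T (Suc j) \<le> \<rho> * T j" for j using tr(3)[of j] by (simp add: T_def)
    have Teven: "\<rho> ^ (2 * j) \<le> T (2 * j)" for j using tr(4)[of j] by (simp add: T_def)
    have Tadd: "T (i + j) \<le> \<rho> ^ i * T j" for i j
    proof (induction i)
      case (Suc i)
      have "T (Suc i + j) \<le> \<rho> * T (i + j)" using TSuc[of "i + j"] by simp
      also have "\<dots> \<le> \<rho> * (\<rho> ^ i * T j)" using Suc \<rho> by simp
      finally show ?case by simp
    qed simp
    \<comment> \<open>The lower bound is available for even powers only; splitting off
      \<open>\<rho> ^ j\<close> carries positivity over to all exponents.\<close>
    have Tpos: "0 < T j" for j
    proof -
      have "0 < \<rho> ^ (2 * j)" using \<rho> by simp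
      also have "\<dots> \<le> T (j + j)" using Teven[of j] by (simp add: mult_2)
      also have "\<dots> \<le> \<rho> ^ j * T j" by (rule Tadd)
      finally show ?thesis using \<rho> by (simp add: zero_less_mult_iff)
    qed
    \<comment> \<open>The effective rank of the covariance matrix.\<close>
    define J where "J = T 1 / \<rho>"
    have J: "1 \<le> J"
    proof -
      have "\<rho> * \<rho> \<le> T 2" using Teven[of 1] by (simp add: power2_eq_square)
      also have "\<dots> \<le> \<rho> * T 1" using TSuc[of 1] by (simp add: numeral_2_eq_2)
      finally have "\<rho> \<le> T 1" using \<rho> by simp
      then show ?thesis using \<rho> by (simp add: J_def)
    qed

    \<comment> \<open>Consequences of the signal condition\<close>
    have dlow: "t * a * real K * (\<rho> ^ Suc i * T (Suc i)) \<le> d i" if i: "i < K" for i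
    proof -
      have "Suc i \<in> {1..K}" using i by simp
      from bspec[OF cond this] show ?thesis
        unfolding d_def D_mat_eq_moment[OF X n K \<beta> i] a_def \<rho>_def T_def by (simp add: mult_ac)
    qed
    have dcol: "d i = (col A i \<bullet> col A i) / n" if "i < K" for i
      unfolding d_def A_def m_def by (rule D_mat_eq_col_norm[OF X n K \<beta> that])
    have Tle: "T (Suc i) \<le> J * \<rho> ^ Suc i" for i
      using Tadd[of i 1] \<rho> by (simp add: J_def mult_ac)
    \<comment> \<open>One factor of the squared trace is bounded by
      \<open>J * \<rho> ^ Suc i\<close>, leaving the product that \<open>dlow\<close>
      controls.\<close>
    have TJ: "(T (Suc i))\<^sup>2 * (a * real K * t) \<le> J * d i" if i: "i < K" for i
    proof -
      have "T (Suc i) * T (Suc i) \<le> (J * \<rho> ^ Suc i) * T (Suc i)"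
        using Tle T0 by (rule mult_right_mono)
      then have "(T (Suc i))\<^sup>2 * (a * real K * t) \<le> (J * \<rho> ^ Suc i) * T (Suc i) * (a * real K * t)"
        unfolding power2_eq_square by (rule mult_right_mono) (use a t in auto)
      also have "\<dots> = J * (t * a * real K * (\<rho> ^ Suc i * T (Suc i)))" by (simp add: mult_ac)
      also have "\<dots> \<le> J * d i" using dlow[OF i] J by (intro mult_left_mono) auto
      finally show ?thesis .
    qed
    define Q where "Q = (\<Sum>i<K. d i * (\<Lambda> $ i)\<^sup>2)"
    have dQ: "d 0 \<le> \<rho>\<^sup>2 * (real K * Q)" using D0(2) by (simp add: Q_def d_def)
    \<comment> \<open>\<open>dlow\<close> at index 0 bounds \<open>d 0\<close> below by
      \<open>t * a * K * \<rho>\<^sup>2 * J\<close>, and \<open>dQ\<close> bounds it above by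
      \<open>\<rho>\<^sup>2 * K * Q\<close>.\<close>
    have signal: "t * a * J \<le> Q"
    proof -
      have "t * a * real K * (\<rho> * T 1) \<le> d 0" using dlow[OF K] by simp
      also note dQ
      finally have "(\<rho>\<^sup>2 * real K) * (t * a * J) \<le> (\<rho>\<^sup>2 * real K) * Q"
        using \<rho> by (simp add: J_def power2_eq_square mult_ac)
      then show ?thesis using \<rho> K by simp
    qed
    \<comment> \<open>Since \<open>d i \<le> \<rho> ^ (2 * i) * d 0\<close> and
      \<open>\<rho> ^ (2 * Suc i) \<le> P\<close>, the quantity \<open>\<rho>\<^sup>2 * Q\<close> is
      at most \<open>d 0 * P * (\<Lambda> \<bullet> \<Lambda>)\<close>; inserting this into
      \<open>dQ\<close> lets \<open>d 0\<close> cancel.\<close>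
    have PL: "1 \<le> real K * (\<Lambda> \<bullet> \<Lambda>) * P"
    proof -
      have TP: "T (2 * Suc i) \<le> P" if "i < K" for i
        unfolding P_def by (rule member_le_sum) (use that T0 in auto)
      have "\<rho>\<^sup>2 * Q \<le> (\<Sum>i<K. d 0 * (P * (\<Lambda> $ i)\<^sup>2))"
        unfolding Q_def sum_distrib_left
      proof (rule sum_mono)
        fix i assume "i \<in> {..<K}"
        then have i: "i < K" by simp
        have "\<rho>\<^sup>2 * (d i * (\<Lambda> $ i)\<^sup>2) \<le> \<rho>\<^sup>2 * ((\<rho> ^ (2 * i) * d 0) * (\<Lambda> $ i)\<^sup>2)"
          using D0(3)[OF i] by (intro mult_left_mono mult_right_mono) (auto simp: d_def)
        also have "\<dots> = d 0 * (\<rho> ^ (2 * Suc i) * (\<Lambda> $ i)\<^sup>2)"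
          by (simp add: power2_eq_square mult_ac)
        also have "\<dots> \<le> d 0 * (P * (\<Lambda> $ i)\<^sup>2)"
          using order_trans[OF Teven TP[OF i]] d[OF K] by (intro mult_left_mono mult_right_mono) auto
        finally show "\<rho>\<^sup>2 * (d i * (\<Lambda> $ i)\<^sup>2) \<le> d 0 * (P * (\<Lambda> $ i)\<^sup>2)" .
      qed
      also have "\<dots> = d 0 * (P * (\<Lambda> \<bullet> \<Lambda>))"
        using \<Lambda>(1) by (simp add: scalar_prod_def atLeast0LessThan power2_eq_square sum_distrib_left)
      finally have "real K * (\<rho>\<^sup>2 * Q) \<le> real K * (d 0 * (P * (\<Lambda> \<bullet> \<Lambda>)))" by (intro mult_left_mono) auto
      then have "d 0 * 1 \<le> d 0 * (real K * (\<Lambda> \<bullet> \<Lambda>) * P)" using dQ by (simp add: mult_ac)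
      then show ?thesis using d[OF K] by simp
    qed
    have P: "0 < P" unfolding P_def using K Tpos by (intro sum_pos) auto

    \<comment> \<open>Four exceptional events for the noise\<close>
    have V1: "\<tau>\<^sup>2 * (\<Sum>i<K. 1 / d i * mat_trace (Sigma_mat X ^\<^sub>m (2 * Suc i))) \<le> n / t"
    proof -
      have "\<tau>\<^sup>2 * (1 / d i * T (2 * Suc i)) \<le> n / (t * K)" if i: "i < K" for i
      proof -
        \<comment> \<open>The trace of the doubled power is dominated by the product of spectral
          radius and trace occurring in the signal condition.\<close>
        have "T (2 * Suc i) \<le> \<rho> ^ Suc i * T (Suc i)" using Tadd[of "Suc i" "Suc i"] by (simp add: mult_2)
        then have "t * a * real K * T (2 * Suc i) \<le> d i"
          using dlow[OF i] t a by (smt (verit) mult_left_mono mult_nonneg_nonneg of_nat_0_le_iff)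
        then show ?thesis using d[OF i] t K n by (simp add: a_def field_simps)
      qed
      then have "(\<Sum>i<K. \<tau>\<^sup>2 * (1 / d i * T (2 * Suc i))) \<le> (\<Sum>i<K. n / (t * K))" by (intro sum_mono) auto
      also have "\<dots> = n / t" using K by simp
      finally show ?thesis by (simp add: sum_distrib_left T_def)
    qed
    obtain B1 where B1: "B1 \<in> events" "prob B1 \<le> sqrt 2 * exp (- x / 4)"
      "\<And>\<omega>. \<omega> \<in> space (gaussian_noise n \<tau>) - B1 \<Longrightarrow>
        (\<Sum>j<n. \<Sum>i<K. 1 / d i * (krylov_design X K (Matrix.vec n \<omega>) $$ (j, i))\<^sup>2) \<le> x * (n / t)"
    proof (rule krylov_noise_frobenius_bad_set[OF X n \<tau> _ _ V1, of x])
      show "0 < n / t" using n t by simp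
    qed (use d in \<open>auto intro: less_imp_le\<close>)
    have V2: "\<tau>\<^sup>2 * (\<Sum>i<K. 1 * mat_trace (Sigma_mat X ^\<^sub>m (2 * Suc i))) \<le> \<tau>\<^sup>2 * P"
      by (simp add: P_def T_def)
    obtain B2 where B2: "B2 \<in> events" "prob B2 \<le> sqrt 2 * exp (- x / 4)"
      "\<And>\<omega>. \<omega> \<in> space (gaussian_noise n \<tau>) - B2 \<Longrightarrow>
        (\<Sum>j<n. \<Sum>i<K. 1 * (krylov_design X K (Matrix.vec n \<omega>) $$ (j, i))\<^sup>2) \<le> x * (\<tau>\<^sup>2 * P)"
    proof (rule krylov_noise_frobenius_bad_set[OF X n \<tau> _ _ V2, of x])
      show "0 < \<tau>\<^sup>2 * P" using \<tau> P by simp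
    qed auto
    have V3: "\<tau>\<^sup>2 * (\<Sum>i<K. 1 / d i * (col A i \<bullet> col A i)) \<le> \<tau>\<^sup>2 * (n * K)"
    proof -
      have "(\<Sum>i<K. 1 / d i * (col A i \<bullet> col A i)) = (\<Sum>i<K. real n)"
      proof (intro sum.cong refl)
        fix i assume "i \<in> {..<K}"
        then have "col A i \<bullet> col A i = n * d i" "d i \<noteq> 0" using dcol[of i] d[of i] n by auto
        then show "1 / d i * (col A i \<bullet> col A i) = real n" by simp
      qed
      then show ?thesis by (simp add: mult_ac)
    qed
    obtain B3 where B3: "B3 \<in> events" "prob B3 \<le> sqrt 2 * exp (- x / 4)"
      "\<And>\<omega>. \<omega> \<in> space (gaussian_noise n \<tau>) - B3 \<Longrightarrow>
        (\<Sum>i<K. 1 / d i * ((A\<^sup>T *\<^sub>v Matrix.vec n \<omega>) $ i)\<^sup>2) \<le> x * (\<tau>\<^sup>2 * (n * K))"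
    proof (rule linear_noise_bad_set[OF \<tau> A _ _ V3, of x])
      show "0 < \<tau>\<^sup>2 * real (n * K)" using \<tau> n K by simp
    qed (use d in \<open>auto intro: less_imp_le\<close>)
    \<comment> \<open>Weighting by the reciprocal expectations (up to \<open>\<tau>\<^sup>2\<close>)
      makes every coordinate contribute equally, so one event controls all \<open>K\<close> of
      them.\<close>
    have V4: "\<tau>\<^sup>2 * (\<Sum>i<K. 1 / T (Suc i) * mat_trace (Sigma_mat X ^\<^sub>m Suc i)) \<le> \<tau>\<^sup>2 * K"
    proof -
      have "(\<Sum>i<K. 1 / T (Suc i) * T (Suc i)) = (\<Sum>i<K. 1)"
        by (intro sum.cong refl) (use Tpos in \<open>simp add: less_imp_neq[symmetric]\<close>)
      then show ?thesis by (simp add: T_def)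
    qed
    obtain B4 where B4: "B4 \<in> events" "prob B4 \<le> sqrt 2 * exp (- x / 4)"
      "\<And>\<omega>. \<omega> \<in> space (gaussian_noise n \<tau>) - B4 \<Longrightarrow>
        (\<Sum>i<K. 1 / T (Suc i) * (((krylov_design X K (Matrix.vec n \<omega>))\<^sup>T *\<^sub>v Matrix.vec n \<omega>) $ i))
          \<le> x * (\<tau>\<^sup>2 * K)
        \<and> (\<forall>i<K. 0 \<le> ((krylov_design X K (Matrix.vec n \<omega>))\<^sup>T *\<^sub>v Matrix.vec n \<omega>) $ i)"
    proof (rule krylov_noise_form_bad_set[OF X n \<tau> _ _ V4, of x])
      show "0 < \<tau>\<^sup>2 * real K" using \<tau> K by simp
    qed (use T0 in auto)

    \<comment> \<open>The loss bound outside the exceptional events\<close>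
    define Good where "Good = {\<omega> \<in> space (gaussian_noise n \<tau>).
      (1 / real n) * (enorm (X *\<^sub>v \<beta>_hat (X *\<^sub>v \<beta> + Matrix.vec n \<omega>) - X *\<^sub>v \<beta>))\<^sup>2 \<le> bound}"
    have Good: "Good \<in> events"
    proof -
      have "Good = {\<omega> \<in> space (gaussian_noise n \<tau>).
          (enorm (X *\<^sub>v \<beta>_hat (m + Matrix.vec n \<omega>) - m))\<^sup>2 \<le> n * bound}"
        unfolding Good_def m_def using n by (simp add: field_simps)
      then show ?thesis using pls_loss_measurable[OF X m pls] by simp
    qed
    have sub: "space (gaussian_noise n \<tau>) - (B1 \<union> B2 \<union> B3 \<union> B4) \<subseteq> Good"
    proof
      fix \<omega> assume \<omega>: "\<omega> \<in> space (gaussian_noise n \<tau>) - (B1 \<union> B2 \<union> B3 \<union> B4)"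
      define e where "e = Matrix.vec n \<omega>"
      define H where "H = krylov_design X K e"
      have e: "e \<in> carrier_vec n" by (simp add: e_def)
      have H: "H \<in> carrier_mat n K" unfolding H_def by (rule krylov_design_carrier[OF X])
      have Y: "m + e \<in> carrier_vec n" using m e by simp
      have AH: "krylov_design X K (m + e) = A + H"
        unfolding A_def H_def by (rule krylov_design_add[OF X m e])
      obtain lam where lam: "lam \<in> carrier_vec K" "X *\<^sub>v \<beta>_hat (m + e) = (A + H) *\<^sub>v lam"
        "(A + H)\<^sup>T *\<^sub>v (m + e - (A + H) *\<^sub>v lam) = 0\<^sub>v K"
        using is_pls_normal_equations[OF X Y bspec[OF pls Y]] unfolding AH by metis
      have Na: "real n * a = \<tau>\<^sup>2" using n by (simp add: a_def)
      have E1: "(\<Sum>j<n. \<Sum>i<K. (H $$ (j, i))\<^sup>2 / d i) \<le> real n * r / 4"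
      proof -
        have "(\<Sum>j<n. \<Sum>i<K. (H $$ (j, i))\<^sup>2 / d i) \<le> x * (n / t)"
          using B1(3)[of \<omega>] \<omega> by (simp add: H_def e_def)
        also have "\<dots> \<le> real n * r / 4"
          using tx t r n by (simp add: field_simps)
        finally show ?thesis .
      qed
      have E2: "(\<Sum>j<n. \<Sum>i<K. (H $$ (j, i))\<^sup>2) \<le> real n * x * a * P"
      proof -
        have "(\<Sum>j<n. \<Sum>i<K. (H $$ (j, i))\<^sup>2) \<le> x * ((real n * a) * P)"
          using B2(3)[of \<omega>] \<omega> unfolding Na by (simp add: H_def e_def)
        then show ?thesis by (simp add: mult_ac)
      qed
      have E3: "(\<Sum>i<K. ((A\<^sup>T *\<^sub>v e) $ i)\<^sup>2 / d i) \<le> (real n)\<^sup>2 * x * real K * a"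
      proof -
        have "(\<Sum>i<K. ((A\<^sup>T *\<^sub>v e) $ i)\<^sup>2 / d i) \<le> x * ((real n * a) * (n * K))"
          using B3(3)[of \<omega>] \<omega> unfolding Na by (simp add: e_def)
        then show ?thesis by (simp add: mult_ac power2_eq_square)
      qed
      have E4: "\<bar>(H\<^sup>T *\<^sub>v e) $ i\<bar> \<le> real n * x * real K * a * T (Suc i)" if i: "i < K" for i
      proof -
        have nn: "\<And>i. i < K \<Longrightarrow> 0 \<le> (H\<^sup>T *\<^sub>v e) $ i"
          and s: "(\<Sum>i<K. 1 / T (Suc i) * (H\<^sup>T *\<^sub>v e) $ i) \<le> x * ((real n * a) * K)"
          using B4(3)[of \<omega>] \<omega> unfolding Na by (auto simp: H_def e_def)
        \<comment> \<open>A single term is at most the whole sum because all terms are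
          nonnegative.\<close>
        have "1 / T (Suc i) * (H\<^sup>T *\<^sub>v e) $ i \<le> (\<Sum>i<K. 1 / T (Suc i) * (H\<^sup>T *\<^sub>v e) $ i)"
          by (rule member_le_sum[of i]) (use i nn T0 in auto)
        also note s
        finally show ?thesis using nn[OF i] Tpos[of "Suc i"] by (simp add: field_simps)
      qed
      have low: "real n * r * (\<Sum>i<K. d i * (u $ i)\<^sup>2) \<le> (A *\<^sub>v u) \<bullet> (A *\<^sub>v u)"
        if "u \<in> carrier_vec K" for u
        using min_eigenvalue_R_mat_le[OF X n K \<beta> D that] by (simp add: r_def d_def A_def m_def)
      note main = least_squares_loss_bound[OF A H m e lam(1) \<Lambda>(1) lam(3) dbounds dmin _ r x t a J K
          low E1 E2 E3 E4 TJ signal[unfolded Q_def] tx PL]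
      have dimR: "dim_row (R_mat X \<beta> K) = K"
        using R_mat_symmetric(1)[OF X n K \<beta> D] by simp
      have Ceq: "C \<delta> (R_mat X \<beta> K)
          = 2 * x + 4 * x * (real K)\<^sup>2 / r + 2 * x * real K * sqrt (8 * real K / r + 2 * (real K)\<^sup>2)"
        unfolding C_def Let_def dimR x_def L_def r_def ..
      have shift: "(\<Sum>i=1..K. f i) = (\<Sum>i<K. f (Suc i))" for f :: "nat \<Rightarrow> real"
        using sum.atLeast_Suc_atMost_Suc_shift[of f 0 "K - 1"] K
        by (simp add: lessThan_Suc_atMost[symmetric] atLeast0AtMost)
      have "((A + H) *\<^sub>v lam - m) \<bullet> ((A + H) *\<^sub>v lam - m) / real n
          \<le> 2 / real n * ((m - A *\<^sub>v \<Lambda>) \<bullet> (m - A *\<^sub>v \<Lambda>))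
          + C \<delta> (R_mat X \<beta> K) * a * max (dmax / dmin * (\<Lambda> \<bullet> \<Lambda>) * P)
              (sqrt (dmax / dmin * (\<Lambda> \<bullet> \<Lambda>) * (\<Sum>i<K. (T (Suc i))\<^sup>2)))"
        unfolding Ceq by (rule main) (use n in auto)
      also have "\<dots> \<le> bound"
      proof -
        have "(m - A *\<^sub>v \<Lambda>) \<bullet> (m - A *\<^sub>v \<Lambda>)
            \<le> (INF v \<in> column_span (G_mat X \<beta> K). (enorm (X *\<^sub>v (\<beta> - v)))\<^sup>2)"
          unfolding m_def A_def by (rule INF_column_span_ge[OF X n K \<beta> \<Lambda>])
        then have "2 / real n * ((m - A *\<^sub>v \<Lambda>) \<bullet> (m - A *\<^sub>v \<Lambda>))
            \<le> 2 / real n * (INF v \<in> column_span (G_mat X \<beta> K). (enorm (X *\<^sub>v (\<beta> - v)))\<^sup>2)"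
          by (intro mult_left_mono) auto
        then show ?thesis
          unfolding bound_def cond_number_def max_eigenvalue_def min_eigenvalue_def[of "D_mat X \<beta> K"]
            dmin_def dmax_def P_def T_def \<Lambda>_def a_def enorm_sq shift by simp
      qed
      finally have "(1 / real n) * (enorm (X *\<^sub>v \<beta>_hat (m + e) - m))\<^sup>2 \<le> bound"
        by (simp add: lam(2) enorm_sq)
      then show "\<omega> \<in> Good" using \<omega> by (simp add: Good_def m_def e_def)
    qed

    \<comment> \<open>Union bound over the exceptional events\<close>
    have tail: "4 * (sqrt 2 * exp (- x / 4)) < \<delta>"
    proof -
      have "exp (- x / 4) \<le> exp (- L)" using L by (simp add: x_def)
      also have "\<dots> = \<delta> / (6 * real K)" using \<delta> K by (simp add: L_def exp_minus)
      also have "\<dots> \<le> \<delta> / 6" using \<delta> K by (simp add: field_simps)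
      finally have "exp (- x / 4) \<le> \<delta> / 6" .
      \<comment> \<open>Four events of probability at most \<open>sqrt 2 * \<delta> / 6\<close> stay
        strictly below \<delta>, since 4 times 3/2 is 6; this gives the strict inequality of the
        conclusion.\<close>
      moreover have "sqrt 2 < 3 / 2" by (rule real_less_lsqrt) (auto simp: power2_eq_square)
      ultimately have "sqrt 2 * exp (- x / 4) \<le> sqrt 2 * (\<delta> / 6)" "sqrt 2 * (\<delta> / 6) < 3 / 2 * (\<delta> / 6)"
        using \<delta> by (auto intro: mult_left_mono)
      then show ?thesis using \<delta> by linarith
    qed
    have "1 - \<delta> < 1 - prob (B1 \<union> B2 \<union> B3 \<union> B4)"
    proof -
      have "prob (B1 \<union> B2 \<union> B3 \<union> B4) \<le> prob B1 + prob B2 + prob B3 + prob B4"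
        using measure_Un_le[OF sets.Un[OF sets.Un[OF B1(1) B2(1)] B3(1)] B4(1)]
          measure_Un_le[OF sets.Un[OF B1(1) B2(1)] B3(1)] measure_Un_le[OF B1(1) B2(1)] by linarith
      then show ?thesis using B1(2) B2(2) B3(2) B4(2) tail by linarith
    qed
    also have "\<dots> = prob (space (gaussian_noise n \<tau>) - (B1 \<union> B2 \<union> B3 \<union> B4))"
      by (rule prob_compl[symmetric]) (use B1(1) B2(1) B3(1) B4(1) in auto)
    also have "\<dots> \<le> prob Good" by (rule finite_measure_mono[OF sub Good])
    finally show "1 - \<delta> < \<P>(\<omega> in gaussian_noise n \<tau>.
          (1 / real n) *
            (enorm (X *\<^sub>v \<beta>_hat (X *\<^sub>v \<beta> + Matrix.vec n \<omega>) - X *\<^sub>v \<beta>))\<^sup>2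
          \<le> (2 / real n) * (INF v \<in> column_span (G_mat X \<beta> K). (enorm (X *\<^sub>v (\<beta> - v)))\<^sup>2)
            + C \<delta> (R_mat X \<beta> K) * (\<tau>\<^sup>2 / real n) *
              max (cond_number (D_mat X \<beta> K) * (enorm (Lambda_vec X \<beta> K))\<^sup>2
                     * (\<Sum>i=1..K. mat_trace (Sigma_mat X ^\<^sub>m (2 * i))))
                  (sqrt (cond_number (D_mat X \<beta> K) * (enorm (Lambda_vec X \<beta> K))\<^sup>2
                     * (\<Sum>i=1..K. (mat_trace (Sigma_mat X ^\<^sub>m i))\<^sup>2))))"
      unfolding Good_def bound_def .
  qed
qed

end
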